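(* Let $t>0$. Let $B=\{B_s\}_{s\ge 0}$ be a standard one-dimensional Brownian motion (started at $0$), and let $\mathbf{B}=\{\mathbf{B}_s=(B^1_s,B^2_s,B^3_s)\}_{s\ge 0}$ be a standard three-dimensional Brownian motion (started at the origin). Then the two-dimensional process $$\Bigl(2\max_{0\le u\le s}B_u-B_s,\ B_s\Bigr),\quad 0\le s\le t,$$ is identical in law with the process $$\Bigl(|\mathbf{B}_s|,\ -|\mathbf{B}_s|+\min\Bigl\{2\min_{s\le u\le t}|\mathbf{B}_u|,\ |\mathbf{B}_t|+B^1_t\Bigr\}\Bigr),\quad 0\le s\le t.$$
   Context: $|\cdot|$ is the Euclidean norm on $\mathbb{R}^3$. A standard three-dimensional Brownian motion started at the origin is a triple of independent standard one-dimensional Brownian motions $B^1,B^2,B^3$ started at $0$. "Identical in law" means equality of laws as continuous processes, i.e. as random elements of $C([0,t];\mathbb{R}^2)$ (equivalently, equality of all finite-dimensional distributions). *)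

theory Defs
  imports "HOL-Probability.Probability"
begin

locale standard_brownian_motion = prob_space M
  for M :: "'a measure" and B :: "real \<Rightarrow> 'a \<Rightarrow> real" +
  assumes random_variable_at: "0 \<le> s \<Longrightarrow> B s \<in> borel_measurable M"
    and starts_at_0: "AE \<omega> in M. B 0 \<omega> = 0"
    and independent_increments:
      "0 \<le> \<tau> 0 \<Longrightarrow> mono_on {..n} \<tau> \<Longrightarrow>
        indep_vars (\<lambda>_. borel) (\<lambda>i \<omega>. B (\<tau> (Suc i)) \<omega> - B (\<tau> i) \<omega>) {..<n::nat}"
    and gaussian_increments:
      "0 \<le> r \<Longrightarrow> r < s \<Longrightarrow>
        distributed M lborel (\<lambda>\<omega>. B s \<omega> - B r \<omega>) (normal_density 0 (sqrt (s - r)))"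
    and continuous_paths: "\<omega> \<in> space M \<Longrightarrow> continuous_on {0..} (\<lambda>s. B s \<omega>)"

text \<open>Independence below is that of the coordinate processes as random functions on
  \<open>[0, \<infinity>)\<close>, not merely independence at each fixed time.\<close>

locale standard_brownian_motion_3d = prob_space M
  for M :: "'a measure" and W :: "real \<Rightarrow> 'a \<Rightarrow> real ^ 3" +
  assumes coordinates: "standard_brownian_motion M (\<lambda>s \<omega>. W s \<omega> $ i)"
    and independent_coordinates:
      "indep_vars (\<lambda>_. PiM {0..} (\<lambda>_. borel)) (\<lambda>i \<omega>. \<lambda>s\<in>{0..}. W s \<omega> $ i) UNIV"

text \<open>The measurable space \<open>C([0,t]; E)\<close>. Its \<open>\<sigma>\<close>-algebra is generated by the evaluation maps;
  for separable metric \<open>E\<close> this is the Borel \<open>\<sigma>\<close>-algebra of the topology of uniform convergence.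
  A path is represented by a function that is \<^const>\<open>undefined\<close> outside \<open>[0,t]\<close>.\<close>

definition path_space :: "real \<Rightarrow> (real \<Rightarrow> 'e::topological_space) measure" where
  "path_space t = restrict_space (PiM {0..t} (\<lambda>_. borel)) {f. continuous_on {0..t} f}"

definition path_on :: "real \<Rightarrow> (real \<Rightarrow> 'a \<Rightarrow> 'e) \<Rightarrow> 'a \<Rightarrow> real \<Rightarrow> 'e" where
  "path_on t X \<omega> = (\<lambda>s\<in>{0..t}. X s \<omega>)"

text \<open>The two measurability conditions are part of the definition because \<^const>\<open>distr\<close> is
  meaningful only for measurable maps.\<close>

definition identical_in_law_on ::
  "real \<Rightarrow> 'a measure \<Rightarrow> (real \<Rightarrow> 'a \<Rightarrow> 'e::topological_space) \<Rightarrow>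
    'b measure \<Rightarrow> (real \<Rightarrow> 'b \<Rightarrow> 'e) \<Rightarrow> bool" where
  "identical_in_law_on t M X N Y \<longleftrightarrow>
    path_on t X \<in> measurable M (path_space t) \<and>
    path_on t Y \<in> measurable N (path_space t) \<and>
    distr M (path_space t) (path_on t X) = distr N (path_space t) (path_on t Y)"

text \<open>Maxima and minima of a process over compact time intervals are written with \<^const>\<open>Sup\<close> and
  \<^const>\<open>Inf\<close>; for continuous paths they are attained. (\<^const>\<open>Max\<close> and \<^const>\<open>Min\<close> are only
  specified for finite sets.)\<close>

end

theory Submission
  imports Defs
begin

text \<open>
  Write \<open>S\<close> for the running maximum of \<open>B\<close> and \<open>R = 2 S - B\<close>. The statement is Pitman's theorem on a
  finite horizon, and it splits into a pathwise part and a part about finite-dimensional laws.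

  Pathwise, \<open>B\<close> can be read off from \<open>R\<close> on \<open>[0,t]\<close> together with the endpoint \<open>B\<^sub>t\<close>:
  \<open>R\<close> never falls below the current maximum, and if \<open>S\<close> increases after time \<open>s\<close>, then \<open>R\<close> equals
  \<open>S\<^sub>s\<close> at the first time from \<open>s\<close> on at which \<open>B\<close> is at the level \<open>S\<^sub>s\<close>. Hence \<open>S\<^sub>s\<close> is the minimum of
  \<open>S\<^sub>t\<close> and of the infimum of \<open>R\<close> over \<open>[s,t]\<close>, where \<open>2 S\<^sub>t = R\<^sub>t + B\<^sub>t\<close>
  (\<open>reflected_path_inversion\<close>). The second process of the theorem applies the same map
  \<open>recover_pair\<close> to \<open>|W|\<close> on \<open>[0,t]\<close> and the endpoint \<open>W\<^sup>1\<^sub>t\<close>. So it suffices that \<open>R\<close> with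
  endpoint \<open>B\<^sub>t\<close> and \<open>|W|\<close> with endpoint \<open>W\<^sup>1\<^sub>t\<close> have the same law, and for this only the laws of
  \<open>(R\<^bsub>s\<^sub>1\<^esub>, ..., R\<^bsub>s\<^sub>n\<^esub>, B\<^bsub>s\<^sub>n\<^esub>)\<close> and of its counterpart matter, with \<open>s\<^sub>n = t\<close>.

  Both are computed time by time. Call \<open>R\<close> and \<open>|W|\<close> the radius, and \<open>B\<close> and \<open>W\<^sup>1\<close> the position. Fix sets
  \<open>A\<^sub>1, ..., A\<^sub>n\<close> and restrict to the event that the radius was in \<open>A\<^sub>i\<close> at each time \<open>s\<^sub>i\<close> so far. On either
  side the joint law of the present radius and position on this event has a density \<open>f(r)\<close> on the fan
  \<open>|b| \<le> r\<close>: given the radius, the position is uniform on \<open>[-r,r]\<close>. On either side the weight \<open>f\<close> starts as \<open>(r/h) \<phi>\<^sub>h(r)\<close>, with \<open>\<phi>\<^sub>h\<close> the centred Gaussian density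
  of variance \<open>h\<close>, evolves by the transition density \<open>\<phi>\<^sub>h(r - y) - \<phi>\<^sub>h(r + y)\<close> of Brownian motion killed at
  \<open>0\<close>, and is cut down to \<open>A\<^sub>i\<close> at time \<open>s\<^sub>i\<close> (\<open>path_weight\<close>).

  For \<open>R\<close> this is an intertwining in the sense of Rogers and Pitman. The reflection principle gives the law
  of an increment on the event that it stays below a level (\<open>killed_law\<close>), the increment is
  independent of the past, and averaging over the uniform fibre
  reduces the evolution of a fan to one Gaussian identity (\<open>killed_density_exchange\<close>).
  For \<open>|W|\<close> the law of \<open>W\<close> on the event is rotation invariant with density
  \<open>f(|x|) / (2 \<pi> |x|)\<close>. By Archimedes' theorem on spherical zones its image under \<open>x \<mapsto> (|x|, x\<^sub>1)\<close> is
  the fan of \<open>f\<close>, and convolution with a Gaussian in space induces the same evolution of \<open>f\<close>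
  (\<open>radial_gauss3_convolution\<close>).
\<close>

section \<open>Running maxima and future infima of continuous paths\<close>

lemma closure_unit_interval_rationals: "closure ({0..1} \<inter> \<rat>) = {0..1::real}"
proof
  show "closure ({0..1} \<inter> \<rat>) \<subseteq> {0..1::real}"
    by (intro closure_minimal) auto
  have "{0<..<1::real} \<subseteq> closure ({0..1} \<inter> \<rat>)"
    using open_Int_closure_subset[of "{0<..<1::real}" "\<rat>"] closure_mono[of "{0<..<1::real} \<inter> \<rat>" "{0..1} \<inter> \<rat>"]
    by (auto simp: Rats_closure_real subset_iff)
  from closure_mono[OF this] show "{0..1::real} \<subseteq> closure ({0..1} \<inter> \<rat>)"
    by simp
qed

lemma cINF_rationals:
  fixes g :: "real \<Rightarrow> real"
  assumes g: "continuous_on {0..1} g"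
  shows "(INF q\<in>{0..1} \<inter> \<rat>. g q) = (INF q\<in>{0..1}. g q)"
proof (rule antisym)
  have bdd: "bdd_below (g ` {0..1})"
    using compact_continuous_image[OF g] by (auto intro: bounded_imp_bdd_below compact_imp_bounded)
  then have bdd': "bdd_below (g ` ({0..1} \<inter> \<rat>))"
    by (rule bdd_below_mono) auto
  show "(INF q\<in>{0..1}. g q) \<le> (INF q\<in>{0..1} \<inter> \<rat>. g q)"
  proof (rule cINF_superset_mono)
    show "{0..1} \<inter> \<rat> \<noteq> ({} :: real set)"
      using Rats_0 by (auto intro!: exI[of _ 0] simp: ex_in_conv[symmetric] simp del: ex_in_conv)
  qed (use bdd in auto)
  show "(INF q\<in>{0..1} \<inter> \<rat>. g q) \<le> (INF q\<in>{0..1}. g q)"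
  proof (rule cINF_greatest)
    fix q :: real assume "q \<in> {0..1}"
    then show "(INF q\<in>{0..1} \<inter> \<rat>. g q) \<le> g q"
    proof (intro continuous_ge_on_closure[of "{0..1} \<inter> \<rat>" g q])
      show "(INF q\<in>{0..1} \<inter> \<rat>. g q) \<le> g u" if "u \<in> {0..1} \<inter> \<rat>" for u
        using that by (intro cINF_lower bdd')
    qed (simp_all only: closure_unit_interval_rationals g)
  qed simp
qed

text \<open>An infimum over an interval, written with countably many coordinates so that it is measurable in
  the product \<open>\<sigma>\<close>-algebra. Rescaling \<open>[s,t]\<close> to \<open>[0,1]\<close> lets one countable dense set serve
  all intervals and keeps both endpoints in it.\<close>

definition inf_path :: "real \<Rightarrow> real \<Rightarrow> (real \<Rightarrow> real) \<Rightarrow> real" where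
  "inf_path s t x = (INF q\<in>{0..1} \<inter> \<rat>. x (s + (t - s) * q))"

lemma inf_path_eq:
  assumes "s \<le> t" "continuous_on {s..t} x"
  shows "(INF u\<in>{s..t}. x u) = inf_path s t x"
proof -
  have im: "(\<lambda>q. s + (t - s) * q) ` {0..1} = {s..t}"
    using image_affinity_atLeastAtMost[of "t - s" s 0 "1::real"] assms(1) by (simp add: add.commute)
  have "continuous_on {0..1} (\<lambda>q. x (s + (t - s) * q))"
    by (rule continuous_on_compose2[OF assms(2)]) (use im in \<open>auto intro!: continuous_intros\<close>)
  from cINF_rationals[OF this] show ?thesis
    unfolding inf_path_def im[symmetric] by (simp add: image_image)
qed

lemma inf_path_cong:
  assumes "s \<le> t" "\<And>u. u \<in> {s..t} \<Longrightarrow> x u = y u"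
  shows "inf_path s t x = inf_path s t y"
  unfolding inf_path_def
proof (rule INF_cong)
  fix q :: real assume "q \<in> {0..1} \<inter> \<rat>"
  then have "s + (t - s) * q \<in> {s..t}"
    using assms(1) mult_left_mono[of q 1 "t - s"] by auto
  then show "x (s + (t - s) * q) = y (s + (t - s) * q)"
    by (rule assms(2))
qed simp

lemma inf_path_measurable:
  assumes "s \<le> t" "{s..t} \<subseteq> I"
  shows "inf_path s t \<in> borel_measurable (PiM I (\<lambda>_. borel))"
  unfolding inf_path_def
proof (rule borel_measurable_cINF_real)
  show "countable ({0..1} \<inter> \<rat> :: real set)"
    by (intro countable_Int2 countable_rat)
  fix q :: real assume "q \<in> {0..1} \<inter> \<rat>"
  then have "s + (t - s) * q \<in> {s..t}"
    using assms(1) mult_left_mono[of q 1 "t - s"] by auto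
  with assms(2) show "(\<lambda>x. x (s + (t - s) * q)) \<in> borel_measurable (PiM I (\<lambda>_. borel :: real measure))"
    by (intro measurable_component_singleton) auto
qed

definition sup_path :: "real \<Rightarrow> real \<Rightarrow> (real \<Rightarrow> real) \<Rightarrow> real" where
  "sup_path s t x = - inf_path s t (\<lambda>u. - x u)"

lemma sup_path_eq:
  assumes "s \<le> t" "continuous_on {s..t} x"
  shows "(SUP u\<in>{s..t}. x u) = sup_path s t x"
proof -
  have "(SUP u\<in>{s..t}. x u) = - (INF u\<in>{s..t}. - x u)"
    by (simp add: Inf_real_def image_image)
  also have "\<dots> = sup_path s t x"
    unfolding sup_path_def using assms by (subst inf_path_eq) (auto intro: continuous_intros)
  finally show ?thesis .
qed

lemma sup_path_cong:
  assumes "s \<le> t" "\<And>u. u \<in> {s..t} \<Longrightarrow> x u = y u"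
  shows "sup_path s t x = sup_path s t y"
  unfolding sup_path_def using assms inf_path_cong[of s t "\<lambda>u. - x u" "\<lambda>u. - y u"] by simp

lemma sup_path_measurable:
  assumes "s \<le> t" "{s..t} \<subseteq> I"
  shows "sup_path s t \<in> borel_measurable (PiM I (\<lambda>_. borel))"
proof -
  have "(\<lambda>x. - inf_path s t (\<lambda>u\<in>I. - x u)) \<in> borel_measurable (PiM I (\<lambda>_. borel))"
    by (intro borel_measurable_uminus measurable_compose[OF _ inf_path_measurable[OF assms]]
      measurable_restrict measurable_component_singleton)
  moreover have "inf_path s t (\<lambda>u\<in>I. - x u) = inf_path s t (\<lambda>u. - x u)" for x :: "real \<Rightarrow> real"
    using assms by (intro inf_path_cong) auto
  ultimately show ?thesis
    by (simp add: sup_path_def[abs_def])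
qed

lemma SUP_path_ge:
  fixes x :: "real \<Rightarrow> real"
  assumes "continuous_on {s..t} x" "u \<in> {s..t}"
  shows "x u \<le> (SUP v\<in>{s..t}. x v)"
  using compact_continuous_image[OF assms(1)] assms(2)
  by (auto intro!: cSUP_upper bounded_imp_bdd_above compact_imp_bounded)

lemma INF_path_le:
  fixes x :: "real \<Rightarrow> real"
  assumes "continuous_on {s..t} x" "u \<in> {s..t}"
  shows "(INF v\<in>{s..t}. x v) \<le> x u"
  using compact_continuous_image[OF assms(1)] assms(2)
  by (auto intro!: cINF_lower bounded_imp_bdd_below compact_imp_bounded)

lemma less_SUP_path_iff:
  fixes x :: "real \<Rightarrow> real"
  assumes "continuous_on {s..t} x" "s \<le> t"
  shows "a < (SUP v\<in>{s..t}. x v) \<longleftrightarrow> (\<exists>u\<in>{s..t}. a < x u)"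
  using compact_continuous_image[OF assms(1)] assms(2)
  by (auto intro!: less_cSUP_iff bounded_imp_bdd_above compact_imp_bounded)

text \<open>The Markov property of \<open>(S, B)\<close> rests on this: the maximum at a later time is a function of the
  maximum so far and of the path in between.\<close>

lemma SUP_path_split:
  fixes x :: "real \<Rightarrow> real"
  assumes "continuous_on {r..t} x" "r \<le> s" "s \<le> t"
  shows "(SUP u\<in>{r..t}. x u) = max (SUP u\<in>{r..s}. x u) (SUP u\<in>{s..t}. x u)"
proof -
  have c: "continuous_on {r..s} x" "continuous_on {s..t} x"
    using assms by (auto elim: continuous_on_subset)
  have "(\<Union>{x ` {r..s}, x ` {s..t}}) = x ` {r..t}"
    using assms(2,3) by (auto simp: image_Un[symmetric] ivl_disj_un_two_touch)
  then have "(SUP u\<in>{r..t}. x u) = Sup (x ` {r..s} \<union> x ` {s..t})"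
    by simp
  also have "\<dots> = max (SUP u\<in>{r..s}. x u) (SUP u\<in>{s..t}. x u)"
    using assms(2,3) compact_continuous_image[OF c(1)] compact_continuous_image[OF c(2)]
    by (subst cSup_union_distrib) (auto simp: sup_max intro!: bounded_imp_bdd_above compact_imp_bounded)
  finally show ?thesis .
qed

text \<open>Over a short interval the maximum grows by at most the oscillation of the path there, because the
  path does not start the interval above its maximum so far.\<close>

lemma continuous_on_running_SUP:
  fixes x :: "real \<Rightarrow> real"
  assumes x: "continuous_on {0..t} x"
  shows "continuous_on {0..t} (\<lambda>s. SUP u\<in>{0..s}. x u)"
proof -
  let ?m = "\<lambda>s. SUP u\<in>{0..s}. x u"
  have "uniformly_continuous_on {0..t} x"
    using x by (intro compact_uniformly_continuous) auto
  have near: "\<exists>d>0. \<forall>r s. 0 \<le> r \<longrightarrow> r \<le> s \<longrightarrow> s \<le> t \<longrightarrow> s - r < d \<longrightarrow> ?m r \<le> ?m s \<and> ?m s < ?m r + e" if "0 < e" for e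
  proof -
    have "0 < e / 2" using that by simp
    with \<open>uniformly_continuous_on {0..t} x\<close>
    have "\<exists>d>0. \<forall>u\<in>{0..t}. \<forall>v\<in>{0..t}. dist v u < d \<longrightarrow> dist (x v) (x u) < e / 2"
      unfolding uniformly_continuous_on_def by blast
    then obtain d where d: "0 < d" "\<And>u v. u \<in> {0..t} \<Longrightarrow> v \<in> {0..t} \<Longrightarrow> \<bar>v - u\<bar> < d \<Longrightarrow> \<bar>x v - x u\<bar> < e / 2"
      unfolding dist_real_def by blast
    have "?m r \<le> ?m s \<and> ?m s < ?m r + e" if rs: "0 \<le> r" "r \<le> s" "s \<le> t" "s - r < d" for r s
    proof -
      have c: "continuous_on {0..s} x" "continuous_on {0..r} x"
        by (rule continuous_on_subset[OF x]; use rs in auto)+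
      have split: "?m s = max (?m r) (SUP u\<in>{r..s}. x u)"
        using SUP_path_split[OF c(1) rs(1,2)] .
      have "(SUP u\<in>{r..s}. x u) \<le> x r + e / 2"
      proof (rule cSUP_least)
        fix u assume "u \<in> {r..s}"
        then have "\<bar>x u - x r\<bar> < e / 2"
          using rs by (intro d(2)) auto
        then show "x u \<le> x r + e / 2"
          by linarith
      qed (use rs in auto)
      moreover have "x r \<le> ?m r"
        using SUP_path_ge[OF c(2), of r] rs by simp
      ultimately show ?thesis
        unfolding split using \<open>0 < e\<close> by auto
    qed
    then show ?thesis using d(1) by blast
  qed
  show ?thesis
    unfolding continuous_on_iff
  proof (intro ballI allI impI)
    fix s e :: real assume s: "s \<in> {0..t}" and e: "0 < e"
    obtain d where d: "0 < d" "\<And>r s. 0 \<le> r \<Longrightarrow> r \<le> s \<Longrightarrow> s \<le> t \<Longrightarrow> s - r < d \<Longrightarrow> ?m r \<le> ?m s \<and> ?m s < ?m r + e"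
      using near[OF e] by blast
    have "dist (?m r) (?m s) < e" if "r \<in> {0..t}" "dist r s < d" for r
      using d(2)[of r s] d(2)[of s r] s that by (cases "r \<le> s") (auto simp: dist_real_def)
    then show "\<exists>d>0. \<forall>r\<in>{0..t}. dist r s < d \<longrightarrow> dist (?m r) (?m s) < e"
      using d(1) by blast
  qed
qed

text \<open>Reversing time and sign turns this into the preceding lemma.\<close>

lemma continuous_on_future_INF:
  fixes x :: "real \<Rightarrow> real"
  assumes x: "continuous_on {0..t} x"
  shows "continuous_on {0..t} (\<lambda>s. INF u\<in>{s..t}. x u)"
proof -
  let ?y = "\<lambda>v. - x (t - v)"
  have eq: "(INF u\<in>{s..t}. x u) = - (SUP v\<in>{0..t - s}. ?y v)" for s
  proof -
    have "{s..t} = (-) t ` {0..t - s}"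
      by (simp add: image_diff_atLeastAtMost)
    then have "x ` {s..t} = (\<lambda>v. x (t - v)) ` {0..t - s}"
      by (simp only: image_image)
    then show ?thesis
      by (simp add: Inf_real_def image_image)
  qed
  have "continuous_on {0..t} ?y"
    by (intro continuous_intros continuous_on_compose2[OF x]) auto
  from continuous_on_running_SUP[OF this]
  have "continuous_on {0..t} (\<lambda>s. - (SUP v\<in>{0..t - s}. ?y v))"
    by (intro continuous_on_minus continuous_on_compose2[where f = "\<lambda>s. t - s" and g = "\<lambda>s. SUP v\<in>{0..s}. ?y v"])
      (auto intro!: continuous_intros)
  then show ?thesis
    unfolding eq .
qed

text \<open>With \<open>r = 2 m - x\<close> the left-hand side uses \<open>r\<close> on \<open>[s,t]\<close> and \<open>2 m(t) = r(t) + x(t)\<close> only, so the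
  identity recovers \<open>m\<close>, and with it \<open>x = 2 m - r\<close>, from \<open>r\<close> and the endpoint. Always \<open>r \<ge> m\<close>. If \<open>m\<close>
  increases after \<open>s\<close>, let \<open>u\<close> be the first time after \<open>s\<close> with \<open>x(u) \<ge> m(s)\<close>; then
  \<open>x(u) = m(u) = m(s)\<close>, so \<open>r(u) = m(s)\<close> and the infimum is attained. If \<open>m\<close> does not increase,
  the term \<open>2 m(t)\<close> takes over.\<close>

lemma reflected_path_inversion:
  fixes x :: "real \<Rightarrow> real"
  assumes x: "continuous_on {0..t} x" and s: "0 \<le> s" "s \<le> t"
  defines "m \<equiv> \<lambda>u. SUP v\<in>{0..u}. x v"
  assumes r: "continuous_on {s..t} (\<lambda>u. 2 * m u - x u)"
  shows "min (2 * (INF u\<in>{s..t}. 2 * m u - x u)) (2 * m t) = 2 * m s"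
proof -
  have m_at: "m u = (SUP v\<in>{0..u}. x v)" for u
    by (simp add: m_def)
  have c: "continuous_on {0..u} x" if "u \<le> t" for u
    using x by (rule continuous_on_subset) (use that in auto)
  have m_ge: "x v \<le> m u" if "0 \<le> v" "v \<le> u" "u \<le> t" for u v
    unfolding m_def using SUP_path_ge[OF c[OF that(3)], of v] that by simp
  have m_le: "m u \<le> b" if "0 \<le> u" "\<And>v. 0 \<le> v \<Longrightarrow> v \<le> u \<Longrightarrow> x v \<le> b" for u b
    unfolding m_def using that by (intro cSUP_least) auto
  have m_mono: "m u \<le> m v" if "0 \<le> u" "u \<le> v" "v \<le> t" for u v
    using that by (intro m_le m_ge) auto
  have le: "2 * m s \<le> 2 * m t"
    using m_mono[of s t] s by simp
  have inf_ge: "m s \<le> (INF u\<in>{s..t}. 2 * m u - x u)"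
  proof (rule cINF_greatest)
    fix u assume "u \<in> {s..t}"
    then show "m s \<le> 2 * m u - x u"
      using m_mono[of s u] m_ge[of u u] s by auto
  qed (use s in auto)
  show ?thesis
  proof (cases "m t = m s")
    case True
    then show ?thesis using inf_ge by simp
  next
    case False
    then have "m s < m t" using le by simp
    then obtain v where v: "v \<in> {0..t}" "m s < x v"
      unfolding m_at[of t] using less_SUP_path_iff[OF x] s by auto
    have "s \<le> v"
      using m_ge[of v s] v s by force
    \<comment> \<open>The first time after \<open>s\<close> at which the path is back at the level of its maximum.\<close>
    let ?Z = "{u \<in> {s..t}. m s \<le> x u}"
    have "closed ?Z"
      using continuous_on_subset[OF x, of "{s..t}"] s
        continuous_closed_preimage[of "{s..t}" x "{m s..}"]
      by (simp add: vimage_def Int_def)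
    then have "compact ?Z"
      using compact_Int_closed[of "{s..t}" ?Z] by (simp add: Int_absorb1 Int_absorb2 subset_iff Collect_conj_eq)
    moreover have "v \<in> ?Z" using v \<open>s \<le> v\<close> by simp
    ultimately obtain u where u: "u \<in> ?Z" "\<And>w. w \<in> ?Z \<Longrightarrow> u \<le> w"
      using compact_attains_inf[of ?Z] by blast
    have before: "x w \<le> m s" if "0 \<le> w" "w < u" for w
      using u(2)[of w] u(1) m_ge[of w s] that s by (cases "w \<le> s") force+
    have "x u \<le> m s"
    proof (cases "u = s")
      case True
      then show ?thesis using m_ge[of s s] s by simp
    next
      case False
      then have su: "s < u" "u \<le> t" using u(1) by auto
      have "continuous_on (closure {s<..<u}) x"
        using continuous_on_subset[OF x, of "{s..u}"] su s by (simp add: closure_greaterThanLessThan)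
      from continuous_le_on_closure[OF this, of u "m s"] su before s
      show ?thesis by (auto simp: closure_greaterThanLessThan)
    qed
    then have xu: "x u = m s" using u(1) by simp
    have "m u \<le> m s"
      using before xu u(1) s by (intro m_le) (auto simp: le_less)
    then have mu: "m u = m s"
      using m_mono[of s u] u(1) s by simp
    have "(INF u\<in>{s..t}. 2 * m u - x u) \<le> 2 * m u - x u"
      using INF_path_le[OF r] u(1) by auto
    then have "(INF u\<in>{s..t}. 2 * m u - x u) = m s"
      using inf_ge mu xu by simp
    then show ?thesis using le by simp
  qed
qed

section \<open>Independence, and laws on an event\<close>

lemma sigma_sets_vimage_generator:
  assumes "X \<in> measurable M S" "sets S = sigma_sets (space S) E" "E \<subseteq> Pow (space S)"
  shows "sigma_sets (space M) {X -` A \<inter> space M | A. A \<in> sets S}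
      = sigma_sets (space M) {X -` A \<inter> space M | A. A \<in> E}"
proof -
  have X: "X \<in> space M \<rightarrow> space S"
    using assms(1) by (auto simp: measurable_def)
  show ?thesis
    unfolding sigma_sets_vimage_commute[OF X, symmetric] assms(2)
    by (subst sigma_sets_sigma_sets_eq) (use assms(3) in auto)
qed

lemma Int_stable_vimage:
  assumes "Int_stable E"
  shows "Int_stable {X -` A \<inter> \<Omega> | A. A \<in> E}"
proof (rule Int_stableI)
  fix a b assume "a \<in> {X -` A \<inter> \<Omega> | A. A \<in> E}" "b \<in> {X -` A \<inter> \<Omega> | A. A \<in> E}"
  then obtain A B where "a = X -` A \<inter> \<Omega>" "b = X -` B \<inter> \<Omega>" "A \<in> E" "B \<in> E"
    by auto
  then show "a \<inter> b \<in> {X -` A \<inter> \<Omega> | A. A \<in> E}"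
    using Int_stableD[OF assms, of A B] by (auto intro!: exI[of _ "A \<inter> B"])
qed

lemma (in prob_space) indep_var_generatorI:
  assumes X: "random_variable S X" and Y: "random_variable T Y"
    and S: "sets S = sigma_sets (space S) E" "E \<subseteq> Pow (space S)" "Int_stable E"
    and T: "sets T = sigma_sets (space T) F" "F \<subseteq> Pow (space T)" "Int_stable F"
    and eq: "\<And>a b. a \<in> E \<Longrightarrow> b \<in> F \<Longrightarrow>
      prob ((X -` a \<inter> space M) \<inter> (Y -` b \<inter> space M)) = prob (X -` a \<inter> space M) * prob (Y -` b \<inter> space M)"
  shows "indep_var S X T Y"
proof -
  have "indep_set {X -` A \<inter> space M | A. A \<in> E} {Y -` A \<inter> space M | A. A \<in> F}"
  proof (rule indep_setI)
    show "{X -` A \<inter> space M | A. A \<in> E} \<subseteq> events"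
      using X S by (auto intro!: measurable_sets[OF X])
    show "{Y -` A \<inter> space M | A. A \<in> F} \<subseteq> events"
      using Y T by (auto intro!: measurable_sets[OF Y])
  qed (use eq in auto)
  then show ?thesis
    unfolding indep_var_eq sigma_sets_vimage_generator[OF X S(1,2)] sigma_sets_vimage_generator[OF Y T(1,2)]
    using X Y S(3) T(3) by (auto intro!: indep_set_sigma_sets Int_stable_vimage)
qed

lemma (in prob_space) indep_var_cong_space:
  assumes "indep_var S X T Y"
    and "\<And>\<omega>. \<omega> \<in> space M \<Longrightarrow> X' \<omega> = X \<omega>" "\<And>\<omega>. \<omega> \<in> space M \<Longrightarrow> Y' \<omega> = Y \<omega>"
  shows "indep_var S X' T Y'"
proof -
  have "X' \<in> measurable M S \<longleftrightarrow> X \<in> measurable M S" "Y' \<in> measurable M T \<longleftrightarrow> Y \<in> measurable M T"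
    using assms by (auto intro!: measurable_cong)
  moreover have "distr M S X' = distr M S X" "distr M T Y' = distr M T Y"
    "distr M (S \<Otimes>\<^sub>M T) (\<lambda>x. (X' x, Y' x)) = distr M (S \<Otimes>\<^sub>M T) (\<lambda>x. (X x, Y x))"
    using assms by (auto intro!: distr_cong)
  ultimately show ?thesis
    using assms(1) unfolding indep_var_distribution_eq by simp
qed

text \<open>Independence of two random variables whose values may have different types, such as a path and
  a number.\<close>

definition (in prob_space) independent_pair ::
    "'b measure \<Rightarrow> ('a \<Rightarrow> 'b) \<Rightarrow> 'c measure \<Rightarrow> ('a \<Rightarrow> 'c) \<Rightarrow> bool" where
  "independent_pair S X T Y \<longleftrightarrow> X \<in> measurable M S \<and> Y \<in> measurable M T \<and>
    distr M (S \<Otimes>\<^sub>M T) (\<lambda>\<omega>. (X \<omega>, Y \<omega>)) = distr M S X \<Otimes>\<^sub>M distr M T Y"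

lemma (in prob_space) independent_pair_of_indep_var:
  "indep_var S X T Y \<Longrightarrow> independent_pair S X T Y"
  unfolding independent_pair_def indep_var_distribution_eq by simp

lemma (in prob_space) independent_pair_compose:
  assumes "independent_pair S X T Y" and f: "f \<in> measurable S S'" and g: "g \<in> measurable T T'"
  shows "independent_pair S' (\<lambda>\<omega>. f (X \<omega>)) T' (\<lambda>\<omega>. g (Y \<omega>))"
proof -
  have [measurable]: "X \<in> measurable M S" "Y \<in> measurable M T" "f \<in> measurable S S'" "g \<in> measurable T T'"
    and eq: "distr M (S \<Otimes>\<^sub>M T) (\<lambda>\<omega>. (X \<omega>, Y \<omega>)) = distr M S X \<Otimes>\<^sub>M distr M T Y"
    using assms by (auto simp: independent_pair_def)
  interpret X: prob_space "distr M S X" by (rule prob_space_distr) measurable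
  interpret Y: prob_space "distr M T Y" by (rule prob_space_distr) measurable
  interpret Y': prob_space "distr (distr M T Y) T' g" by (rule Y.prob_space_distr) measurable
  have "distr M (S' \<Otimes>\<^sub>M T') (\<lambda>\<omega>. (f (X \<omega>), g (Y \<omega>))) =
      distr (distr M (S \<Otimes>\<^sub>M T) (\<lambda>\<omega>. (X \<omega>, Y \<omega>))) (S' \<Otimes>\<^sub>M T') (\<lambda>(x, y). (f x, g y))"
    by (subst distr_distr) (auto simp: comp_def)
  also have "\<dots> = distr (distr M S X) S' f \<Otimes>\<^sub>M distr (distr M T Y) T' g"
    unfolding eq by (rule pair_measure_distr[symmetric]) (auto intro: Y'.sigma_finite_measure_axioms)
  finally show ?thesis
    by (simp add: independent_pair_def distr_distr comp_def)
qed

text \<open>Fubini's theorem for independent variables: a function of the past and the future may be averaged over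
  an independent copy of the future first.\<close>

lemma (in prob_space) nn_integral_independent_pair:
  assumes "independent_pair S X T Y" and [measurable]: "F \<in> borel_measurable (S \<Otimes>\<^sub>M T)"
  shows "(\<integral>\<^sup>+\<omega>. F (X \<omega>, Y \<omega>) \<partial>M) = (\<integral>\<^sup>+\<omega>. (\<integral>\<^sup>+\<eta>. F (X \<omega>, Y \<eta>) \<partial>M) \<partial>M)"
proof -
  have [measurable]: "X \<in> measurable M S" "Y \<in> measurable M T"
    and eq: "distr M (S \<Otimes>\<^sub>M T) (\<lambda>\<omega>. (X \<omega>, Y \<omega>)) = distr M S X \<Otimes>\<^sub>M distr M T Y"
    using assms by (auto simp: independent_pair_def)
  interpret Y: prob_space "distr M T Y" by (rule prob_space_distr) measurable
  have "(\<integral>\<^sup>+\<omega>. F (X \<omega>, Y \<omega>) \<partial>M) = (\<integral>\<^sup>+p. F p \<partial>distr M (S \<Otimes>\<^sub>M T) (\<lambda>\<omega>. (X \<omega>, Y \<omega>)))"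
    by (subst nn_integral_distr) auto
  also have "\<dots> = (\<integral>\<^sup>+x. (\<integral>\<^sup>+y. F (x, y) \<partial>distr M T Y) \<partial>distr M S X)"
    unfolding eq by (rule Y.nn_integral_fst[symmetric]) measurable
  also have "\<dots> = (\<integral>\<^sup>+\<omega>. (\<integral>\<^sup>+y. F (X \<omega>, y) \<partial>distr M T Y) \<partial>M)"
    by (rule nn_integral_distr) measurable
  also have "\<dots> = (\<integral>\<^sup>+\<omega>. (\<integral>\<^sup>+\<eta>. F (X \<omega>, Y \<eta>) \<partial>M) \<partial>M)"
  proof (rule nn_integral_cong)
    fix \<omega> assume "\<omega> \<in> space M"
    then have [measurable]: "X \<omega> \<in> space S"
      by (rule measurable_space[rotated]) measurable
    show "(\<integral>\<^sup>+y. F (X \<omega>, y) \<partial>distr M T Y) = (\<integral>\<^sup>+\<eta>. F (X \<omega>, Y \<eta>) \<partial>M)"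
      by (rule nn_integral_distr) measurable
  qed
  finally show ?thesis .
qed

text \<open>The probabilistic content of every reflection argument: flipping the sign of a symmetric variable that
  is independent of \<open>U\<close> does not change the joint law with \<open>U\<close>.\<close>

lemma (in prob_space) independent_symmetric_reflection:
  assumes ind: "independent_pair S U borel (V :: 'a \<Rightarrow> real)"
    and sym: "distr M borel (\<lambda>\<omega>. - V \<omega>) = distr M borel V"
    and A: "A \<in> sets (S \<Otimes>\<^sub>M borel)"
  shows "prob {\<omega> \<in> space M. (U \<omega>, V \<omega>) \<in> A} = prob {\<omega> \<in> space M. (U \<omega>, - V \<omega>) \<in> A}"
proof -
  have [measurable]: "U \<in> measurable M S" "V \<in> borel_measurable M"
    using ind by (auto simp: independent_pair_def)
  have "independent_pair S U borel (\<lambda>\<omega>. - V \<omega>)"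
    using independent_pair_compose[OF ind, of "\<lambda>x. x" S uminus borel] by simp
  then have "distr M (S \<Otimes>\<^sub>M borel) (\<lambda>\<omega>. (U \<omega>, V \<omega>)) = distr M (S \<Otimes>\<^sub>M borel) (\<lambda>\<omega>. (U \<omega>, - V \<omega>))"
    using ind sym by (simp add: independent_pair_def)
  then have "measure (distr M (S \<Otimes>\<^sub>M borel) (\<lambda>\<omega>. (U \<omega>, V \<omega>))) A =
      measure (distr M (S \<Otimes>\<^sub>M borel) (\<lambda>\<omega>. (U \<omega>, - V \<omega>))) A"
    by simp
  then show ?thesis
    using A by (simp add: measure_distr vimage_def Int_def conj_commute)
qed

lemma (in prob_space) prob_tendsto_of_AE:
  assumes "\<And>n. A n \<in> events" "A' \<in> events"
    and "AE \<omega> in M. \<forall>\<^sub>F n in sequentially. \<omega> \<in> A n \<longleftrightarrow> \<omega> \<in> A'"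
  shows "(\<lambda>n. prob (A n)) \<longlonglongrightarrow> prob A'"
proof -
  have "(\<lambda>n. (\<integral>\<omega>. indicator (A n) \<omega> \<partial>M)) \<longlonglongrightarrow> ((\<integral>\<omega>. indicator A' \<omega> \<partial>M) :: real)"
  proof (rule integral_dominated_convergence[where w = "\<lambda>_. 1"])
    show "AE \<omega> in M. (\<lambda>n. indicator (A n) \<omega>) \<longlonglongrightarrow> (indicator A' \<omega> :: real)"
      using assms(3)
    proof eventually_elim
      case (elim \<omega>)
      then show ?case
        by (intro tendsto_eventually) (auto elim!: eventually_mono simp: indicator_def)
    qed
  qed (use assms in \<open>auto simp: indicator_def\<close>)
  then show ?thesis
    using assms by (simp add: Int_absorb1 sets.sets_into_space)
qed

text \<open>The law of \<open>Z\<close> restricted to the event \<open>E\<close>, without renormalisation: its total mass is the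
  probability of \<open>E\<close>. Finite-dimensional laws are computed by shrinking \<open>E\<close> step by step.\<close>

definition law_on :: "'a measure \<Rightarrow> 'a set \<Rightarrow> ('a \<Rightarrow> 'c::topological_space) \<Rightarrow> 'c measure" where
  "law_on M E Z = distr (density M (indicator E)) borel Z"

lemma (in prob_space) law_on_facts:
  assumes [measurable]: "E \<in> events" "Z \<in> borel_measurable M"
  shows "sets (law_on M E Z) = sets borel" "finite_measure (law_on M E Z)"
    and "\<And>D. D \<in> sets borel \<Longrightarrow> emeasure (law_on M E Z) D = emeasure M {\<omega> \<in> E. Z \<omega> \<in> D}"
    and "\<And>F. F \<in> borel_measurable borel \<Longrightarrow> (\<integral>\<^sup>+z. F z \<partial>law_on M E Z) = (\<integral>\<^sup>+\<omega>. indicator E \<omega> * F (Z \<omega>) \<partial>M)"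
proof -
  show "sets (law_on M E Z) = sets borel" by (simp add: law_on_def)
  show em: "emeasure (law_on M E Z) D = emeasure M {\<omega> \<in> E. Z \<omega> \<in> D}" if [measurable]: "D \<in> sets borel" for D
  proof -
    have "emeasure (law_on M E Z) D = (\<integral>\<^sup>+\<omega>. indicator E \<omega> * indicator (Z -` D \<inter> space M) \<omega> \<partial>M)"
      unfolding law_on_def by (subst emeasure_distr) (auto simp: emeasure_density)
    also have "\<dots> = (\<integral>\<^sup>+\<omega>. indicator {\<omega> \<in> E. Z \<omega> \<in> D} \<omega> \<partial>M)"
      by (intro nn_integral_cong) (auto simp: indicator_def)
    also have "\<dots> = emeasure M {\<omega> \<in> E. Z \<omega> \<in> D}"
    proof (rule nn_integral_indicator)
      have "{\<omega> \<in> E. Z \<omega> \<in> D} = E \<inter> (Z -` D \<inter> space M)"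
        using sets.sets_into_space[OF assms(1)] by auto
      then show "{\<omega> \<in> E. Z \<omega> \<in> D} \<in> events" by simp
    qed
    finally show ?thesis .
  qed
  show "finite_measure (law_on M E Z)"
    using em[of UNIV] by (intro finite_measureI) (auto simp: law_on_def emeasure_eq_measure)
  show "(\<integral>\<^sup>+z. F z \<partial>law_on M E Z) = (\<integral>\<^sup>+\<omega>. indicator E \<omega> * F (Z \<omega>) \<partial>M)" if [measurable]: "F \<in> borel_measurable borel" for F
    unfolding law_on_def by (subst nn_integral_distr) (auto simp: nn_integral_density)
qed

lemma (in prob_space) law_on_restrict:
  fixes Z :: "'a \<Rightarrow> 'c::euclidean_space"
  assumes E [measurable]: "E \<in> events" and Z [measurable]: "Z \<in> borel_measurable M"
    and \<rho> [measurable]: "\<rho> \<in> borel_measurable borel"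
    and g [measurable]: "g \<in> borel_measurable borel" and C [measurable]: "C \<in> sets borel"
    and eq: "law_on M E Z = density lborel \<rho>"
  shows "law_on M {\<omega> \<in> E. g (Z \<omega>) \<in> C} Z = density lborel (\<lambda>z. \<rho> z * indicator C (g z))"
proof (rule measure_eqI)
  have E': "{\<omega> \<in> E. g (Z \<omega>) \<in> C} = E \<inter> {\<omega> \<in> space M. g (Z \<omega>) \<in> C}"
    using sets.sets_into_space[OF E] by auto
  have ev [measurable]: "{\<omega> \<in> E. g (Z \<omega>) \<in> C} \<in> events"
    unfolding E' by measurable
  show "sets (law_on M {\<omega> \<in> E. g (Z \<omega>) \<in> C} Z) = sets (density lborel (\<lambda>z. \<rho> z * indicator C (g z)))"
    by (simp add: law_on_facts)
  fix D assume "D \<in> sets (law_on M {\<omega> \<in> E. g (Z \<omega>) \<in> C} Z)"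
  then have D [measurable]: "D \<in> sets borel"
    by (simp add: law_on_facts)
  have "{z \<in> D. g z \<in> C} = D \<inter> {z \<in> space borel. g z \<in> C}"
    by auto
  also have "\<dots> \<in> sets borel" by measurable
  finally have D' [measurable]: "{z \<in> D. g z \<in> C} \<in> sets borel" .
  have "emeasure (law_on M {\<omega> \<in> E. g (Z \<omega>) \<in> C} Z) D = emeasure M {\<omega> \<in> E. Z \<omega> \<in> {z \<in> D. g z \<in> C}}"
    unfolding law_on_facts(3)[OF ev Z D] by (auto intro!: arg_cong[where f = "emeasure M"])
  also have "\<dots> = emeasure (density lborel \<rho>) {z \<in> D. g z \<in> C}"
    unfolding eq[symmetric] by (rule law_on_facts(3)[OF E Z D', symmetric])
  also have "\<dots> = (\<integral>\<^sup>+z. \<rho> z * indicator {z \<in> D. g z \<in> C} z \<partial>lborel)"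
    by (rule emeasure_density) measurable
  also have "\<dots> = (\<integral>\<^sup>+z. \<rho> z * indicator C (g z) * indicator D z \<partial>lborel)"
    by (intro nn_integral_cong) (auto simp: indicator_def)
  also have "\<dots> = emeasure (density lborel (\<lambda>z. \<rho> z * indicator C (g z))) D"
    by (rule emeasure_density[symmetric]) measurable
  finally show "emeasure (law_on M {\<omega> \<in> E. g (Z \<omega>) \<in> C} Z) D =
      emeasure (density lborel (\<lambda>z. \<rho> z * indicator C (g z))) D" .
qed

section \<open>Independence of past and future, and the reflection principle\<close>

text \<open>Starting at \<open>0\<close> surely, and not only almost surely, makes the value at a time literally equal to
  the sum of the increments before it. The process \<open>B\<^sub>u - B\<^sub>0\<close> is of this kind and almost surely equals
  \<open>B\<^sub>u\<close>.\<close>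

locale pinned_brownian_motion = standard_brownian_motion +
  assumes pinned: "\<omega> \<in> space M \<Longrightarrow> B 0 \<omega> = 0"

lemma (in standard_brownian_motion) shifted_increments_pinned:
  assumes "0 \<le> s"
  shows "pinned_brownian_motion M (\<lambda>u \<omega>. B (s + u) \<omega> - B s \<omega>)"
proof unfold_locales
  show "(\<lambda>\<omega>. B (s + u) \<omega> - B s \<omega>) \<in> borel_measurable M" if "0 \<le> u" for u
    using random_variable_at assms that by auto
  show "AE \<omega> in M. B (s + 0) \<omega> - B s \<omega> = 0" "\<And>\<omega>. \<omega> \<in> space M \<Longrightarrow> B (s + 0) \<omega> - B s \<omega> = 0"
    by auto
  show "indep_vars (\<lambda>_. borel) (\<lambda>i \<omega>. B (s + \<tau> (Suc i)) \<omega> - B s \<omega> - (B (s + \<tau> i) \<omega> - B s \<omega>)) {..<n}"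
    if "0 \<le> \<tau> 0" "mono_on {..n} \<tau>" for \<tau> and n :: nat
    using independent_increments[of "\<lambda>i. s + \<tau> i" n] assms that by (simp add: mono_on_def)
  show "distributed M lborel (\<lambda>\<omega>. B (s + v) \<omega> - B s \<omega> - (B (s + r) \<omega> - B s \<omega>)) (normal_density 0 (sqrt (v - r)))"
    if "0 \<le> r" "r < v" for r v
    using gaussian_increments[of "s + r" "s + v"] assms that by simp
  show "continuous_on {0..} (\<lambda>u. B (s + u) \<omega> - B s \<omega>)" if "\<omega> \<in> space M" for \<omega>
    by (intro continuous_intros continuous_on_compose2[OF continuous_paths[OF that]]) (use assms in auto)
qed

text \<open>All times involved, past and future, together with \<open>0\<close> and \<open>s\<close>, are listed in increasing order. Past values
  are sums of increments up to the index of \<open>s\<close>, future ones sums of increments after it, and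
  disjoint blocks of an independent family are independent.\<close>

lemma (in pinned_brownian_motion) finite_past_future_independent:
  assumes s: "0 \<le> s" and J: "finite J" "J \<subseteq> {0..s}" and K: "finite K" "K \<subseteq> {0..}"
  shows "indep_var (PiM J (\<lambda>_. borel)) (\<lambda>\<omega>. \<lambda>u\<in>J. B u \<omega>)
    (PiM K (\<lambda>_. borel)) (\<lambda>\<omega>. \<lambda>u\<in>K. B (s + u) \<omega> - B s \<omega>)"
proof -
  define L where "L = insert 0 (insert s (J \<union> (\<lambda>u. s + u) ` K))"
  have L: "finite L" "0 \<in> L" "s \<in> L" "\<And>u. u \<in> L \<Longrightarrow> 0 \<le> u"
    using s J K by (auto simp: L_def)
  define xs where "xs = sorted_list_of_set L"
  define n where "n = length xs - 1"
  define \<tau> where "\<tau> i = xs ! min i n" for i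
  have xs: "set xs = L" "sorted xs" "distinct xs"
    using L by (auto simp: xs_def)
  have strict: "sorted_wrt (<) xs"
    using xs by (simp add: strict_sorted_iff)
  from xs have len: "n < length xs" "length xs = Suc n"
    using L by (cases xs; force simp: n_def)+
  have mono: "\<tau> i \<le> \<tau> j" if "i \<le> j" for i j
    unfolding \<tau>_def using that len xs by (intro sorted_nth_mono) auto
  have idx: "\<exists>i\<le>n. \<tau> i = u" if "u \<in> L" for u
  proof -
    obtain i where "i < length xs" "xs ! i = u"
      using \<open>u \<in> L\<close> xs(1) in_set_conv_nth[of u xs] by auto
    then show ?thesis
      using len by (intro exI[of _ i]) (auto simp: \<tau>_def)
  qed
  define k where "k u = (SOME i. i \<le> n \<and> \<tau> i = u)" for u
  have k: "k u \<le> n" "\<tau> (k u) = u" if "u \<in> L" for u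
    using someI_ex[OF idx[OF that]] by (auto simp: k_def)
  have less: "\<tau> i < \<tau> j" if "i < j" "j \<le> n" for i j
    using that len sorted_wrt_nth_less[OF strict, of i j] by (simp add: \<tau>_def)
  have k_mono: "k u \<le> k v" if "u \<in> L" "v \<in> L" "u \<le> v" for u v
  proof (rule ccontr)
    assume "\<not> k u \<le> k v"
    then have "\<tau> (k v) < \<tau> (k u)"
      using k(1)[OF that(1)] by (intro less) auto
    then show False
      using k(2)[OF that(1)] k(2)[OF that(2)] that(3) by simp
  qed
  have \<tau>0: "\<tau> 0 = 0"
  proof (rule antisym)
    show "\<tau> 0 \<le> 0"
      using mono[of 0 "k 0"] k(2)[OF L(2)] by simp
    have "\<tau> 0 \<in> L"
      using nth_mem[of 0 xs] len xs(1) by (simp add: \<tau>_def)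
    then show "0 \<le> \<tau> 0"
      using L(4) by simp
  qed
  define inc where "inc i \<omega> = B (\<tau> (Suc i)) \<omega> - B (\<tau> i) \<omega>" for i \<omega>
  have sum: "(\<Sum>i\<in>{a..<b}. inc i \<omega>) = B (\<tau> b) \<omega> - B (\<tau> a) \<omega>" if "a \<le> b" for a b \<omega>
    unfolding inc_def using sum_Suc_diff'[OF that, of "\<lambda>i. B (\<tau> i) \<omega>"] by simp
  have ind: "indep_vars (\<lambda>_. borel) inc {..<n}"
    unfolding inc_def[abs_def] by (intro independent_increments) (auto simp: \<tau>0 mono_on_def mono)
  define p where "p = k s"
  have p: "p \<le> n" "\<tau> p = s"
    using k L by (auto simp: p_def)
  have "indep_var (PiM {..<p} (\<lambda>_. borel)) (\<lambda>\<omega>. \<lambda>i\<in>{..<p}. inc i \<omega>)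
      (PiM {p..<n} (\<lambda>_. borel)) (\<lambda>\<omega>. \<lambda>i\<in>{p..<n}. inc i \<omega>)"
    by (intro indep_var_restrict[OF ind]) (use p in auto)
  then have *: "indep_var (PiM J (\<lambda>_. borel)) 
     ((\<lambda>x. \<lambda>u\<in>J. \<Sum>i\<in>{0..<k u}. x i) \<circ> (\<lambda>\<omega>. \<lambda>i\<in>{..<p}. inc i \<omega>))
      (PiM K (\<lambda>_. borel)) 
      ((\<lambda>x. \<lambda>u\<in>K. \<Sum>i\<in>{p..<k (s + u)}. x i) \<circ> (\<lambda>\<omega>. \<lambda>i\<in>{p..<n}. inc i \<omega>))"
  proof (rule indep_var_compose)
    show "(\<lambda>x. \<lambda>u\<in>J. \<Sum>i\<in>{0..<k u}. x i) \<in> (\<Pi>\<^sub>M i\<in>{..<p}. borel) \<rightarrow>\<^sub>M (\<Pi>\<^sub>M u\<in>J. borel :: real measure)"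
    proof (intro measurable_restrict borel_measurable_sum measurable_component_singleton)
      fix u i assume "u \<in> J" "i \<in> {0..<k u}"
      moreover have "k u \<le> p" if "u \<in> J"
        unfolding p_def using that J by (intro k_mono) (auto simp: L_def)
      ultimately show "i \<in> {..<p}" by auto
    qed
    show "(\<lambda>x. \<lambda>u\<in>K. \<Sum>i\<in>{p..<k (s + u)}. x i) \<in> (\<Pi>\<^sub>M i\<in>{p..<n}. borel) \<rightarrow>\<^sub>M (\<Pi>\<^sub>M u\<in>K. borel :: real measure)"
    proof (intro measurable_restrict borel_measurable_sum measurable_component_singleton)
      fix u i assume "u \<in> K" "i \<in> {p..<k (s + u)}"
      then show "i \<in> {p..<n}" using k(1)[of "s + u"] by (auto simp: L_def)
    qed
  qed
  show ?thesis
  proof (rule indep_var_cong_space[OF *])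
    fix \<omega> assume \<omega>: "\<omega> \<in> space M"
    have "(\<Sum>i\<in>{0..<k u}. (\<lambda>i\<in>{..<p}. inc i \<omega>) i) = B u \<omega>" if "u \<in> J" for u
    proof -
      have u: "u \<in> L" "u \<le> s"
        using that J by (auto simp: L_def)
      have "k u \<le> p"
        unfolding p_def using u L by (intro k_mono) auto
      then have "(\<Sum>i\<in>{0..<k u}. (\<lambda>i\<in>{..<p}. inc i \<omega>) i) = (\<Sum>i\<in>{0..<k u}. inc i \<omega>)"
        by (intro sum.cong) auto
      also have "\<dots> = B u \<omega>"
        using sum[of 0 "k u" \<omega>] pinned[OF \<omega>] k(2)[OF u(1)] \<tau>0 by simp
      finally show ?thesis .
    qed
    then show "(\<lambda>u\<in>J. B u \<omega>) = ((\<lambda>x. \<lambda>u\<in>J. \<Sum>i\<in>{0..<k u}. x i) \<circ> (\<lambda>\<omega>. \<lambda>i\<in>{..<p}. inc i \<omega>)) \<omega>"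
      unfolding comp_def by (intro restrict_ext) (simp only:)
  next
    fix \<omega> assume \<omega>: "\<omega> \<in> space M"
    have "(\<Sum>i\<in>{p..<k (s + u)}. (\<lambda>i\<in>{p..<n}. inc i \<omega>) i) = B (s + u) \<omega> - B s \<omega>" if "u \<in> K" for u
    proof -
      have u: "s + u \<in> L" "s \<le> s + u"
        using that K by (auto simp: L_def)
      have le: "p \<le> k (s + u)"
        unfolding p_def using u L by (intro k_mono) auto
      have "(\<Sum>i\<in>{p..<k (s + u)}. (\<lambda>i\<in>{p..<n}. inc i \<omega>) i) = (\<Sum>i\<in>{p..<k (s + u)}. inc i \<omega>)"
        using k(1)[OF u(1)] by (intro sum.cong) auto
      also have "\<dots> = B (s + u) \<omega> - B s \<omega>"
        using sum[OF le, of \<omega>] k(2)[OF u(1)] p by simp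
      finally show ?thesis .
    qed
    then show "(\<lambda>u\<in>K. B (s + u) \<omega> - B s \<omega>) =
        ((\<lambda>x. \<lambda>u\<in>K. \<Sum>i\<in>{p..<k (s + u)}. x i) \<circ> (\<lambda>\<omega>. \<lambda>i\<in>{p..<n}. inc i \<omega>)) \<omega>"
      unfolding comp_def by (intro restrict_ext) (simp only:)
  qed
qed

text \<open>Cylinder sets generate the product \<open>\<sigma>\<close>-algebra, so the finite case suffices.\<close>

lemma (in pinned_brownian_motion) past_future_independent:
  assumes "0 \<le> s"
  shows "independent_pair (PiM {0..s} (\<lambda>_. borel)) (\<lambda>\<omega>. \<lambda>u\<in>{0..s}. B u \<omega>)
    (PiM {0..} (\<lambda>_. borel)) (\<lambda>\<omega>. \<lambda>u\<in>{0..}. B (s + u) \<omega> - B s \<omega>)"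
proof (intro independent_pair_of_indep_var indep_var_generatorI)
  let ?X = "\<lambda>\<omega>. \<lambda>u\<in>{0..s}. B u \<omega>" and ?Y = "\<lambda>\<omega>. \<lambda>u\<in>{0..}. B (s + u) \<omega> - B s \<omega>"
  show "?X \<in> measurable M (PiM {0..s} (\<lambda>_. borel))"
    by (intro measurable_restrict random_variable_at) auto
  show "?Y \<in> measurable M (PiM {0..} (\<lambda>_. borel))"
    using assms by (intro measurable_restrict borel_measurable_diff random_variable_at) auto
  show "sets (PiM {0..s} (\<lambda>_. borel)) = sigma_sets (space (PiM {0..s} (\<lambda>_. borel :: real measure))) (prod_algebra {0..s} (\<lambda>_. borel))"
    "sets (PiM {0..} (\<lambda>_. borel)) = sigma_sets (space (PiM {0..} (\<lambda>_. borel :: real measure))) (prod_algebra {0::real..} (\<lambda>_. borel))"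
    by (simp_all add: sets_PiM space_PiM)
  show "prod_algebra {0..s} (\<lambda>_. borel) \<subseteq> Pow (space (PiM {0..s} (\<lambda>_. borel :: real measure)))"
    "prod_algebra {0::real..} (\<lambda>_. borel) \<subseteq> Pow (space (PiM {0..} (\<lambda>_. borel :: real measure)))"
    unfolding space_PiM by (rule prod_algebra_sets_into_space)+
  show "Int_stable (prod_algebra {0..s} (\<lambda>_. borel :: real measure))" "Int_stable (prod_algebra {0::real..} (\<lambda>_. borel :: real measure))"
    by (rule Int_stable_prod_algebra)+
  fix a b assume "a \<in> prod_algebra {0..s} (\<lambda>_. borel :: real measure)" "b \<in> prod_algebra {0::real..} (\<lambda>_. borel :: real measure)"
  then obtain J E K F where a: "a = prod_emb {0..s} (\<lambda>_. borel) J (\<Pi>\<^sub>E j\<in>J. E j)"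
      "finite J" "J \<subseteq> {0..s}" "\<And>j. j \<in> J \<Longrightarrow> E j \<in> sets borel"
    and b: "b = prod_emb {0..} (\<lambda>_. borel) K (\<Pi>\<^sub>E j\<in>K. F j)"
      "finite K" "K \<subseteq> {0..}" "\<And>j. j \<in> K \<Longrightarrow> F j \<in> sets borel"
    by (auto elim!: prod_algebraE)
  let ?XJ = "\<lambda>\<omega>. \<lambda>u\<in>J. B u \<omega>" and ?YK = "\<lambda>\<omega>. \<lambda>u\<in>K. B (s + u) \<omega> - B s \<omega>"
  have X: "?X -` a \<inter> space M = ?XJ -` (\<Pi>\<^sub>E j\<in>J. E j) \<inter> space M"
    using a(3) by (auto simp: a(1) prod_emb_def PiE_iff Int_absorb1 subset_iff restrict_def extensional_def) 
  have Y: "?Y -` b \<inter> space M = ?YK -` (\<Pi>\<^sub>E j\<in>K. F j) \<inter> space M"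
    using b(3) by (auto simp: b(1) prod_emb_def PiE_iff Int_absorb1 subset_iff restrict_def extensional_def)
  have "prob ((\<lambda>\<omega>. (?XJ \<omega>, ?YK \<omega>)) -` ((\<Pi>\<^sub>E j\<in>J. E j) \<times> (\<Pi>\<^sub>E j\<in>K. F j)) \<inter> space M) =
      prob (?XJ -` (\<Pi>\<^sub>E j\<in>J. E j) \<inter> space M) * prob (?YK -` (\<Pi>\<^sub>E j\<in>K. F j) \<inter> space M)"
    by (rule indep_varD[OF finite_past_future_independent]) (use assms a b in \<open>auto intro!: sets_PiM_I_finite\<close>)
  also have "(\<lambda>\<omega>. (?XJ \<omega>, ?YK \<omega>)) -` ((\<Pi>\<^sub>E j\<in>J. E j) \<times> (\<Pi>\<^sub>E j\<in>K. F j)) \<inter> space M =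
      (?X -` a \<inter> space M) \<inter> (?Y -` b \<inter> space M)"
    unfolding X Y by auto
  finally show "prob ((?X -` a \<inter> space M) \<inter> (?Y -` b \<inter> space M)) =
      prob (?X -` a \<inter> space M) * prob (?Y -` b \<inter> space M)"
    unfolding X Y .
qed

lemma (in standard_brownian_motion) increment_symmetric:
  assumes "0 \<le> r" "r \<le> s"
  shows "distr M borel (\<lambda>\<omega>. - (B s \<omega> - B r \<omega>)) = distr M borel (\<lambda>\<omega>. B s \<omega> - B r \<omega>)"
proof (cases "r = s")
  case False
  then have "r < s" using assms by simp
  let ?D = "\<lambda>\<omega>. B s \<omega> - B r \<omega>"
  have D: "distributed M lborel ?D (normal_density 0 (sqrt (s - r)))"
    using assms \<open>r < s\<close> by (intro gaussian_increments)
  have "distributed M lborel (\<lambda>\<omega>. 0 + - 1 * ?D \<omega>) (normal_density (0 + - 1 * 0) (\<bar>- 1\<bar> * sqrt (s - r)))"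
    by (rule normal_density_affine[OF D]) (use \<open>r < s\<close> in auto)
  then have "distributed M lborel (\<lambda>\<omega>. - ?D \<omega>) (normal_density 0 (sqrt (s - r)))"
    by simp
  with D have "distr M lborel (\<lambda>\<omega>. - ?D \<omega>) = distr M lborel ?D"
    by (simp add: distributed_distr_eq_density)
  then show ?thesis
    by (simp cong: distr_cong)
qed simp

context standard_brownian_motion begin

lemma continuous_path: "\<omega> \<in> space M \<Longrightarrow> 0 \<le> s \<Longrightarrow> continuous_on {s..t} (\<lambda>u. B u \<omega>)"
  by (rule continuous_on_subset[OF continuous_paths]) auto

lemma random_variable_SUP:
  assumes "0 \<le> s" "s \<le> t"
  shows "(\<lambda>\<omega>. SUP u\<in>{s..t}. B u \<omega>) \<in> borel_measurable M"
proof -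
  have "(\<lambda>\<omega>. sup_path s t (\<lambda>u\<in>{s..t}. B u \<omega>)) \<in> borel_measurable M"
    using assms by (intro measurable_compose[OF _ sup_path_measurable[OF assms(2) order.refl]]
      measurable_restrict random_variable_at) auto
  also have "?this \<longleftrightarrow> ?thesis"
  proof (rule measurable_cong)
    fix \<omega> assume "\<omega> \<in> space M"
    then show "sup_path s t (\<lambda>u\<in>{s..t}. B u \<omega>) = (SUP u\<in>{s..t}. B u \<omega>)"
      using sup_path_eq[OF assms(2) continuous_path] assms by (auto intro: sup_path_cong)
  qed
  finally show ?thesis .
qed

end

text \<open>The reflection principle for a walk observed at finitely many times. Split according to the first
  time \<open>g k\<close> at which the level \<open>a\<close> is exceeded, and reflect the remaining increment. A walk may jump over \<open>a\<close>, so
  the reflection is at its position \<open>B (g k)\<close> after the jump and not at \<open>a\<close>.\<close>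

lemma (in pinned_brownian_motion) grid_reflection:
  assumes g: "mono g" "0 \<le> g (0::nat)"
  shows "prob {\<omega> \<in> space M. (\<exists>k\<le>n. a < B (g k) \<omega>) \<and> B (g n) \<omega> \<le> c} =
    prob {\<omega> \<in> space M. \<exists>k\<le>n. a < B (g k) \<omega> \<and> (\<forall>j<k. B (g j) \<omega> \<le> a) \<and> 2 * B (g k) \<omega> - c \<le> B (g n) \<omega>}"
    (is "prob ?L = prob ?R")
proof -
  have g0: "0 \<le> g k" for k
    using g monoD[OF g(1), of 0 k] by simp
  have [measurable]: "B (g k) \<in> borel_measurable M" for k
    using g0 by (intro random_variable_at)
  \<comment> \<open>The event that the first crossing happens at \<open>g k\<close>.\<close>
  define A where "A k = {\<omega> \<in> space M. a < B (g k) \<omega> \<and> (\<forall>j<k. B (g j) \<omega> \<le> a)}" for k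
  define L where "L k = {\<omega> \<in> A k. B (g n) \<omega> \<le> c}" for k
  define R where "R k = {\<omega> \<in> A k. 2 * B (g k) \<omega> - c \<le> B (g n) \<omega>}" for k
  have ev [measurable]: "A k \<in> events" "L k \<in> events" "R k \<in> events" for k
    unfolding L_def R_def A_def by measurable
  have "disjoint_family_on A {..n}"
    unfolding disjoint_family_on_def
  proof (intro ballI impI)
    fix i j :: nat assume "i \<noteq> j"
    then consider "i < j" | "j < i" by linarith
    then show "A i \<inter> A j = {}"
      by cases (auto simp: A_def; force)+
  qed
  then have disj: "disjoint_family_on L {..n}" "disjoint_family_on R {..n}"
    by (auto simp: disjoint_family_on_def L_def R_def)
  have first: "(\<exists>k\<le>n. a < B (g k) \<omega>) \<longleftrightarrow> (\<exists>k\<le>n. a < B (g k) \<omega> \<and> (\<forall>j<k. B (g j) \<omega> \<le> a))" for \<omega>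
  proof
    assume "\<exists>k\<le>n. a < B (g k) \<omega>"
    then obtain k where k: "k \<le> n" "a < B (g k) \<omega>" by auto
    define T where "T = (LEAST k. a < B (g k) \<omega>)"
    have "a < B (g T) \<omega>" "T \<le> k" 
      unfolding T_def by (rule LeastI[of "\<lambda>k. a < B (g k) \<omega>", OF k(2)], rule Least_le[of "\<lambda>k. a < B (g k) \<omega>", OF k(2)])
    moreover have "B (g j) \<omega> \<le> a" if "j < T" for j
      using not_less_Least[of j "\<lambda>k. a < B (g k) \<omega>"] that by (auto simp: T_def)
    ultimately show "\<exists>k\<le>n. a < B (g k) \<omega> \<and> (\<forall>j<k. B (g j) \<omega> \<le> a)"
      using k(1) by (intro exI[of _ T]) auto
  qed auto
  have "?L = (\<Union>k\<le>n. L k)"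
    using first by (auto simp: L_def A_def)
  then have "prob ?L = (\<Sum>k\<le>n. prob (L k))"
    using finite_measure_finite_Union[OF _ _ disj(1)] ev by (simp add: image_subset_iff)
  also have "\<dots> = (\<Sum>k\<le>n. prob (R k))"
  proof (rule sum.cong[OF refl])
    fix k assume "k \<in> {..n}"
    then have gk: "g k \<le> g n" using g monoD by auto
    let ?S = "PiM {0..g k} (\<lambda>_. borel :: real measure)"
    let ?D = "{p \<in> space (?S \<Otimes>\<^sub>M borel). a < fst p (g k) \<and> (\<forall>j<k. fst p (g j) \<le> a) \<and> snd p \<le> c - fst p (g k)}"
    have comp: "(\<lambda>p. fst p (g j)) \<in> borel_measurable (?S \<Otimes>\<^sub>M (borel :: real measure))" if "j \<le> k" for j
      using g0[of j] monoD[OF g(1) that]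
      by (intro measurable_compose[OF measurable_fst] measurable_component_singleton) auto
    have D: "?D \<in> sets (?S \<Otimes>\<^sub>M borel)"
    proof -
      have m: "(\<lambda>p. fst p (g k)) \<in> borel_measurable (?S \<Otimes>\<^sub>M (borel :: real measure))"
        "snd \<in> borel_measurable (?S \<Otimes>\<^sub>M (borel :: real measure))"
        by (auto intro: comp)
      let ?P = "?S \<Otimes>\<^sub>M (borel :: real measure)"
      have 1: "{p \<in> space ?P. \<forall>j\<in>{..<k}. fst p (g j) \<le> a} \<in> sets ?P"
        by (rule sets.sets_Collect_countable_All', rule borel_measurable_le, rule comp) auto
      have 2: "{p \<in> space ?P. a < fst p (g k)} \<in> sets ?P"
        by (intro borel_measurable_less borel_measurable_const m)
      have 3: "{p \<in> space ?P. snd p \<le> c - fst p (g k)} \<in> sets ?P"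
        by (intro borel_measurable_le borel_measurable_diff borel_measurable_const m)
      have "?D = {p \<in> space ?P. a < fst p (g k)} \<inter> ({p \<in> space ?P. \<forall>j\<in>{..<k}. fst p (g j) \<le> a} \<inter>
          {p \<in> space ?P. snd p \<le> c - fst p (g k)})"
        by blast
      then show ?thesis
        using sets.Int[OF 2 sets.Int[OF 1 3]] by (simp only:)
    qed
    have "independent_pair ?S (\<lambda>\<omega>. \<lambda>u\<in>{0..g k}. B u \<omega>) borel
        (\<lambda>\<omega>. (\<lambda>u\<in>{0..}. B (g k + u) \<omega> - B (g k) \<omega>) (g n - g k))"
      using gk independent_pair_compose[OF past_future_independent[OF g0[of k]],
          where f = "\<lambda>x. x" and g = "\<lambda>y. y (g n - g k)" and S' = ?S and T' = borel]
      by (auto intro: measurable_component_singleton)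
    then have ind: "independent_pair ?S (\<lambda>\<omega>. \<lambda>u\<in>{0..g k}. B u \<omega>) borel (\<lambda>\<omega>. B (g n) \<omega> - B (g k) \<omega>)"
      using gk by simp
    have "prob (L k) = prob {\<omega> \<in> space M. ((\<lambda>u\<in>{0..g k}. B u \<omega>), B (g n) \<omega> - B (g k) \<omega>) \<in> ?D}"
      using g0 monoD[OF g(1)]
      by (intro arg_cong[where f=prob]) (auto simp: L_def A_def space_pair_measure space_PiM)
    also have "\<dots> = prob {\<omega> \<in> space M. ((\<lambda>u\<in>{0..g k}. B u \<omega>), - (B (g n) \<omega> - B (g k) \<omega>)) \<in> ?D}"
      using gk g0 by (intro independent_symmetric_reflection[OF ind _ D] increment_symmetric)
    also have "\<dots> = prob (R k)"
      using g0 monoD[OF g(1)]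
      by (intro arg_cong[where f=prob]) (auto simp: R_def A_def space_pair_measure space_PiM)
    finally show "prob (L k) = prob (R k)" .
  qed
  also have "\<dots> = prob (\<Union>k\<le>n. R k)"
    using finite_measure_finite_Union[OF _ _ disj(2)] ev by (simp add: image_subset_iff)
  also have "(\<Union>k\<le>n. R k) = ?R"
    by (auto simp: R_def A_def)
  finally show ?thesis .
qed

text \<open>On fine grids the overshoot over \<open>a\<close> is small, by uniform continuity: the path was at
  most \<open>a\<close> one grid step earlier. There is such a step since \<open>x 0 \<le> a\<close>.\<close>

lemma first_grid_crossing_tendsto:
  fixes x :: "real \<Rightarrow> real"
  assumes x: "continuous_on {0..h} x" "x 0 \<le> a" and h: "0 < h" and s: "s \<in> {0..h}" "a < x s" and e: "0 < e"
  shows "\<forall>\<^sub>F n in sequentially. (\<exists>k\<le>Suc n. a < x (h * k / Suc n)) \<and>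
    (\<forall>k\<le>Suc n. a < x (h * k / Suc n) \<longrightarrow> (\<forall>j<k. x (h * j / Suc n) \<le> a) \<longrightarrow> x (h * k / Suc n) < a + e)"
proof -
  have "uniformly_continuous_on {0..h} x"
    using x by (intro compact_uniformly_continuous) auto
  then obtain d where d: "0 < d" "\<And>u v. u \<in> {0..h} \<Longrightarrow> v \<in> {0..h} \<Longrightarrow> \<bar>v - u\<bar> < d \<Longrightarrow> \<bar>x v - x u\<bar> < min e (x s - a)"
    using e s unfolding uniformly_continuous_on_def dist_real_def by (metis diff_gt_0_iff_gt min_less_iff_conj)
  have "(\<lambda>n. h / Suc n) \<longlonglongrightarrow> 0"
    using tendsto_mult[OF tendsto_const[of h] LIMSEQ_inverse_real_of_nat] by (simp add: divide_inverse)
  then have "\<forall>\<^sub>F n in sequentially. h / Suc n < d"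
    using d(1) by (rule order_tendstoD)
  then show ?thesis
  proof eventually_elim
    case (elim n)
    have in_range: "h * k / Suc n \<in> {0..h}" if "k \<le> Suc n" for k :: nat
      using mult_left_mono[of "real k" "real (Suc n)" h] that h by (auto simp: divide_le_eq)
    \<comment> \<open>The grid point just below \<open>s\<close> is within \<open>d\<close> of \<open>s\<close>, so the path exceeds \<open>a\<close> there as well.\<close>
    let ?k = "nat \<lfloor>s * Suc n / h\<rfloor>"
    have k: "real ?k \<le> s * Suc n / h" "s * Suc n / h < real ?k + 1"
      using s h by (auto simp: floor_correct)
    have "?k \<le> Suc n"
    proof -
      have "s * Suc n / h \<le> Suc n" using s h by (simp add: divide_le_eq mult.commute mult_right_mono)
      then show ?thesis using k by linarith
    qed
    moreover have "\<bar>h * ?k / Suc n - s\<bar> < d"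
    proof -
      have "h * ?k / Suc n \<le> s" "s < h * (real ?k + 1) / Suc n"
        using k h by (simp_all add: divide_le_eq le_divide_eq less_divide_eq divide_less_eq mult.commute del: of_nat_Suc)
      moreover have "h * (real ?k + 1) / Suc n = h * ?k / Suc n + h / Suc n"
        by (simp add: add_divide_distrib distrib_left)
      ultimately have "h * ?k / Suc n \<le> s" "s < h * ?k / Suc n + h / Suc n"
        by simp_all
      then show ?thesis using elim by linarith
    qed
    ultimately have "\<bar>x (h * ?k / Suc n) - x s\<bar> < x s - a"
      using d(2)[OF s(1) in_range] by auto
    then have "a < x (h * ?k / Suc n)" by linarith
    moreover have "x (h * k / Suc n) < a + e"
      if k: "k \<le> Suc n" "a < x (h * k / Suc n)" "\<forall>j<k. x (h * j / Suc n) \<le> a" for k :: nat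
    proof (cases k)
      case 0
      then show ?thesis using k x by simp
    next
      case (Suc j)
      have "\<bar>h * k / Suc n - h * j / Suc n\<bar> < d"
      proof -
        have "h * k / Suc n - h * j / Suc n = h / Suc n"
          by (simp add: Suc diff_divide_distrib[symmetric] algebra_simps)
        then show ?thesis using elim h by simp
      qed
      then have "\<bar>x (h * k / Suc n) - x (h * j / Suc n)\<bar> < e"
        using d(2)[of "h * j / Suc n" "h * k / Suc n"] in_range[of j] in_range[of k] k Suc by auto
      then show ?thesis using k(3) Suc by force
    qed
    ultimately show ?case using \<open>?k \<le> Suc n\<close> by blast
  qed
qed

context pinned_brownian_motion begin

lemma distributed_at:
  assumes "0 < h"
  shows "distributed M lborel (B h) (normal_density 0 (sqrt h))"
proof -
  have "distributed M lborel (\<lambda>\<omega>. B h \<omega> - B 0 \<omega>) (normal_density 0 (sqrt (h - 0)))"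
    using assms by (intro gaussian_increments) auto
  moreover have "distr M lborel (\<lambda>\<omega>. B h \<omega> - B 0 \<omega>) = distr M lborel (B h)"
    by (rule distr_cong) (auto simp: pinned)
  ultimately show ?thesis
    using random_variable_at[of h] assms by (simp add: distributed_def)
qed

lemma emeasure_at:
  assumes "0 < h" "A \<in> sets borel"
  shows "emeasure M {\<omega> \<in> space M. B h \<omega> \<in> A} = (\<integral>\<^sup>+x. ennreal (normal_density 0 (sqrt h) x) * indicator A x \<partial>lborel)"
  using distributed_emeasure[OF distributed_at[OF assms(1)], of A] assms(2)
  by (simp add: vimage_def Int_def conj_commute)

text \<open>Pass to the limit in the discrete principle along refining grids. The reflection point tends to \<open>a\<close>,
  and the reflected event to \<open>2 a - c < B h\<close>, except where \<open>B h\<close> equals \<open>2 a - c\<close>, a null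
  event. A path with \<open>2 a - c < B h\<close> exceeds \<open>a\<close> because \<open>c \<le> a\<close>, so the maximum
  disappears from the right-hand side.\<close>

lemma reflection_principle:
  assumes h: "0 < h" and a: "0 \<le> a" "c \<le> a"
  shows "prob {\<omega> \<in> space M. a < (SUP u\<in>{0..h}. B u \<omega>) \<and> B h \<omega> \<le> c} = prob {\<omega> \<in> space M. 2 * a - c < B h \<omega>}"
    (is "prob ?L = prob ?R")
proof -
  define g where "g n k = h * real k / Suc n" for n k :: nat
  have g: "mono (g n)" "0 \<le> g n 0" "g n (Suc n) = h" for n
    using h by (auto simp: g_def mono_def divide_right_mono simp del: of_nat_Suc)
  have g_nonneg: "0 \<le> g n k" for n k
    using h by (simp add: g_def)
  have [measurable]: "B h \<in> borel_measurable M" "B (g n k) \<in> borel_measurable M"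
    "(\<lambda>\<omega>. SUP u\<in>{0..h}. B u \<omega>) \<in> borel_measurable M" for n k
    using h g_nonneg by (auto intro: random_variable_at random_variable_SUP)
  define L where "L n = {\<omega> \<in> space M. (\<exists>k\<le>Suc n. a < B (g n k) \<omega>) \<and> B (g n (Suc n)) \<omega> \<le> c}" for n
  define R where "R n = {\<omega> \<in> space M. \<exists>k\<le>Suc n. a < B (g n k) \<omega> \<and> (\<forall>j<k. B (g n j) \<omega> \<le> a) \<and>
      2 * B (g n k) \<omega> - c \<le> B (g n (Suc n)) \<omega>}" for n
  have [measurable]: "L n \<in> events" "R n \<in> events" for n
    unfolding L_def R_def by measurable
  have sup: "a < (SUP u\<in>{0..h}. B u \<omega>) \<longleftrightarrow> (\<exists>u\<in>{0..h}. a < B u \<omega>)" if "\<omega> \<in> space M" for \<omega>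
    using continuous_path[OF that, of 0 h] h by (intro less_SUP_path_iff) auto
  have g_range: "g n k \<in> {0..h}" if "k \<le> Suc n" for n k
    using g_nonneg[of n k] monoD[OF g(1) that, of n] g(3) by simp
  have "(\<lambda>n. prob (L n)) \<longlonglongrightarrow> prob ?L"
  proof (rule prob_tendsto_of_AE)
    show "AE \<omega> in M. \<forall>\<^sub>F n in sequentially. \<omega> \<in> L n \<longleftrightarrow> \<omega> \<in> ?L"
    proof (rule AE_I2)
      fix \<omega> assume \<omega>: "\<omega> \<in> space M"
      show "\<forall>\<^sub>F n in sequentially. \<omega> \<in> L n \<longleftrightarrow> \<omega> \<in> ?L"
      proof (cases "\<exists>u\<in>{0..h}. a < B u \<omega>")
        case True
        then obtain u where u: "u \<in> {0..h}" "a < B u \<omega>" by auto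
        have "\<forall>\<^sub>F n in sequentially. \<exists>k\<le>Suc n. a < B (h * k / Suc n) \<omega>"
          using first_grid_crossing_tendsto[of h "\<lambda>u. B u \<omega>" a u 1] continuous_path[OF \<omega>, of 0 h] pinned[OF \<omega>] a h u
          by (auto elim: eventually_mono)
        then show ?thesis
          by eventually_elim (use \<omega> sup[OF \<omega>] True in \<open>auto simp: L_def g(3)\<close>, auto simp: g_def)
      next
        case False
        then show ?thesis
          using g_range sup[OF \<omega>] unfolding L_def by (intro always_eventually allI) blast
      qed
    qed
  qed auto
  moreover have "(\<lambda>n. prob (R n)) \<longlonglongrightarrow> prob ?R"
  proof (rule prob_tendsto_of_AE)
    have "AE \<omega> in M. B h \<omega> \<noteq> 2 * a - c"
    proof (rule AE_I)
      show "{\<omega> \<in> space M. \<not> B h \<omega> \<noteq> 2 * a - c} \<subseteq> {\<omega> \<in> space M. B h \<omega> \<in> {2 * a - c}}" by auto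
      show "emeasure M {\<omega> \<in> space M. B h \<omega> \<in> {2 * a - c}} = 0"
        by (subst emeasure_at[OF h]) (simp_all add: nn_integral_null_set)
      show "{\<omega> \<in> space M. B h \<omega> \<in> {2 * a - c}} \<in> events"
        by measurable
    qed
    then show "AE \<omega> in M. \<forall>\<^sub>F n in sequentially. \<omega> \<in> R n \<longleftrightarrow> \<omega> \<in> ?R"
    proof (rule AE_mp, intro AE_I2 impI)
      fix \<omega> assume \<omega>: "\<omega> \<in> space M" and ne: "B h \<omega> \<noteq> 2 * a - c"
      show "\<forall>\<^sub>F n in sequentially. \<omega> \<in> R n \<longleftrightarrow> \<omega> \<in> ?R"
      proof (cases "2 * a - c < B h \<omega>")
        case True
        \<comment> \<open>An overshoot below half the gap \<open>B h - (2 a - c)\<close> keeps the reflected end point below \<open>B h\<close>.\<close>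
        then have "\<forall>\<^sub>F n in sequentially. (\<exists>k\<le>Suc n. a < B (h * k / Suc n) \<omega>) \<and>
          (\<forall>k\<le>Suc n. a < B (h * k / Suc n) \<omega> \<longrightarrow> (\<forall>j<k. B (h * j / Suc n) \<omega> \<le> a) \<longrightarrow>
            B (h * k / Suc n) \<omega> < a + (B h \<omega> - (2 * a - c)) / 2)"
          using continuous_path[OF \<omega>, of 0 h] pinned[OF \<omega>] a h
          by (intro first_grid_crossing_tendsto[where s=h]) auto
        then show ?thesis
        proof eventually_elim
          case (elim n)
          define T where "T = (LEAST k. a < B (g n k) \<omega>)"
          obtain k where k: "k \<le> Suc n" "a < B (g n k) \<omega>"
            using elim by (auto simp: g_def)
          have T: "a < B (g n T) \<omega>" "T \<le> k"
            unfolding T_def by (rule LeastI[of "\<lambda>k. a < B (g n k) \<omega>", OF k(2)],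
              rule Least_le[of "\<lambda>k. a < B (g n k) \<omega>", OF k(2)])
          have T': "B (g n j) \<omega> \<le> a" if "j < T" for j
            using not_less_Least[of j "\<lambda>k. a < B (g n k) \<omega>"] that by (auto simp: T_def)
          have "B (g n T) \<omega> < a + (B h \<omega> - (2 * a - c)) / 2"
            using elim T T' k(1) by (auto simp: g_def)
          then have "2 * B (g n T) \<omega> - c \<le> B (g n (Suc n)) \<omega>"
            by (simp add: g(3) field_simps)
          then have "\<omega> \<in> R n"
            unfolding R_def using \<omega> T T' k(1) by (auto intro!: exI[of _ T])
          then show ?case using True \<omega> by simp
        qed
      next
        case False
        then have "B h \<omega> < 2 * a - c" using ne by simp
        then have "\<omega> \<notin> R n" for n
          by (auto simp: R_def g(3))
        then show ?thesis using False by simp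
      qed
    qed
  qed auto
  moreover have "(\<lambda>n. prob (L n)) = (\<lambda>n. prob (R n))"
    unfolding L_def R_def by (intro ext grid_reflection[OF g(1,2)])
  ultimately show ?thesis
    by (simp add: LIMSEQ_unique)
qed

end

section \<open>Brownian motion killed at a level\<close>

text \<open>The transition density over time \<open>h\<close> of Brownian motion on the positive half-line killed at \<open>0\<close>.\<close>

definition killed_density :: "real \<Rightarrow> real \<Rightarrow> real \<Rightarrow> real" where
  "killed_density h x y = normal_density 0 (sqrt h) (x - y) - normal_density 0 (sqrt h) (x + y)"

lemma normal_density_even: "normal_density 0 \<sigma> (- x) = normal_density 0 \<sigma> x"
  by (simp add: normal_density_def)

lemma normal_density_antimono:
  assumes "\<bar>x\<bar> \<le> \<bar>y\<bar>"
  shows "normal_density 0 \<sigma> y \<le> normal_density 0 \<sigma> x"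
proof -
  have "x\<^sup>2 \<le> y\<^sup>2" using assms by (simp add: abs_le_square_iff)
  then have "- y\<^sup>2 / (2 * \<sigma>\<^sup>2) \<le> - x\<^sup>2 / (2 * \<sigma>\<^sup>2)"
    by (intro divide_right_mono) auto
  then show ?thesis
    unfolding normal_density_def by (intro mult_left_mono) auto
qed

lemma killed_density_nonneg: "0 \<le> x \<Longrightarrow> 0 \<le> y \<Longrightarrow> 0 \<le> killed_density h x y"
  unfolding killed_density_def by (simp add: normal_density_antimono)

lemma killed_density_measurable [measurable]:
  assumes [measurable]: "f \<in> borel_measurable M" "g \<in> borel_measurable M"
  shows "(\<lambda>x. killed_density h (f x) (g x)) \<in> borel_measurable M"
  unfolding killed_density_def by measurable

text \<open>On the event that the maximum stays below \<open>a\<close>, the process \<open>a - B\<close> is Brownian motion from \<open>a\<close> that has not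
  been killed at \<open>0\<close>. The formula is the reflection principle in terms of densities: the mass above \<open>2 a - d\<close>
  is moved to \<open>]-\<infinity>, d]\<close> by \<open>x \<mapsto> 2 a - x\<close> and subtracted.\<close>

lemma (in pinned_brownian_motion) killed_law:
  assumes h: "0 < h" and a: "0 \<le> a"
  shows "emeasure M {\<omega> \<in> space M. (SUP u\<in>{0..h}. B u \<omega>) \<le> a \<and> B h \<omega> \<le> c} =
    (\<integral>\<^sup>+x. ennreal (killed_density h a (a - x)) * indicator {..min a c} x \<partial>lborel)"
proof -
  let ?p = "normal_density 0 (sqrt h)" and ?S = "\<lambda>\<omega>. SUP u\<in>{0..h}. B u \<omega>"
  define d where "d = min a c"
  then have d: "d \<le> a" by simp
  have [measurable]: "B h \<in> borel_measurable M" "?S \<in> borel_measurable M"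
    using h by (auto intro: random_variable_at random_variable_SUP)
  have BS: "B h \<omega> \<le> ?S \<omega>" if "\<omega> \<in> space M" for \<omega>
    using h by (intro SUP_path_ge continuous_path that) auto
  have 1: "{\<omega> \<in> space M. ?S \<omega> \<le> a \<and> B h \<omega> \<le> c} = {\<omega> \<in> space M. ?S \<omega> \<le> a \<and> B h \<omega> \<le> d}"
    using BS by (force simp: d_def)
  have "emeasure M {\<omega> \<in> space M. ?S \<omega> \<le> a \<and> B h \<omega> \<le> d} + emeasure M {\<omega> \<in> space M. 2 * a - d < B h \<omega>}
    = emeasure M {\<omega> \<in> space M. ?S \<omega> \<le> a \<and> B h \<omega> \<le> d} + emeasure M {\<omega> \<in> space M. a < ?S \<omega> \<and> B h \<omega> \<le> d}"
    using reflection_principle[OF h a d] by (simp add: emeasure_eq_measure)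
  also have "\<dots> = emeasure M {\<omega> \<in> space M. B h \<omega> \<in> {..d}}"
    by (subst plus_emeasure) (auto intro!: arg_cong[where f="emeasure M"])
  finally have "emeasure M {\<omega> \<in> space M. ?S \<omega> \<le> a \<and> B h \<omega> \<le> d} + emeasure M {\<omega> \<in> space M. 2 * a - d < B h \<omega>}
    = (\<integral>\<^sup>+x. ennreal (?p x) * indicator {..d} x \<partial>lborel)"
    by (subst (asm) emeasure_at[OF h]) auto
  also have "\<dots> = (\<integral>\<^sup>+x. ennreal (killed_density h a (a - x)) * indicator {..d} x + ennreal (?p (2 * a - x)) * indicator {..d} x \<partial>lborel)"
  proof (intro nn_integral_cong)
    fix x
    show "ennreal (?p x) * indicator {..d} x =
      ennreal (killed_density h a (a - x)) * indicator {..d} x + ennreal (?p (2 * a - x)) * indicator {..d} x"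
      using killed_density_nonneg[of a "a - x" h] a d
      by (auto simp: killed_density_def algebra_simps ennreal_plus[symmetric] split: split_indicator simp del: ennreal_plus)
  qed
  also have "\<dots> = (\<integral>\<^sup>+x. ennreal (killed_density h a (a - x)) * indicator {..d} x \<partial>lborel) +
      (\<integral>\<^sup>+x. ennreal (?p (2 * a - x)) * indicator {..d} x \<partial>lborel)"
    by (rule nn_integral_add) measurable
  also have "(\<integral>\<^sup>+x. ennreal (?p (2 * a - x)) * indicator {..d} x \<partial>lborel) =
      (\<integral>\<^sup>+x. ennreal (?p x) * indicator {2 * a - d..} x \<partial>lborel)"
  proof -
    have "(\<integral>\<^sup>+x. ennreal (?p x) * indicator {2 * a - d..} x \<partial>lborel) =
        ennreal \<bar>-1\<bar> * (\<integral>\<^sup>+x. ennreal (?p (2 * a + -1 * x)) * indicator {2 * a - d..} (2 * a + -1 * x) \<partial>lborel)"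
      by (rule nn_integral_real_affine) auto
    also have "\<dots> = (\<integral>\<^sup>+x. ennreal (?p (2 * a - x)) * indicator {..d} x \<partial>lborel)"
      by (auto intro!: nn_integral_cong simp: indicator_def)
    finally show ?thesis ..
  qed
  also have "\<dots> = (\<integral>\<^sup>+x. ennreal (?p x) * indicator {2 * a - d<..} x \<partial>lborel)"
  proof (rule nn_integral_cong_AE)
    show "AE x in lborel. ennreal (?p x) * indicator {2 * a - d..} x = ennreal (?p x) * indicator {2 * a - d<..} x"
      using AE_lborel_singleton[of "2 * a - d"] by eventually_elim (auto split: split_indicator)
  qed
  also have "\<dots> = emeasure M {\<omega> \<in> space M. 2 * a - d < B h \<omega>}"
    by (subst emeasure_at[OF h, symmetric]) auto
  finally show ?thesis
    unfolding 1 d_def[symmetric] by (simp add: ennreal_add_left_cancel add.commute)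
qed

lemma normal_density_odd_primitive:
  assumes "0 < \<sigma>"
  obtains G where "\<And>x. (G has_real_derivative normal_density 0 \<sigma> x) (at x)" "\<And>x. G (- x) = - G x"
proof -
  have "isCont (normal_density 0 \<sigma>) x" for x
    unfolding normal_density_def using assms by (intro continuous_intros) auto
  then have "\<exists>F. \<forall>x. - \<infinity> < ereal x \<longrightarrow> ereal x < \<infinity> \<longrightarrow> (F has_vector_derivative normal_density 0 \<sigma> x) (at x)"
    by (intro einterval_antiderivative) auto
  then obtain F where F: "(F has_real_derivative normal_density 0 \<sigma> x) (at x)" for x
    by (auto simp: has_real_derivative_iff_has_vector_derivative)
  show thesis
  proof
    show "((\<lambda>x. F x - F 0) has_real_derivative normal_density 0 \<sigma> x) (at x)" for x
      by (auto intro!: derivative_eq_intros F)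
    have "((\<lambda>x. F x + F (- x)) has_real_derivative 0) (at x)" for x
    proof -
      have "((\<lambda>x. F x + F (- x)) has_real_derivative normal_density 0 \<sigma> x + normal_density 0 \<sigma> (- x) * (- 1)) (at x)"
        by (intro DERIV_add F DERIV_chain2[where f = F and g = uminus]) (auto intro!: derivative_eq_intros)
      then show ?thesis by (simp add: normal_density_even)
    qed
    then have "F x + F (- x) = F 0 + F (- 0)" for x
      using DERIV_isconst_all[of "\<lambda>x. F x + F (- x)" x 0] by simp
    then show "F (- x) - F 0 = - (F x - F 0)" for x
      by (simp add: algebra_simps)
  qed
qed

text \<open>A\<close>

text \<open>The Gaussian identity behind the theorem. With \<open>m = (r + b)/2\<close> as current maximum and \<open>b\<close> as current
  position, the left-hand side integrates, over the positions \<open>b\<close> in the fibre of \<open>r\<close> with \<open>m \<le> \<mu>\<close>, the density of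
  moving to \<open>x\<close> without exceeding \<open>\<mu>\<close>. The right-hand side moves the radius from \<open>r\<close> to \<open>y\<close> by the
  killed density and then spreads it over the fibre of \<open>y\<close>: the pair with radius \<open>y\<close> and
  position \<open>x\<close> lies in the fan for \<open>|x| \<le> y\<close>, and has maximum at most \<open>\<mu>\<close> when \<open>y \<le> 2 \<mu> - x\<close>. Both integrals are evaluated with an odd
  primitive \<open>G\<close> of the Gaussian density.\<close>

lemma killed_density_exchange:
  assumes h: "0 < h" and r: "0 \<le> r" and x: "x \<le> \<mu>"
  shows "(\<integral>\<^sup>+b. ennreal (killed_density h (\<mu> - b) (\<mu> - x)) * indicator {-r..min r (2 * \<mu> - r)} b \<partial>lborel) =
    (\<integral>\<^sup>+y. ennreal (killed_density h r y) * indicator {\<bar>x\<bar>..2 * \<mu> - x} y \<partial>lborel)"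
proof (cases "0 \<le> \<mu>")
  case False
  then have "{-r..min r (2 * \<mu> - r)} = {}" "{\<bar>x\<bar>..2 * \<mu> - x} = {}"
    by auto
  then show ?thesis by simp
next
  case True
  obtain G where G: "\<And>x. (G has_real_derivative normal_density 0 (sqrt h) x) (at x)" "\<And>x. G (- x) = - G x"
    using normal_density_odd_primitive[of "sqrt h"] h by auto
  have G': "((\<lambda>y. G (f y)) has_real_derivative normal_density 0 (sqrt h) (f y) * f') (at y)"
    if "(f has_real_derivative f') (at y)" for f f' y
    by (rule DERIV_chain2[OF G(1) that])
  let ?c = "min r (2 * \<mu> - r)"
  have "(\<integral>\<^sup>+b. ennreal (killed_density h (\<mu> - b) (\<mu> - x)) * indicator {-r..?c} b \<partial>lborel) =
      (G (2 * \<mu> - x - ?c) - G (x - ?c)) - (G (2 * \<mu> - x - (- r)) - G (x - (- r)))"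
  proof (rule nn_integral_FTC_Icc)
    fix b assume b': "b \<in> {- r..?c}"
    then have b: "- r \<le> b" "b \<le> ?c" by auto
    have "((\<lambda>b. G (2 * \<mu> - x - b) - G (x - b)) has_real_derivative
        normal_density 0 (sqrt h) (2 * \<mu> - x - b) * (- 1) - normal_density 0 (sqrt h) (x - b) * (- 1)) (at b)"
      by (intro DERIV_diff G') (auto intro!: derivative_eq_intros)
    moreover have "killed_density h (\<mu> - b) (\<mu> - x) =
        normal_density 0 (sqrt h) (2 * \<mu> - x - b) * (- 1) - normal_density 0 (sqrt h) (x - b) * (- 1)"
      by (simp add: killed_density_def algebra_simps)
    ultimately show "((\<lambda>b. G (2 * \<mu> - x - b) - G (x - b)) has_real_derivative killed_density h (\<mu> - b) (\<mu> - x)) (at b)"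
      by (simp only:)
    show "0 \<le> killed_density h (\<mu> - b) (\<mu> - x)"
      using b x by (intro killed_density_nonneg) auto
  qed (use True r in auto)
  moreover have "(\<integral>\<^sup>+y. ennreal (killed_density h r y) * indicator {\<bar>x\<bar>..2 * \<mu> - x} y \<partial>lborel) =
      (- G (r - (2 * \<mu> - x)) - G (r + (2 * \<mu> - x))) - (- G (r - \<bar>x\<bar>) - G (r + \<bar>x\<bar>))"
  proof (rule nn_integral_FTC_Icc)
    fix y assume y': "y \<in> {\<bar>x\<bar>..2 * \<mu> - x}"
    then have y: "\<bar>x\<bar> \<le> y" "y \<le> 2 * \<mu> - x" by auto
    have "((\<lambda>y. - G (r - y) - G (r + y)) has_real_derivative
        - (normal_density 0 (sqrt h) (r - y) * (- 1)) - normal_density 0 (sqrt h) (r + y) * 1) (at y)"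
      by (intro DERIV_diff DERIV_minus G') (auto intro!: derivative_eq_intros)
    then show "((\<lambda>y. - G (r - y) - G (r + y)) has_real_derivative killed_density h r y) (at y)"
      by (simp add: killed_density_def)
    show "0 \<le> killed_density h r y"
      using y r by (intro killed_density_nonneg) auto
  qed (use True x in auto)
  \<comment> \<open>As \<open>G\<close> is odd, the first primitive agrees at \<open>r\<close> and \<open>2 \<mu> - r\<close>, and the second at \<open>x\<close> and \<open>-x\<close>. So neither
    the minimum nor the absolute value affects the result.\<close>
  moreover have "(G (2 * \<mu> - x - ?c) - G (x - ?c)) - (G (2 * \<mu> - x - (- r)) - G (x - (- r))) =
      (- G (r - (2 * \<mu> - x)) - G (r + (2 * \<mu> - x))) - (- G (r - \<bar>x\<bar>) - G (r + \<bar>x\<bar>))"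
    using G(2)[of "r - x"] G(2)[of "r - (2 * \<mu> - x)"]
    by (cases "r \<le> 2 * \<mu> - r"; cases "0 \<le> x") (auto simp: min_def algebra_simps)
  ultimately show ?thesis by simp
qed

section \<open>Measures on the fan and their evolution\<close>

lemma measure_eqI_atMost_pair:
  fixes P Q :: "(real \<times> real) measure"
  assumes sets: "sets P = sets borel" "sets Q = sets borel" and P: "finite_measure P"
    and eq: "\<And>a c. emeasure P {..(a, c)} = emeasure Q {..(a, c)}"
  shows "P = Q"
proof (rule measure_eqI_generator_eq[where \<Omega> = UNIV and E = "range atMost" and A = "\<lambda>i::nat. {..(real i, real i)}"])
  have "{..p} \<inter> {..q} = {..inf p q}" for p q :: "real \<times> real"
    by (auto simp: le_inf_iff)
  then show "Int_stable (range atMost :: (real \<times> real) set set)"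
    by (auto simp: Int_stable_def)
  have "sets borel = sigma_sets UNIV (range atMost :: (real \<times> real) set set)"
    by (subst borel_eq_atMost) simp
  then show "sets P = sigma_sets UNIV (range atMost)" "sets Q = sigma_sets UNIV (range atMost)"
    using sets by simp_all
  have "\<exists>i::nat. p \<le> (real i, real i)" for p :: "real \<times> real"
  proof -
    obtain i :: nat where "max (fst p) (snd p) \<le> real i" using real_arch_simple by blast
    then show ?thesis by (intro exI[of _ i]) (cases p, simp)
  qed
  then show "(\<Union>i::nat. {..(real i, real i)}) = (UNIV :: (real \<times> real) set)"
    by auto
  show "emeasure P {..(real i, real i)} \<noteq> \<infinity>" for i :: nat
    using finite_measure.emeasure_finite[OF P] by (simp add: infinity_ennreal_def)
qed (use eq in auto)

text \<open>The measure with density \<open>f r\<close> at the points \<open>(r, b)\<close> with \<open>|b| \<le> r\<close>. Given the radius, the second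
  component is uniform on \<open>[-r,r]\<close>; the radius itself has density \<open>2 r f(r)\<close>.\<close>

definition fan :: "(real \<Rightarrow> ennreal) \<Rightarrow> (real \<times> real) measure" where
  "fan f = density lborel (\<lambda>(r, b). f r * indicator {- r..r} b)"

lemma sets_fan [simp, measurable_cong]: "sets (fan f) = sets borel"
  by (simp add: fan_def)

lemma pred_in_interval [measurable (raw)]:
  fixes f a b :: "'a \<Rightarrow> real"
  assumes [measurable]: "f \<in> borel_measurable M" "a \<in> borel_measurable M" "b \<in> borel_measurable M"
  shows "Measurable.pred M (\<lambda>x. f x \<in> {a x..b x})"
  unfolding atLeastAtMost_iff by measurable

lemma nn_integral_fan:
  assumes [measurable]: "f \<in> borel_measurable borel" "F \<in> borel_measurable (borel \<Otimes>\<^sub>M borel)"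
  shows "(\<integral>\<^sup>+p. F p \<partial>fan f) = (\<integral>\<^sup>+r. (\<integral>\<^sup>+b. f r * indicator {- r..r} b * F (r, b) \<partial>lborel) \<partial>lborel)"
    and "(\<integral>\<^sup>+p. F p \<partial>fan f) = (\<integral>\<^sup>+b. (\<integral>\<^sup>+r. f r * indicator {- r..r} b * F (r, b) \<partial>lborel) \<partial>lborel)"
proof -
  have "(\<integral>\<^sup>+p. F p \<partial>fan f) = (\<integral>\<^sup>+p. f (fst p) * indicator {- fst p..fst p} (snd p) * F p \<partial>(lborel \<Otimes>\<^sub>M lborel))"
    unfolding fan_def lborel_prod
    by (subst nn_integral_density) (auto simp: case_prod_unfold borel_prod[symmetric])
  moreover have "\<dots> = (\<integral>\<^sup>+r. (\<integral>\<^sup>+b. f r * indicator {- r..r} b * F (r, b) \<partial>lborel) \<partial>lborel)"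
    by (subst lborel.nn_integral_fst[symmetric]) simp_all
  moreover have "\<dots> = (\<integral>\<^sup>+b. (\<integral>\<^sup>+r. f r * indicator {- r..r} b * F (r, b) \<partial>lborel) \<partial>lborel)"
    by (rule lborel_pair.Fubini') simp
  ultimately show "(\<integral>\<^sup>+p. F p \<partial>fan f) = (\<integral>\<^sup>+r. (\<integral>\<^sup>+b. f r * indicator {- r..r} b * F (r, b) \<partial>lborel) \<partial>lborel)"
    and "(\<integral>\<^sup>+p. F p \<partial>fan f) = (\<integral>\<^sup>+b. (\<integral>\<^sup>+r. f r * indicator {- r..r} b * F (r, b) \<partial>lborel) \<partial>lborel)"
    by simp_all
qed

text \<open>A measure on pairs \<open>(r, b)\<close> is determined by its joint distribution function in the coordinates
  \<open>((r + b)/2, b)\<close>, which for \<open>r = 2 S - B\<close> and \<open>b = B\<close> are the maximum and the position. This form suits the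
  events \<open>S \<le> \<mu>\<close> to which the reflection principle applies.\<close>

lemma fan_eqI:
  assumes f [measurable]: "f \<in> borel_measurable borel"
    and \<nu>: "finite_measure \<nu>" "sets \<nu> = sets borel"
    and eq: "\<And>\<mu> d. emeasure \<nu> {p. fst p + snd p \<le> 2 * \<mu> \<and> snd p \<le> d} =
      (\<integral>\<^sup>+x. indicator {..d} x * (\<integral>\<^sup>+y. f y * indicator {\<bar>x\<bar>..2 * \<mu> - x} y \<partial>lborel) \<partial>lborel)"
  shows "\<nu> = fan f"
proof -
  \<comment> \<open>\<open>T\<close> passes from radius and position to maximum and position, and \<open>U\<close> is its inverse.\<close>
  define T :: "real \<times> real \<Rightarrow> real \<times> real" where "T p = ((fst p + snd p) / 2, snd p)" for p
  define U :: "real \<times> real \<Rightarrow> real \<times> real" where "U q = (2 * fst q - snd q, snd q)" for q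
  have [measurable]: "T \<in> borel_measurable borel" "U \<in> borel_measurable borel"
    unfolding T_def U_def borel_prod[symmetric] by measurable
  have [measurable_cong]: "sets \<nu> = sets borel" by fact
  have UT: "distr (distr \<rho> borel T) borel U = \<rho>" if [measurable_cong]: "sets \<rho> = sets borel" for \<rho>
  proof -
    have "distr (distr \<rho> borel T) borel U = distr \<rho> borel (\<lambda>p. U (T p))"
      by (subst distr_distr) (auto simp: comp_def)
    also have "\<dots> = distr \<rho> \<rho> (\<lambda>p. p)"
      by (rule distr_cong) (auto simp: that U_def T_def field_simps)
    finally show ?thesis by simp
  qed
  have vim: "T -` {..(\<mu>, d)} = {p. fst p + snd p \<le> 2 * \<mu> \<and> snd p \<le> d}" for \<mu> d
    by (auto simp: T_def)
  have "distr \<nu> borel T = distr (fan f) borel T"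
  proof (rule measure_eqI_atMost_pair)
    show "finite_measure (distr \<nu> borel T)"
      by (intro finite_measure.finite_measure_distr \<nu>) measurable
    fix \<mu> d :: real
    let ?D = "{p. fst p + snd p \<le> 2 * \<mu> \<and> snd p \<le> d}"
    have "{p \<in> space (borel \<Otimes>\<^sub>M (borel :: real measure)). fst p + snd p \<le> 2 * \<mu> \<and> snd p \<le> d} \<in> sets (borel \<Otimes>\<^sub>M borel)"
      by measurable
    then have [measurable]: "?D \<in> sets (borel \<Otimes>\<^sub>M (borel :: real measure))"
      by (simp add: space_pair_measure)
    then have D: "?D \<in> sets borel" unfolding borel_prod .
    have "emeasure (fan f) ?D = (\<integral>\<^sup>+p. indicator ?D p \<partial>fan f)"
      using D by simp
    also have "\<dots> = (\<integral>\<^sup>+b. (\<integral>\<^sup>+r. f r * indicator {- r..r} b * indicator ?D (r, b) \<partial>lborel) \<partial>lborel)"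
      by (rule nn_integral_fan) measurable
    also have "\<dots> = (\<integral>\<^sup>+x. (\<integral>\<^sup>+y. indicator {..d} x * (f y * indicator {\<bar>x\<bar>..2 * \<mu> - x} y) \<partial>lborel) \<partial>lborel)"
      by (intro nn_integral_cong) (auto simp: indicator_def)
    also have "\<dots> = emeasure \<nu> ?D"
      unfolding eq by (intro nn_integral_cong nn_integral_cmult) measurable
    finally show "emeasure (distr \<nu> borel T) {..(\<mu>, d)} = emeasure (distr (fan f) borel T) {..(\<mu>, d)}"
      by (subst (1 2) emeasure_distr) (simp_all add: vim sets_eq_imp_space_eq[OF \<nu>(2)] sets_eq_imp_space_eq[OF sets_fan])
  qed auto
  then have "distr (distr \<nu> borel T) borel U = distr (distr (fan f) borel T) borel U"
    by (rule arg_cong)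
  then show ?thesis
    unfolding UT[OF \<nu>(2)] UT[OF sets_fan] .
qed

lemma (in prob_space) law_on_fan_restrict:
  assumes "E \<in> events" "Z \<in> borel_measurable M" and f [measurable]: "f \<in> borel_measurable borel"
    and "C \<in> sets borel" and eq: "law_on M E Z = fan f"
  shows "law_on M {\<omega> \<in> E. fst (Z \<omega>) \<in> C} Z = fan (\<lambda>r. f r * indicator C r)"
proof -
  have "(\<lambda>p. f (fst p) * indicator {- fst p..fst p} (snd p)) \<in> borel_measurable (borel \<Otimes>\<^sub>M borel)"
    by measurable
  then have w: "(\<lambda>(r, b). f r * indicator {- r..r} b) \<in> borel_measurable (borel :: (real \<times> real) measure)"
    by (simp add: case_prod_unfold borel_prod)
  have "law_on M {\<omega> \<in> E. fst (Z \<omega>) \<in> C} Z =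
      density lborel (\<lambda>p. (case p of (r, b) \<Rightarrow> f r * indicator {- r..r} b) * indicator C (fst p))"
    by (rule law_on_restrict[OF assms(1,2) w _ assms(4) eq[unfolded fan_def]])
      (intro borel_measurable_continuous_onI continuous_intros)
  then show ?thesis
    by (simp add: fan_def case_prod_unfold mult_ac)
qed

text \<open>The entrance law of the killed motion: the limit of \<open>killed_density h x r / (2 x)\<close> as \<open>x\<close> tends
  to \<open>0\<close>.\<close>

definition entrance_density :: "real \<Rightarrow> real \<Rightarrow> ennreal" where
  "entrance_density h r = ennreal (r / h * normal_density 0 (sqrt h) r)"

text \<open>Since a fan with weight \<open>f\<close> has radial density \<open>2 r f(r)\<close>, evolving \<open>f\<close> by the killed motion evolves the radius by
  the Doob transform of the killed motion with the harmonic function \<open>r\<close>, that is, by the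
  three-dimensional Bessel process.\<close>

definition killed_step :: "real \<Rightarrow> (real \<Rightarrow> ennreal) \<Rightarrow> real \<Rightarrow> ennreal" where
  "killed_step h f y = (\<integral>\<^sup>+r. f r * indicator {0..} r * ennreal (killed_density h r y) \<partial>lborel)"

lemma entrance_density_measurable [measurable]: "entrance_density h \<in> borel_measurable borel"
  unfolding entrance_density_def[abs_def] by measurable

lemma killed_step_measurable [measurable]:
  assumes [measurable]: "f \<in> borel_measurable borel"
  shows "killed_step h f \<in> borel_measurable borel"
  unfolding killed_step_def[abs_def] by measurable

lemma entrance_density_integral:
  assumes "0 < h" "0 \<le> a" "a \<le> b"
  shows "(\<integral>\<^sup>+y. entrance_density h y * indicator {a..b} y \<partial>lborel) =
    ennreal (normal_density 0 (sqrt h) a - normal_density 0 (sqrt h) b)"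
proof -
  have "(\<integral>\<^sup>+y. ennreal (y / h * normal_density 0 (sqrt h) y) * indicator {a..b} y \<partial>lborel) =
      (- normal_density 0 (sqrt h) b) - (- normal_density 0 (sqrt h) a)"
  proof (rule nn_integral_FTC_Icc)
    fix y assume y: "y \<in> {a..b}"
    show "((\<lambda>y. - normal_density 0 (sqrt h) y) has_real_derivative y / h * normal_density 0 (sqrt h) y) (at y)"
      unfolding normal_density_def using assms(1)
      by (auto intro!: derivative_eq_intros simp: field_simps)
    show "0 \<le> y / h * normal_density 0 (sqrt h) y"
      using assms y by auto
  qed (use assms in auto)
  then show ?thesis
    by (simp add: entrance_density_def)
qed

text \<open>Integrated form of \<open>killed_density_exchange\<close>: moving maximum and position from a fan keeps the law on
  fans, with the weight evolved by \<open>killed_step\<close>. The left-hand side is the probability, started from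
  \<open>fan f\<close>, that after time \<open>h\<close> the maximum is at most \<open>\<mu>\<close> and the position at most \<open>d\<close>; the right-hand side is the
  same quantity for \<open>fan (killed_step h f)\<close>, in the form required by \<open>fan_eqI\<close>.\<close>

lemma fan_killed_intertwining:
  assumes [measurable]: "f \<in> borel_measurable borel" and h: "0 < h"
  shows "(\<integral>\<^sup>+p. indicator {..2 * \<mu>} (fst p + snd p) *
        (\<integral>\<^sup>+x. ennreal (killed_density h (\<mu> - snd p) (\<mu> - x)) * indicator {..min \<mu> d} x \<partial>lborel) \<partial>fan f) =
    (\<integral>\<^sup>+x. indicator {..d} x * (\<integral>\<^sup>+y. killed_step h f y * indicator {\<bar>x\<bar>..2 * \<mu> - x} y \<partial>lborel) \<partial>lborel)"
    (is "?L = ?R")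
proof -
  let ?w = "\<lambda>r. f r * indicator {0..} r"
  let ?K = "\<lambda>r x. (\<integral>\<^sup>+y. ennreal (killed_density h r y) * indicator {\<bar>x\<bar>..2 * \<mu> - x} y \<partial>lborel)"
  have "?L = (\<integral>\<^sup>+r. (\<integral>\<^sup>+b. f r * indicator {- r..r} b * (indicator {..2 * \<mu>} (r + b) *
        (\<integral>\<^sup>+x. ennreal (killed_density h (\<mu> - b) (\<mu> - x)) * indicator {..min \<mu> d} x \<partial>lborel)) \<partial>lborel) \<partial>lborel)"
    by (subst nn_integral_fan(1)) simp_all
  also have "\<dots> = (\<integral>\<^sup>+r. (\<integral>\<^sup>+x. ?w r * (indicator {..d} x * ?K r x) \<partial>lborel) \<partial>lborel)"
  proof (rule nn_integral_cong)
    fix r :: real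
    have "(\<integral>\<^sup>+b. f r * indicator {- r..r} b * (indicator {..2 * \<mu>} (r + b) *
        (\<integral>\<^sup>+x. ennreal (killed_density h (\<mu> - b) (\<mu> - x)) * indicator {..min \<mu> d} x \<partial>lborel)) \<partial>lborel) =
      (\<integral>\<^sup>+b. (\<integral>\<^sup>+x. f r * indicator {- r..r} b * (indicator {..2 * \<mu>} (r + b) *
        (ennreal (killed_density h (\<mu> - b) (\<mu> - x)) * indicator {..min \<mu> d} x)) \<partial>lborel) \<partial>lborel)"
      by (intro nn_integral_cong) (simp add: nn_integral_cmult)
    also have "\<dots> = (\<integral>\<^sup>+x. (\<integral>\<^sup>+b. f r * indicator {- r..r} b * (indicator {..2 * \<mu>} (r + b) *
        (ennreal (killed_density h (\<mu> - b) (\<mu> - x)) * indicator {..min \<mu> d} x)) \<partial>lborel) \<partial>lborel)"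
      by (rule lborel_pair.Fubini') measurable
    also have "\<dots> = (\<integral>\<^sup>+x. ?w r * (indicator {..d} x * ?K r x) \<partial>lborel)"
    proof (rule nn_integral_cong)
      fix x :: real
      \<comment> \<open>Both sides vanish unless \<open>0 \<le> r\<close> and \<open>x \<le> min \<mu> d\<close>.\<close>
      consider "r < 0" | "d < x" | "0 \<le> r" "\<mu> < x" | "0 \<le> r" "x \<le> \<mu>" "x \<le> d" by linarith
      then show "(\<integral>\<^sup>+b. f r * indicator {- r..r} b * (indicator {..2 * \<mu>} (r + b) *
        (ennreal (killed_density h (\<mu> - b) (\<mu> - x)) * indicator {..min \<mu> d} x)) \<partial>lborel) = ?w r * (indicator {..d} x * ?K r x)"
      proof cases
        case 1
        then have "{- r..r} = {}" by auto
        with 1 show ?thesis by simp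
      next
        case 2
        then show ?thesis by (simp add: indicator_def)
      next
        case 3
        then have "{\<bar>x\<bar>..2 * \<mu> - x} = {}" by auto
        with 3 show ?thesis by (simp add: indicator_def)
      next
        case 4
        have "(\<integral>\<^sup>+b. f r * indicator {- r..r} b * (indicator {..2 * \<mu>} (r + b) *
            (ennreal (killed_density h (\<mu> - b) (\<mu> - x)) * indicator {..min \<mu> d} x)) \<partial>lborel) =
          (\<integral>\<^sup>+b. f r * (ennreal (killed_density h (\<mu> - b) (\<mu> - x)) * indicator {- r..min r (2 * \<mu> - r)} b) \<partial>lborel)"
          using 4 by (intro nn_integral_cong) (auto simp: indicator_def)
        also have "\<dots> = f r * ?K r x"
          using 4 h by (simp add: nn_integral_cmult killed_density_exchange)
        finally show ?thesis using 4 by simp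
      qed
    qed
    finally show "(\<integral>\<^sup>+b. f r * indicator {- r..r} b * (indicator {..2 * \<mu>} (r + b) *
        (\<integral>\<^sup>+x. ennreal (killed_density h (\<mu> - b) (\<mu> - x)) * indicator {..min \<mu> d} x \<partial>lborel)) \<partial>lborel) =
      (\<integral>\<^sup>+x. ?w r * (indicator {..d} x * ?K r x) \<partial>lborel)" .
  qed
  also have "\<dots> = (\<integral>\<^sup>+x. (\<integral>\<^sup>+r. ?w r * (indicator {..d} x * ?K r x) \<partial>lborel) \<partial>lborel)"
    by (rule lborel_pair.Fubini') measurable
  also have "\<dots> = ?R"
  proof (rule nn_integral_cong)
    fix x :: real
    have "(\<integral>\<^sup>+r. ?w r * (indicator {..d} x * ?K r x) \<partial>lborel) = (\<integral>\<^sup>+r. indicator {..d} x * (?w r * ?K r x) \<partial>lborel)"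
      by (simp add: mult_ac)
    also have "\<dots> = indicator {..d} x * (\<integral>\<^sup>+r. ?w r * ?K r x \<partial>lborel)"
      by (rule nn_integral_cmult) measurable
    also have "(\<integral>\<^sup>+r. ?w r * ?K r x \<partial>lborel) =
        (\<integral>\<^sup>+r. (\<integral>\<^sup>+y. ?w r * ennreal (killed_density h r y) * indicator {\<bar>x\<bar>..2 * \<mu> - x} y \<partial>lborel) \<partial>lborel)"
      by (intro nn_integral_cong) (simp add: nn_integral_cmult mult.assoc)
    also have "\<dots> = (\<integral>\<^sup>+y. (\<integral>\<^sup>+r. ?w r * ennreal (killed_density h r y) * indicator {\<bar>x\<bar>..2 * \<mu> - x} y \<partial>lborel) \<partial>lborel)"
      by (rule lborel_pair.Fubini') measurable
    also have "\<dots> = (\<integral>\<^sup>+y. killed_step h f y * indicator {\<bar>x\<bar>..2 * \<mu> - x} y \<partial>lborel)"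
      unfolding killed_step_def by (intro nn_integral_cong nn_integral_multc) measurable
    finally show "(\<integral>\<^sup>+r. ?w r * (indicator {..d} x * ?K r x) \<partial>lborel) =
        indicator {..d} x * (\<integral>\<^sup>+y. killed_step h f y * indicator {\<bar>x\<bar>..2 * \<mu> - x} y \<partial>lborel)" .
  qed
  finally show ?thesis .
qed

text \<open>The weight common to both processes of the theorem, at time \<open>\<tau> n\<close> and on the event that the radius is in
  \<open>A i\<close> at time \<open>\<tau> i\<close> for all \<open>i \<le> n\<close>.\<close>

primrec path_weight :: "(nat \<Rightarrow> real) \<Rightarrow> (nat \<Rightarrow> real set) \<Rightarrow> nat \<Rightarrow> real \<Rightarrow> ennreal" where
  "path_weight \<tau> A 0 = (\<lambda>r. entrance_density (\<tau> 0) r * indicator (A 0) r)"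
| "path_weight \<tau> A (Suc n) =
    (\<lambda>r. killed_step (\<tau> (Suc n) - \<tau> n) (path_weight \<tau> A n) r * indicator (A (Suc n)) r)"

lemma path_weight_measurable [measurable]:
  assumes [measurable]: "\<And>i. A i \<in> sets borel"
  shows "path_weight \<tau> A n \<in> borel_measurable borel"
  by (induction n) simp_all

section \<open>Finite-dimensional laws of twice the maximum minus the motion\<close>

context pinned_brownian_motion begin

definition pitman :: "real \<Rightarrow> 'a \<Rightarrow> real" where
  "pitman s \<omega> = 2 * (SUP u\<in>{0..s}. B u \<omega>) - B s \<omega>"

lemma pitman_measurable: "0 \<le> s \<Longrightarrow> pitman s \<in> borel_measurable M"
  unfolding pitman_def[abs_def]
  by (intro borel_measurable_diff borel_measurable_times random_variable_SUP random_variable_at) auto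

lemma pitman_pair_measurable: "0 \<le> s \<Longrightarrow> (\<lambda>\<omega>. (pitman s \<omega>, B s \<omega>)) \<in> borel_measurable M"
  unfolding borel_prod[symmetric] by (intro measurable_Pair pitman_measurable random_variable_at)

text \<open>By \<open>killed_law\<close> from level \<open>\<mu>\<close>, because \<open>killed_density h \<mu> (\<mu> - x)\<close> is for \<open>x \<le> \<mu>\<close> the integral of
  the entrance density over \<open>|x| \<le> y \<le> 2 \<mu> - x\<close>.\<close>

lemma pitman_initial:
  assumes h: "0 < h"
  shows "law_on M (space M) (\<lambda>\<omega>. (pitman h \<omega>, B h \<omega>)) = fan (entrance_density h)"
proof (rule fan_eqI)
  have Z [measurable]: "(\<lambda>\<omega>. (pitman h \<omega>, B h \<omega>)) \<in> borel_measurable M"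
    using h by (intro pitman_pair_measurable) simp
  show "finite_measure (law_on M (space M) (\<lambda>\<omega>. (pitman h \<omega>, B h \<omega>)))"
    "sets (law_on M (space M) (\<lambda>\<omega>. (pitman h \<omega>, B h \<omega>))) = sets borel"
    using law_on_facts(1,2)[OF sets.top Z] by simp_all
  fix \<mu> d :: real
  let ?D = "{p :: real \<times> real. fst p + snd p \<le> 2 * \<mu> \<and> snd p \<le> d}"
  have D: "?D \<in> sets borel"
    by (intro borel_closed closed_Collect_conj closed_Collect_le continuous_intros)
  have sup: "0 \<le> (SUP u\<in>{0..h}. B u \<omega>)" if "\<omega> \<in> space M" for \<omega>
    using SUP_path_ge[OF continuous_path[OF that, of 0 h], of 0] pinned[OF that] h by simp
  have 1: "emeasure (law_on M (space M) (\<lambda>\<omega>. (pitman h \<omega>, B h \<omega>))) ?D =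
      emeasure M {\<omega> \<in> space M. (SUP u\<in>{0..h}. B u \<omega>) \<le> \<mu> \<and> B h \<omega> \<le> d}"
    unfolding law_on_facts(3)[OF sets.top Z D] by (auto simp: pitman_def intro!: arg_cong[where f = "emeasure M"])
  show "emeasure (law_on M (space M) (\<lambda>\<omega>. (pitman h \<omega>, B h \<omega>))) ?D =
      (\<integral>\<^sup>+x. indicator {..d} x * (\<integral>\<^sup>+y. entrance_density h y * indicator {\<bar>x\<bar>..2 * \<mu> - x} y \<partial>lborel) \<partial>lborel)"
  proof (cases "0 \<le> \<mu>")
    case False
    then have int: "{\<bar>x\<bar>..2 * \<mu> - x} = {}" for x by auto
    have empty: "{\<omega> \<in> space M. (SUP u\<in>{0..h}. B u \<omega>) \<le> \<mu> \<and> B h \<omega> \<le> d} = {}"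
      using sup False by force
    show ?thesis unfolding 1 empty int by simp
  next
    case True
    have "ennreal (killed_density h \<mu> (\<mu> - x)) * indicator {..min \<mu> d} x =
        indicator {..d} x * (\<integral>\<^sup>+y. entrance_density h y * indicator {\<bar>x\<bar>..2 * \<mu> - x} y \<partial>lborel)" for x
    proof (cases "x \<le> \<mu>")
      case False
      then have "{\<bar>x\<bar>..2 * \<mu> - x} = {}" by auto
      with False show ?thesis by simp
    next
      case x: True
      have "normal_density 0 (sqrt h) \<bar>x\<bar> = normal_density 0 (sqrt h) x"
        by (simp add: normal_density_even abs_if)
      then have "(\<integral>\<^sup>+y. entrance_density h y * indicator {\<bar>x\<bar>..2 * \<mu> - x} y \<partial>lborel) = ennreal (killed_density h \<mu> (\<mu> - x))"
        using True x h by (subst entrance_density_integral) (auto simp: killed_density_def algebra_simps)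
      with x show ?thesis by (simp add: indicator_def)
    qed
    then show ?thesis
      unfolding 1 killed_law[OF h True] by (intro nn_integral_cong)
  qed
qed measurable

lemma SUP_split_at_time:
  assumes "\<omega> \<in> space M" "0 \<le> s" "0 \<le> h"
  shows "(SUP u\<in>{0..s + h}. B u \<omega>) = max (SUP u\<in>{0..s}. B u \<omega>) (B s \<omega> + (SUP u\<in>{0..h}. B (s + u) \<omega> - B s \<omega>))"
proof -
  have "(SUP u\<in>{s..s + h}. B u \<omega>) = (SUP u\<in>{0..h}. B (s + u) \<omega>)"
  proof -
    have "{s..s + h} = (+) s ` {0..h}"
      using image_add_atLeastAtMost[of s 0 h] by simp
    show ?thesis unfolding \<open>{s..s + h} = (+) s ` {0..h}\<close> image_image ..
  qed
  also have "\<dots> = B s \<omega> + (SUP u\<in>{0..h}. B (s + u) \<omega> - B s \<omega>)"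
  proof -
    interpret Sh: pinned_brownian_motion M "\<lambda>u \<omega>. B (s + u) \<omega> - B s \<omega>"
      using assms by (intro shifted_increments_pinned)
    show ?thesis
    proof (rule antisym)
      show "(SUP u\<in>{0..h}. B (s + u) \<omega>) \<le> B s \<omega> + (SUP u\<in>{0..h}. B (s + u) \<omega> - B s \<omega>)"
        using SUP_path_ge[OF Sh.continuous_path[OF assms(1), of 0 h]] assms
        by (intro cSUP_least) (auto simp: diff_le_eq add.commute)
      have c: "continuous_on {0..h} (\<lambda>u. B (s + u) \<omega>)"
        using Sh.continuous_path[OF assms(1), of 0 h] continuous_on_add[OF _ continuous_on_const, of "{0..h}" "\<lambda>u. B (s + u) \<omega> - B s \<omega>" "B s \<omega>"]
        by simp
      have "(SUP u\<in>{0..h}. B (s + u) \<omega> - B s \<omega>) \<le> (SUP u\<in>{0..h}. B (s + u) \<omega>) - B s \<omega>"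
        using SUP_path_ge[OF c] assms by (intro cSUP_least) auto
      then show "B s \<omega> + (SUP u\<in>{0..h}. B (s + u) \<omega> - B s \<omega>) \<le> (SUP u\<in>{0..h}. B (s + u) \<omega>)"
        by simp
    qed
  qed
  finally show ?thesis
    using SUP_path_split[OF continuous_path[OF assms(1), of 0 "s + h"], of s] assms by simp
qed

text \<open>The Markov property. The maximum at time \<open>s + h\<close> is at most \<open>\<mu>\<close> if and only if the maximum at time \<open>s\<close> is, and the
  maximal increment after \<open>s\<close> is at most \<open>\<mu> - B s\<close>. Integrating out the future, which is independent of the
  past, leaves the function \<open>H\<close> of the present pair, and the intertwining applies.\<close>

lemma pitman_step:
  assumes s: "0 \<le> s" and h: "0 < h" and A: "A \<in> sets (PiM {0..s} (\<lambda>_. borel))"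
    and f [measurable]: "f \<in> borel_measurable borel"
    and E: "E = {\<omega> \<in> space M. (\<lambda>u\<in>{0..s}. B u \<omega>) \<in> A}"
    and eq: "law_on M E (\<lambda>\<omega>. (pitman s \<omega>, B s \<omega>)) = fan f"
  shows "law_on M E (\<lambda>\<omega>. (pitman (s + h) \<omega>, B (s + h) \<omega>)) = fan (killed_step h f)"
proof (rule fan_eqI)
  interpret Sh: pinned_brownian_motion M "\<lambda>u \<omega>. B (s + u) \<omega> - B s \<omega>"
    using s by (rule shifted_increments_pinned)
  let ?P = "PiM {0..s} (\<lambda>_. borel :: real measure)"
  let ?X = "\<lambda>\<omega>. \<lambda>u\<in>{0..s}. B u \<omega>"
  let ?m = "\<lambda>\<omega>. SUP u\<in>{0..h}. B (s + u) \<omega> - B s \<omega>"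
  let ?V = "\<lambda>\<omega>. (?m \<omega>, B (s + h) \<omega> - B s \<omega>)"
  have X: "?X \<in> measurable M ?P"
    by (intro measurable_restrict random_variable_at) auto
  have "E = ?X -` A \<inter> space M" by (auto simp: E)
  then have ev [measurable]: "E \<in> events"
    using X A by simp
  have Zs [measurable]: "(\<lambda>\<omega>. (pitman s \<omega>, B s \<omega>)) \<in> borel_measurable M"
    using s by (rule pitman_pair_measurable)
  have Z [measurable]: "(\<lambda>\<omega>. (pitman (s + h) \<omega>, B (s + h) \<omega>)) \<in> borel_measurable M"
    using s h by (intro pitman_pair_measurable) simp
  show "finite_measure (law_on M E (\<lambda>\<omega>. (pitman (s + h) \<omega>, B (s + h) \<omega>)))"
    "sets (law_on M E (\<lambda>\<omega>. (pitman (s + h) \<omega>, B (s + h) \<omega>))) = sets borel"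
    using law_on_facts(1,2)[OF ev Z] by simp_all
  have ind: "independent_pair ?P ?X (borel \<Otimes>\<^sub>M borel) ?V"
  proof -
    have "independent_pair ?P ?X (borel \<Otimes>\<^sub>M borel)
        (\<lambda>\<omega>. (\<lambda>y. (sup_path 0 h y, y h)) (\<lambda>u\<in>{0..}. B (s + u) \<omega> - B s \<omega>))"
      using h by (intro independent_pair_compose[OF past_future_independent[OF s], where f = "\<lambda>x. x"]
        measurable_Pair sup_path_measurable measurable_component_singleton) auto
    moreover have "sup_path 0 h (\<lambda>u\<in>{0..}. B (s + u) \<omega> - B s \<omega>) = ?m \<omega>" if "\<omega> \<in> space M" for \<omega>
    proof -
      have "sup_path 0 h (\<lambda>u\<in>{0..}. B (s + u) \<omega> - B s \<omega>) = sup_path 0 h (\<lambda>u. B (s + u) \<omega> - B s \<omega>)"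
        using h by (intro sup_path_cong) auto
      then show ?thesis
        using sup_path_eq[OF _ Sh.continuous_path[OF that], of 0 h] h by simp
    qed
    moreover have "(\<lambda>\<omega>. (\<lambda>u\<in>{0..}. B (s + u) \<omega> - B s \<omega>) h) = (\<lambda>\<omega>. B (s + h) \<omega> - B s \<omega>)"
      using h by auto
    ultimately show ?thesis
      unfolding independent_pair_def using h
      by (simp cong: measurable_cong distr_cong)
  qed
  fix \<mu> d :: real
  let ?D = "{p :: real \<times> real. fst p + snd p \<le> 2 * \<mu> \<and> snd p \<le> d}"
  have D: "?D \<in> sets borel"
    by (intro borel_closed closed_Collect_conj closed_Collect_le continuous_intros)
  \<comment> \<open>The event at time \<open>s + h\<close>, as a function of the path up to \<open>s\<close> and of the maximal and the final increment.\<close>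
  define F :: "(real \<Rightarrow> real) \<times> real \<times> real \<Rightarrow> ennreal" where
    "F p = indicator A (fst p) * (indicator {..\<mu>} (sup_path 0 s (fst p)) *
      (indicator {..\<mu>} (fst p s + fst (snd p)) * indicator {..d} (fst p s + snd (snd p))))" for p
  have F: "F \<in> borel_measurable (?P \<Otimes>\<^sub>M (borel \<Otimes>\<^sub>M borel))"
  proof -
    note [measurable] = A
    have [measurable]: "sup_path 0 s \<in> borel_measurable ?P" "(\<lambda>x. x s) \<in> borel_measurable ?P"
      using s by (auto intro: sup_path_measurable measurable_component_singleton)
    show ?thesis unfolding F_def[abs_def] by measurable
  qed
  define H :: "real \<times> real \<Rightarrow> ennreal" where
    "H p = indicator {..2 * \<mu>} (fst p + snd p) *
        (\<integral>\<^sup>+x. ennreal (killed_density h (\<mu> - snd p) (\<mu> - x)) * indicator {..min \<mu> d} x \<partial>lborel)" for p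
  have H: "H \<in> borel_measurable borel"
    unfolding H_def[abs_def] borel_prod[symmetric] by measurable
  have supX: "sup_path 0 s (?X \<omega>) = (SUP u\<in>{0..s}. B u \<omega>)" if "\<omega> \<in> space M" for \<omega>
  proof -
    have "sup_path 0 s (?X \<omega>) = sup_path 0 s (\<lambda>u. B u \<omega>)"
      using s by (intro sup_path_cong) auto
    then show ?thesis
      using sup_path_eq[OF s continuous_path[OF that]] by simp
  qed
  have inner: "(\<integral>\<^sup>+\<eta>. F (?X \<omega>, ?V \<eta>) \<partial>M) = indicator E \<omega> * H (pitman s \<omega>, B s \<omega>)" if \<omega>: "\<omega> \<in> space M" for \<omega>
  proof (cases "\<omega> \<in> E \<and> (SUP u\<in>{0..s}. B u \<omega>) \<le> \<mu>")
    case False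
    then show ?thesis
      using \<omega> supX[OF \<omega>] by (auto simp: F_def H_def E pitman_def indicator_def)
  next
    case True
    let ?b = "B s \<omega>"
    have b: "?b \<le> \<mu>"
      using True SUP_path_ge[OF continuous_path[OF \<omega>, of 0 s], of s] s by auto
    have "(\<integral>\<^sup>+\<eta>. F (?X \<omega>, ?V \<eta>) \<partial>M) = (\<integral>\<^sup>+\<eta>. indicator {\<eta> \<in> space M. ?m \<eta> \<le> \<mu> - ?b \<and> B (s + h) \<eta> - B s \<eta> \<le> d - ?b} \<eta> \<partial>M)"
      using True supX[OF \<omega>] s \<omega> by (intro nn_integral_cong) (auto simp: F_def E indicator_def)
    also have "\<dots> = emeasure M {\<eta> \<in> space M. ?m \<eta> \<le> \<mu> - ?b \<and> B (s + h) \<eta> - B s \<eta> \<le> d - ?b}"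
    proof (rule nn_integral_indicator)
      have [measurable]: "?m \<in> borel_measurable M" "(\<lambda>\<eta>. B (s + h) \<eta> - B s \<eta>) \<in> borel_measurable M"
        using h by (auto intro: Sh.random_variable_SUP Sh.random_variable_at)
      show "{\<eta> \<in> space M. ?m \<eta> \<le> \<mu> - ?b \<and> B (s + h) \<eta> - B s \<eta> \<le> d - ?b} \<in> events"
        by measurable
    qed
    also have "\<dots> = (\<integral>\<^sup>+x. ennreal (killed_density h (\<mu> - ?b) (\<mu> - ?b - x)) * indicator {..min (\<mu> - ?b) (d - ?b)} x \<partial>lborel)"
      using b by (intro Sh.killed_law h) simp
    also have "\<dots> = ennreal \<bar>1\<bar> * (\<integral>\<^sup>+x. ennreal (killed_density h (\<mu> - ?b) (\<mu> - ?b - (- ?b + 1 * x))) *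
        indicator {..min (\<mu> - ?b) (d - ?b)} (- ?b + 1 * x) \<partial>lborel)"
      by (rule nn_integral_real_affine) measurable
    also have "\<dots> = (\<integral>\<^sup>+x. ennreal (killed_density h (\<mu> - ?b) (\<mu> - x)) * indicator {..min \<mu> d} x \<partial>lborel)"
      by (auto intro!: nn_integral_cong simp: indicator_def)
    also have "\<dots> = indicator E \<omega> * H (pitman s \<omega>, B s \<omega>)"
      using True by (simp add: H_def pitman_def)
    finally show ?thesis .
  qed
  have "emeasure (law_on M E (\<lambda>\<omega>. (pitman (s + h) \<omega>, B (s + h) \<omega>))) ?D =
      (\<integral>\<^sup>+p. indicator ?D p \<partial>law_on M E (\<lambda>\<omega>. (pitman (s + h) \<omega>, B (s + h) \<omega>)))"
    using D by (simp add: law_on_facts)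
  also have "\<dots> = (\<integral>\<^sup>+\<omega>. indicator E \<omega> * indicator ?D (pitman (s + h) \<omega>, B (s + h) \<omega>) \<partial>M)"
    using D by (intro law_on_facts) auto
  also have "\<dots> = (\<integral>\<^sup>+\<omega>. F (?X \<omega>, ?V \<omega>) \<partial>M)"
  proof (rule nn_integral_cong)
    fix \<omega> assume \<omega>: "\<omega> \<in> space M"
    show "indicator E \<omega> * indicator ?D (pitman (s + h) \<omega>, B (s + h) \<omega>) = F (?X \<omega>, ?V \<omega>)"
      using supX[OF \<omega>] SUP_split_at_time[OF \<omega> s, of h] \<omega> s h
      by (auto simp: F_def E pitman_def indicator_def)
  qed
  also have "\<dots> = (\<integral>\<^sup>+\<omega>. indicator E \<omega> * H (pitman s \<omega>, B s \<omega>) \<partial>M)"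
    by (simp add: nn_integral_independent_pair[OF ind F] inner cong: nn_integral_cong)
  also have "\<dots> = (\<integral>\<^sup>+p. H p \<partial>law_on M E (\<lambda>\<omega>. (pitman s \<omega>, B s \<omega>)))"
    by (rule law_on_facts(4)[symmetric]) (use H in auto)
  also have "\<dots> = (\<integral>\<^sup>+x. indicator {..d} x * (\<integral>\<^sup>+y. killed_step h f y * indicator {\<bar>x\<bar>..2 * \<mu> - x} y \<partial>lborel) \<partial>lborel)"
    unfolding eq H_def by (rule fan_killed_intertwining[OF f h])
  finally show "emeasure (law_on M E (\<lambda>\<omega>. (pitman (s + h) \<omega>, B (s + h) \<omega>))) ?D =
    (\<integral>\<^sup>+x. indicator {..d} x * (\<integral>\<^sup>+y. killed_step h f y * indicator {\<bar>x\<bar>..2 * \<mu> - x} y \<partial>lborel) \<partial>lborel)" .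
qed measurable

end

lemma (in pinned_brownian_motion) pitman_finite_dimensional_law:
  assumes \<tau>: "0 < \<tau> 0" "strict_mono \<tau>" and A [measurable]: "\<And>i. A i \<in> sets borel"
  shows "law_on M {\<omega> \<in> space M. \<forall>i\<le>n. pitman (\<tau> i) \<omega> \<in> A i} (\<lambda>\<omega>. (pitman (\<tau> n) \<omega>, B (\<tau> n) \<omega>)) =
    fan (path_weight \<tau> A n)"
proof -
  have pos: "0 < \<tau> i" for i
    using \<tau> strict_mono_less_eq[of \<tau> 0 i] by simp
  have [measurable]: "pitman (\<tau> i) \<in> borel_measurable M" for i
    using pos[of i] by (intro pitman_measurable) simp
  have Z: "(\<lambda>\<omega>. (pitman (\<tau> n) \<omega>, B (\<tau> n) \<omega>)) \<in> borel_measurable M" for n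
    using pos[of n] by (intro pitman_pair_measurable) simp
  define E where "E n = {\<omega> \<in> space M. \<forall>i\<le>n. pitman (\<tau> i) \<omega> \<in> A i}" for n
  have ev: "E n \<in> events" for n
    unfolding E_def by measurable
  have "law_on M (E n) (\<lambda>\<omega>. (pitman (\<tau> n) \<omega>, B (\<tau> n) \<omega>)) = fan (path_weight \<tau> A n)"
  proof (induction n)
    case 0
    have "{\<omega> \<in> space M. fst (pitman (\<tau> 0) \<omega>, B (\<tau> 0) \<omega>) \<in> A 0} = E 0"
      by (auto simp: E_def)
    then show ?case
      using law_on_fan_restrict[OF sets.top Z entrance_density_measurable A pitman_initial[OF pos], of 0 0] by simp
  next
    case (Suc n)
    define A' where "A' = {x \<in> space (PiM {0..\<tau> n} (\<lambda>_. borel)). \<forall>i\<in>{..n}. 2 * sup_path 0 (\<tau> i) x - x (\<tau> i) \<in> A i}"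
    have A': "A' \<in> sets (PiM {0..\<tau> n} (\<lambda>_. borel))"
      unfolding A'_def
    proof (intro sets.sets_Collect_countable_All')
      fix i assume "i \<in> {..n}"
      then have i: "\<tau> i \<in> {0..\<tau> n}"
        using pos[of i] \<tau>(2) by (simp add: strict_mono_less_eq)
      then have "(\<lambda>x. 2 * sup_path 0 (\<tau> i) x - x (\<tau> i)) \<in> borel_measurable (PiM {0..\<tau> n} (\<lambda>_. borel))"
        by (intro borel_measurable_diff borel_measurable_times sup_path_measurable measurable_component_singleton) auto
      from measurable_sets[OF this A[of i]]
      show "{x \<in> space (PiM {0..\<tau> n} (\<lambda>_. borel)). 2 * sup_path 0 (\<tau> i) x - x (\<tau> i) \<in> A i} \<in> sets (PiM {0..\<tau> n} (\<lambda>_. borel))"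
        by (simp add: vimage_def Int_def conj_commute)
    qed simp
    have val: "2 * sup_path 0 (\<tau> i) (\<lambda>u\<in>{0..\<tau> n}. B u \<omega>) - (\<lambda>u\<in>{0..\<tau> n}. B u \<omega>) (\<tau> i) = pitman (\<tau> i) \<omega>"
      if "\<omega> \<in> space M" "i \<le> n" for \<omega> i
    proof -
      have i: "\<tau> i \<in> {0..\<tau> n}" "0 \<le> \<tau> i"
        using pos[of i] \<tau>(2) that(2) by (simp_all add: strict_mono_less_eq)
      have "sup_path 0 (\<tau> i) (\<lambda>u\<in>{0..\<tau> n}. B u \<omega>) = sup_path 0 (\<tau> i) (\<lambda>u. B u \<omega>)"
        using i by (intro sup_path_cong) auto
      then show ?thesis
        using sup_path_eq[OF i(2) continuous_path[OF that(1)]] i by (simp add: pitman_def)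
    qed
    have E: "E n = {\<omega> \<in> space M. (\<lambda>u\<in>{0..\<tau> n}. B u \<omega>) \<in> A'}"
      using val by (auto simp: E_def A'_def space_PiM simp del: restrict_apply)
    have less: "0 < \<tau> (Suc n) - \<tau> n"
      using \<tau>(2) by (simp add: strict_mono_less)
    have step: "law_on M (E n) (\<lambda>\<omega>. (pitman (\<tau> (Suc n)) \<omega>, B (\<tau> (Suc n)) \<omega>)) =
        fan (killed_step (\<tau> (Suc n) - \<tau> n) (path_weight \<tau> A n))"
      using pitman_step[OF _ less A' path_weight_measurable[OF A] E Suc.IH] pos[of n] by simp
    have "{\<omega> \<in> E n. fst (pitman (\<tau> (Suc n)) \<omega>, B (\<tau> (Suc n)) \<omega>) \<in> A (Suc n)} = E (Suc n)"
      by (auto simp: E_def le_Suc_eq)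
    then show ?case
      using law_on_fan_restrict[OF ev Z killed_step_measurable[OF path_weight_measurable[OF A]] A step, of "Suc n"] by simp
  qed
  then show ?thesis
    unfolding E_def .
qed

section \<open>Rotation-invariant integrals in three-dimensional space\<close>

text \<open>Lebesgue measure in the plane is invariant under the reflection with matrix rows \<open>(c, s)\<close> and
  \<open>(s, -c)\<close>. For \<open>c = 0\<close> it exchanges the coordinates up to sign. Otherwise, by Fubini's
  theorem, two one-dimensional substitutions suffice: first \<open>x\<close> is replaced by the first new
  coordinate \<open>u\<close> with \<open>y\<close> fixed, then \<open>y\<close> by the second new coordinate with \<open>u\<close> fixed; the
  factors \<open>1/|c|\<close> and \<open>|c|\<close> cancel.\<close>

lemma nn_integral_plane_reflection:
  fixes F :: "real \<times> real \<Rightarrow> ennreal"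
  assumes F [measurable]: "F \<in> borel_measurable (borel \<Otimes>\<^sub>M borel)" and cs: "c\<^sup>2 + s\<^sup>2 = 1"
  shows "(\<integral>\<^sup>+x. (\<integral>\<^sup>+y. F (c * x + s * y, s * x - c * y) \<partial>lborel) \<partial>lborel) =
    (\<integral>\<^sup>+x. (\<integral>\<^sup>+y. F (x, y) \<partial>lborel) \<partial>lborel)"
proof (cases "c = 0")
  case True
  then have s: "s \<noteq> 0" "\<bar>s\<bar> = 1"
    using cs by (auto simp: abs_square_eq_1)
  have "(\<integral>\<^sup>+x. (\<integral>\<^sup>+y. F (c * x + s * y, s * x - c * y) \<partial>lborel) \<partial>lborel) =
      (\<integral>\<^sup>+x. (\<integral>\<^sup>+y. F (s * y, s * x) \<partial>lborel) \<partial>lborel)"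
    using True by simp
  also have "\<dots> = (\<integral>\<^sup>+x. (\<integral>\<^sup>+y. F (y, s * x) \<partial>lborel) \<partial>lborel)"
  proof (rule nn_integral_cong)
    fix x
    show "(\<integral>\<^sup>+y. F (s * y, s * x) \<partial>lborel) = (\<integral>\<^sup>+y. F (y, s * x) \<partial>lborel)"
      using nn_integral_real_affine[of "\<lambda>y. F (y, s * x)" s 0] s by simp
  qed
  also have "\<dots> = (\<integral>\<^sup>+x. (\<integral>\<^sup>+y. F (y, x) \<partial>lborel) \<partial>lborel)"
    using nn_integral_real_affine[of "\<lambda>x. \<integral>\<^sup>+y. F (y, x) \<partial>lborel" s 0] s by simp
  also have "\<dots> = (\<integral>\<^sup>+x. (\<integral>\<^sup>+y. F (x, y) \<partial>lborel) \<partial>lborel)"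
    by (rule lborel_pair.Fubini') simp
  finally show ?thesis .
next
  case c: False
  have u: "ennreal \<bar>1 / c\<bar> * F (u, (s * u - y) / c) = ennreal \<bar>1 / c\<bar> * F (c * ((u - s * y) / c) + s * y, s * ((u - s * y) / c) - c * y)" for u y
  proof -
    have "s * ((u - s * y) / c) - c * y = (s * u - (c\<^sup>2 + s\<^sup>2) * y) / c"
      using c by (simp add: field_simps power2_eq_square)
    then show ?thesis using c by (simp add: cs)
  qed
  have "(\<integral>\<^sup>+x. (\<integral>\<^sup>+y. F (c * x + s * y, s * x - c * y) \<partial>lborel) \<partial>lborel) =
      (\<integral>\<^sup>+y. (\<integral>\<^sup>+x. F (c * x + s * y, s * x - c * y) \<partial>lborel) \<partial>lborel)"
    by (rule lborel_pair.Fubini') measurable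
  also have "\<dots> = (\<integral>\<^sup>+y. (\<integral>\<^sup>+u. ennreal \<bar>1 / c\<bar> * F (u, (s * u - y) / c) \<partial>lborel) \<partial>lborel)"
  proof (rule nn_integral_cong)
    fix y
    have "(\<integral>\<^sup>+x. F (c * x + s * y, s * x - c * y) \<partial>lborel) =
        ennreal \<bar>1 / c\<bar> * (\<integral>\<^sup>+u. F (c * (- (s * y) / c + 1 / c * u) + s * y, s * (- (s * y) / c + 1 / c * u) - c * y) \<partial>lborel)"
      using c by (intro nn_integral_real_affine) auto
    also have "\<dots> = (\<integral>\<^sup>+u. ennreal \<bar>1 / c\<bar> * F (u, (s * u - y) / c) \<partial>lborel)"
      unfolding u by (subst nn_integral_cmult) (auto simp: diff_divide_distrib)
    finally show "(\<integral>\<^sup>+x. F (c * x + s * y, s * x - c * y) \<partial>lborel) = (\<integral>\<^sup>+u. ennreal \<bar>1 / c\<bar> * F (u, (s * u - y) / c) \<partial>lborel)" .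
  qed
  also have "\<dots> = (\<integral>\<^sup>+u. (\<integral>\<^sup>+y. ennreal \<bar>1 / c\<bar> * F (u, (s * u - y) / c) \<partial>lborel) \<partial>lborel)"
    by (rule lborel_pair.Fubini') measurable
  also have "\<dots> = (\<integral>\<^sup>+u. (\<integral>\<^sup>+v. F (u, v) \<partial>lborel) \<partial>lborel)"
  proof (rule nn_integral_cong)
    fix u
    have "(\<integral>\<^sup>+y. ennreal \<bar>1 / c\<bar> * F (u, (s * u - y) / c) \<partial>lborel) =
        ennreal \<bar>- c\<bar> * (\<integral>\<^sup>+v. ennreal \<bar>1 / c\<bar> * F (u, (s * u - (s * u + - c * v)) / c) \<partial>lborel)"
      using c by (intro nn_integral_real_affine) auto
    also have "\<dots> = ennreal \<bar>- c\<bar> * (ennreal \<bar>1 / c\<bar> * (\<integral>\<^sup>+v. F (u, v) \<partial>lborel))"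
      using c by (subst nn_integral_cmult) auto
    also have "\<dots> = (\<integral>\<^sup>+v. F (u, v) \<partial>lborel)"
      using c by (simp add: mult.assoc[symmetric] ennreal_mult[symmetric])
    finally show "(\<integral>\<^sup>+y. ennreal \<bar>1 / c\<bar> * F (u, (s * u - y) / c) \<partial>lborel) = (\<integral>\<^sup>+v. F (u, v) \<partial>lborel)" .
  qed
  finally show ?thesis .
qed

text \<open>Reflect so that the linear form depends on the first coordinate only.\<close>

lemma nn_integral_plane_linear_form:
  fixes G :: "real \<times> real \<Rightarrow> ennreal"
  assumes G [measurable]: "G \<in> borel_measurable (borel \<Otimes>\<^sub>M borel)"
  shows "(\<integral>\<^sup>+x. (\<integral>\<^sup>+y. G (x\<^sup>2 + y\<^sup>2, a * x + b * y) \<partial>lborel) \<partial>lborel) =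
    (\<integral>\<^sup>+x. (\<integral>\<^sup>+y. G (x\<^sup>2 + y\<^sup>2, sqrt (a\<^sup>2 + b\<^sup>2) * x) \<partial>lborel) \<partial>lborel)"
proof (cases "a = 0 \<and> b = 0")
  case False
  let ?w = "sqrt (a\<^sup>2 + b\<^sup>2)"
  have w: "0 < ?w" "?w\<^sup>2 = a\<^sup>2 + b\<^sup>2"
    using False by (auto simp: sum_power2_gt_zero_iff)
  let ?c = "a / ?w" and ?s = "b / ?w"
  have cs: "?c\<^sup>2 + ?s\<^sup>2 = 1"
  proof -
    have "?c\<^sup>2 + ?s\<^sup>2 = (a\<^sup>2 + b\<^sup>2) / ?w\<^sup>2"
      by (simp only: power_divide add_divide_distrib)
    then show ?thesis
      unfolding w(2) using False by (simp add: sum_power2_eq_zero_iff)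
  qed
  have "(?c * x + ?s * y)\<^sup>2 + (?s * x - ?c * y)\<^sup>2 = (?c\<^sup>2 + ?s\<^sup>2) * (x\<^sup>2 + y\<^sup>2)" for x y
    by algebra
  then have q: "(?c * x + ?s * y)\<^sup>2 + (?s * x - ?c * y)\<^sup>2 = x\<^sup>2 + y\<^sup>2" for x y
    unfolding cs by simp
  have l: "?w * (?c * x + ?s * y) = a * x + b * y" for x y
    using w(1) by (simp add: distrib_left)
  show ?thesis
    using nn_integral_plane_reflection[OF _ cs, of "\<lambda>(u, v). G (u\<^sup>2 + v\<^sup>2, ?w * u)"]
    unfolding prod.case q l by simp
qed simp

text \<open>The plane case twice: first in the second and third coordinates, then in the first and second.\<close>

lemma nn_integral_space_linear_form:
  fixes G :: "real \<times> real \<Rightarrow> ennreal"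
  assumes G [measurable]: "G \<in> borel_measurable (borel \<Otimes>\<^sub>M borel)"
  shows "(\<integral>\<^sup>+x. (\<integral>\<^sup>+y. (\<integral>\<^sup>+z. G (x\<^sup>2 + y\<^sup>2 + z\<^sup>2, a * x + b * y + c * z) \<partial>lborel) \<partial>lborel) \<partial>lborel) =
    (\<integral>\<^sup>+x. (\<integral>\<^sup>+y. (\<integral>\<^sup>+z. G (x\<^sup>2 + y\<^sup>2 + z\<^sup>2, sqrt (a\<^sup>2 + b\<^sup>2 + c\<^sup>2) * x) \<partial>lborel) \<partial>lborel) \<partial>lborel)"
proof -
  have swap: "(\<integral>\<^sup>+x. (\<integral>\<^sup>+y. (\<integral>\<^sup>+z. H x y z \<partial>lborel) \<partial>lborel) \<partial>lborel) = (\<integral>\<^sup>+z. (\<integral>\<^sup>+x. (\<integral>\<^sup>+y. H x y z \<partial>lborel) \<partial>lborel) \<partial>lborel)"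
    if "(\<lambda>(x, y, z). H x y z) \<in> borel_measurable (borel \<Otimes>\<^sub>M borel \<Otimes>\<^sub>M borel)"
    for H :: "real \<Rightarrow> real \<Rightarrow> real \<Rightarrow> ennreal"
  proof -
    define H' where "H' = (\<lambda>(x, y, z). H x y z)"
    have H: "H x y z = H' (x, y, z)" for x y z
      by (simp add: H'_def)
    have [measurable]: "H' \<in> borel_measurable (borel \<Otimes>\<^sub>M borel \<Otimes>\<^sub>M borel)"
      unfolding H'_def by (rule that)
    have "(\<integral>\<^sup>+x. (\<integral>\<^sup>+y. (\<integral>\<^sup>+z. H x y z \<partial>lborel) \<partial>lborel) \<partial>lborel) = (\<integral>\<^sup>+x. (\<integral>\<^sup>+z. (\<integral>\<^sup>+y. H x y z \<partial>lborel) \<partial>lborel) \<partial>lborel)"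
      unfolding H by (intro nn_integral_cong lborel_pair.Fubini') measurable
    also have "\<dots> = (\<integral>\<^sup>+z. (\<integral>\<^sup>+x. (\<integral>\<^sup>+y. H x y z \<partial>lborel) \<partial>lborel) \<partial>lborel)"
      unfolding H by (rule lborel_pair.Fubini') measurable
    finally show ?thesis .
  qed
  let ?w = "sqrt (b\<^sup>2 + c\<^sup>2)"
  have "(\<integral>\<^sup>+x. (\<integral>\<^sup>+y. (\<integral>\<^sup>+z. G (x\<^sup>2 + y\<^sup>2 + z\<^sup>2, a * x + b * y + c * z) \<partial>lborel) \<partial>lborel) \<partial>lborel) =
      (\<integral>\<^sup>+x. (\<integral>\<^sup>+y. (\<integral>\<^sup>+z. G (x\<^sup>2 + y\<^sup>2 + z\<^sup>2, a * x + ?w * y) \<partial>lborel) \<partial>lborel) \<partial>lborel)"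
  proof (rule nn_integral_cong)
    fix x :: real
    show "(\<integral>\<^sup>+y. (\<integral>\<^sup>+z. G (x\<^sup>2 + y\<^sup>2 + z\<^sup>2, a * x + b * y + c * z) \<partial>lborel) \<partial>lborel) =
        (\<integral>\<^sup>+y. (\<integral>\<^sup>+z. G (x\<^sup>2 + y\<^sup>2 + z\<^sup>2, a * x + ?w * y) \<partial>lborel) \<partial>lborel)"
      using nn_integral_plane_linear_form[of "\<lambda>(q, l). G (x\<^sup>2 + q, a * x + l)" b c] by (simp add: add.assoc)
  qed
  also have "\<dots> = (\<integral>\<^sup>+z. (\<integral>\<^sup>+x. (\<integral>\<^sup>+y. G (x\<^sup>2 + y\<^sup>2 + z\<^sup>2, a * x + ?w * y) \<partial>lborel) \<partial>lborel) \<partial>lborel)"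
    by (rule swap) measurable
  also have "\<dots> = (\<integral>\<^sup>+z. (\<integral>\<^sup>+x. (\<integral>\<^sup>+y. G (x\<^sup>2 + y\<^sup>2 + z\<^sup>2, sqrt (a\<^sup>2 + ?w\<^sup>2) * x) \<partial>lborel) \<partial>lborel) \<partial>lborel)"
  proof (rule nn_integral_cong)
    fix z :: real
    show "(\<integral>\<^sup>+x. (\<integral>\<^sup>+y. G (x\<^sup>2 + y\<^sup>2 + z\<^sup>2, a * x + ?w * y) \<partial>lborel) \<partial>lborel) =
        (\<integral>\<^sup>+x. (\<integral>\<^sup>+y. G (x\<^sup>2 + y\<^sup>2 + z\<^sup>2, sqrt (a\<^sup>2 + ?w\<^sup>2) * x) \<partial>lborel) \<partial>lborel)"
      using nn_integral_plane_linear_form[of "\<lambda>(q, l). G (q + z\<^sup>2, l)" a ?w] by simp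
  qed
  also have "\<dots> = (\<integral>\<^sup>+x. (\<integral>\<^sup>+y. (\<integral>\<^sup>+z. G (x\<^sup>2 + y\<^sup>2 + z\<^sup>2, sqrt (a\<^sup>2 + ?w\<^sup>2) * x) \<partial>lborel) \<partial>lborel) \<partial>lborel)"
    by (rule swap[symmetric]) measurable
  finally show ?thesis
    by (simp add: add.assoc)
qed

text \<open>Archimedes' theorem on spherical zones, in the form of a density: in the plane at height \<open>b\<close>, the
  distance to the origin of space is at most \<open>a\<close> on a disc of area \<open>\<pi> (a\<^sup>2 - b\<^sup>2)\<close>, whose derivative \<open>2 \<pi> a\<close> does not depend
  on \<open>b\<close>.\<close>

lemma distr_shell_radius:
  "distr (lborel :: (real \<times> real) measure) borel (\<lambda>y. sqrt (b\<^sup>2 + (norm y)\<^sup>2)) =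
    density lborel (\<lambda>r. ennreal (2 * pi * r) * indicator {\<bar>b\<bar>..} r)"
proof (rule measure_eqI_generator_eq[where \<Omega> = UNIV and E = "range atMost" and A = "\<lambda>i::nat. {..real i}"])
  let ?R = "\<lambda>y :: real \<times> real. sqrt (b\<^sup>2 + (norm y)\<^sup>2)"
  have [measurable]: "?R \<in> borel_measurable borel"
    by (intro borel_measurable_continuous_onI continuous_intros)
  have "{..p} \<inter> {..q} = {..min p q}" for p q :: real
    by auto
  then show "Int_stable (range atMost :: real set set)"
    by (auto simp: Int_stable_def)
  have "sets borel = sigma_sets UNIV (range atMost :: real set set)"
    by (subst borel_eq_atMost) simp
  then show "sets (distr lborel borel ?R) = sigma_sets UNIV (range atMost)"
    "sets (density lborel (\<lambda>r. ennreal (2 * pi * r) * indicator {\<bar>b\<bar>..} r)) = sigma_sets UNIV (range atMost)"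
    by simp_all
  show "(\<Union>i::nat. {..real i}) = UNIV"
    using real_arch_simple by auto
  have em: "emeasure (distr lborel borel ?R) {..a} = (if \<bar>b\<bar> \<le> a then ennreal (pi * (a\<^sup>2 - b\<^sup>2)) else 0)" for a
  proof (cases "\<bar>b\<bar> \<le> a")
    case True
    then have le: "b\<^sup>2 \<le> a\<^sup>2" "0 \<le> a" by (auto simp: abs_le_square_iff[symmetric])
    have "?R y \<le> a \<longleftrightarrow> norm y \<le> sqrt (a\<^sup>2 - b\<^sup>2)" for y
    proof -
      have "?R y \<le> a \<longleftrightarrow> b\<^sup>2 + (norm y)\<^sup>2 \<le> a\<^sup>2"
        using le by (intro real_sqrt_le_iff') auto
      also have "\<dots> \<longleftrightarrow> (norm y)\<^sup>2 \<le> a\<^sup>2 - b\<^sup>2" by auto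
      also have "\<dots> \<longleftrightarrow> norm y \<le> sqrt (a\<^sup>2 - b\<^sup>2)"
        using real_sqrt_le_iff[of "(norm y)\<^sup>2" "a\<^sup>2 - b\<^sup>2"] by simp
      finally show ?thesis .
    qed
    then have "?R -` {..a} = cball 0 (sqrt (a\<^sup>2 - b\<^sup>2))"
      by (intro set_eqI) (simp only: vimage_eq atMost_iff mem_cball dist_0_norm)
    then show ?thesis
      using True le by (subst emeasure_distr) (auto simp: emeasure_cball eval_unit_ball_vol)
  next
    case False
    have "\<bar>b\<bar> \<le> ?R y" for y
      by (rule real_le_rsqrt) simp
    then have "?R y \<notin> {..a}" for y
      using False order.trans[of "\<bar>b\<bar>" "?R y" a] by auto
    then have "?R -` {..a} = {}"
      by blast
    then show ?thesis
      using False by (subst emeasure_distr) auto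
  qed
  then show "emeasure (distr lborel borel ?R) {..real i} \<noteq> \<infinity>" for i :: nat
    by simp
  fix X :: "real set" assume "X \<in> range atMost"
  then obtain a where X: "X = {..a}" by auto
  have "emeasure (density lborel (\<lambda>r. ennreal (2 * pi * r) * indicator {\<bar>b\<bar>..} r)) {..a} =
      (\<integral>\<^sup>+r. ennreal (2 * pi * r) * indicator {\<bar>b\<bar>..a} r \<partial>lborel)"
    by (subst emeasure_density) (auto intro!: nn_integral_cong simp: indicator_def)
  also have "\<dots> = (if \<bar>b\<bar> \<le> a then ennreal (pi * (a\<^sup>2 - b\<^sup>2)) else 0)"
  proof (cases "\<bar>b\<bar> \<le> a")
    case True
    then have "(\<integral>\<^sup>+r. ennreal (2 * pi * r) * indicator {\<bar>b\<bar>..a} r \<partial>lborel) = pi * a\<^sup>2 - pi * \<bar>b\<bar>\<^sup>2"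
      by (intro nn_integral_FTC_Icc) (auto intro!: derivative_eq_intros)
    with True show ?thesis by (simp add: right_diff_distrib)
  next
    case False
    then have "{\<bar>b\<bar>..a} = {}" by auto
    with False show ?thesis by simp
  qed
  finally show "emeasure (distr lborel borel ?R) X = emeasure (density lborel (\<lambda>r. ennreal (2 * pi * r) * indicator {\<bar>b\<bar>..} r)) X"
    unfolding X em ..
qed auto

type_synonym space3 = "real \<times> real \<times> real"

lemma nn_integral_space3:
  fixes F :: "space3 \<Rightarrow> ennreal"
  assumes "F \<in> borel_measurable borel"
  shows "(\<integral>\<^sup>+x. F x \<partial>lborel) = (\<integral>\<^sup>+x. (\<integral>\<^sup>+y. (\<integral>\<^sup>+z. F (x, y, z) \<partial>lborel) \<partial>lborel) \<partial>lborel)"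
proof -
  have "(\<integral>\<^sup>+x. F x \<partial>lborel) = (\<integral>\<^sup>+x. F x \<partial>(lborel \<Otimes>\<^sub>M (lborel :: (real \<times> real) measure)))"
    by (simp only: lborel_prod)
  also have "\<dots> = (\<integral>\<^sup>+x. (\<integral>\<^sup>+p. F (x, p) \<partial>(lborel :: (real \<times> real) measure)) \<partial>lborel)"
    by (rule lborel.nn_integral_fst[symmetric]) (use assms in \<open>simp add: lborel_prod\<close>)
  also have "\<dots> = (\<integral>\<^sup>+x. (\<integral>\<^sup>+y. (\<integral>\<^sup>+z. F (x, y, z) \<partial>lborel) \<partial>lborel) \<partial>lborel)"
  proof (rule nn_integral_cong)
    fix x :: real
    have m: "(\<lambda>p. F (x, p)) \<in> borel_measurable (borel :: (real \<times> real) measure)"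
      by (rule measurable_compose[OF _ assms], intro borel_measurable_continuous_onI continuous_intros)
    have "(\<integral>\<^sup>+p. F (x, p) \<partial>(lborel :: (real \<times> real) measure)) = (\<integral>\<^sup>+p. F (x, p) \<partial>(lborel \<Otimes>\<^sub>M (lborel :: real measure)))"
      by (simp only: lborel_prod)
    also have "\<dots> = (\<integral>\<^sup>+y. (\<integral>\<^sup>+z. F (x, y, z) \<partial>lborel) \<partial>lborel)"
      by (rule lborel.nn_integral_fst[symmetric]) (use m in \<open>simp add: lborel_prod\<close>)
    finally show "(\<integral>\<^sup>+p. F (x, p) \<partial>(lborel :: (real \<times> real) measure)) = (\<integral>\<^sup>+y. (\<integral>\<^sup>+z. F (x, y, z) \<partial>lborel) \<partial>lborel)" .
  qed
  finally show ?thesis .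
qed

lemma norm_space3: "(norm ((x, y, z) :: space3))\<^sup>2 = x\<^sup>2 + y\<^sup>2 + z\<^sup>2"
  by (simp add: norm_Pair)

lemma measurable_norm_fst:
  "(\<lambda>x :: space3. (norm x, fst x)) \<in> borel_measurable borel"
  by (intro borel_measurable_continuous_onI continuous_intros)

lemma nn_integral_rotate_inner:
  fixes G :: "real \<times> real \<Rightarrow> ennreal" and w :: space3
  assumes G: "G \<in> borel_measurable (borel \<Otimes>\<^sub>M borel)"
  shows "(\<integral>\<^sup>+x. G ((norm x)\<^sup>2, x \<bullet> w) \<partial>lborel) = (\<integral>\<^sup>+x. G ((norm x)\<^sup>2, norm w * fst x) \<partial>(lborel :: space3 measure))"
proof -
  obtain a b c where w: "w = (a, b, c)" by (cases w)
  have G': "G \<in> borel_measurable borel" using G by (simp add: borel_prod)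
  have nw: "norm w = sqrt (a\<^sup>2 + b\<^sup>2 + c\<^sup>2)"
    using norm_space3[of a b c] by (simp add: w real_sqrt_unique)
  have 1: "(\<lambda>x :: space3. G ((norm x)\<^sup>2, x \<bullet> w)) \<in> borel_measurable borel"
    by (rule measurable_compose[OF _ G'], intro borel_measurable_continuous_onI continuous_intros)
  have 2: "(\<lambda>x :: space3. G ((norm x)\<^sup>2, norm w * fst x)) \<in> borel_measurable borel"
    by (rule measurable_compose[OF _ G'], intro borel_measurable_continuous_onI continuous_intros)
  have ip: "(x, y, z) \<bullet> w = a * x + b * y + c * z" for x y z
    by (simp add: w algebra_simps)
  show ?thesis
    by (subst nn_integral_space3[OF 1], subst nn_integral_space3[OF 2])
      (simp only: norm_space3 ip fst_conv nw nn_integral_space_linear_form[OF G])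
qed

lemma nn_integral_shells:
  fixes F :: "real \<times> real \<Rightarrow> ennreal"
  assumes F [measurable]: "F \<in> borel_measurable (borel \<Otimes>\<^sub>M borel)"
  shows "(\<integral>\<^sup>+x. F (norm x, fst x) \<partial>(lborel :: space3 measure)) =
    (\<integral>\<^sup>+b. (\<integral>\<^sup>+r. ennreal (2 * pi * r) * indicator {\<bar>b\<bar>..} r * F (r, b) \<partial>lborel) \<partial>lborel)"
proof -
  have F': "F \<in> borel_measurable borel" using F by (simp add: borel_prod)
  have m: "(\<lambda>x :: space3. F (norm x, fst x)) \<in> borel_measurable borel"
    by (rule measurable_compose[OF measurable_norm_fst F'])
  have "(\<integral>\<^sup>+x. F (norm x, fst x) \<partial>(lborel :: space3 measure)) =
      (\<integral>\<^sup>+x. F (norm x, fst x) \<partial>(lborel \<Otimes>\<^sub>M (lborel :: (real \<times> real) measure)))"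
    by (simp only: lborel_prod)
  also have "\<dots> = (\<integral>\<^sup>+b. (\<integral>\<^sup>+y. F (norm (b, y), b) \<partial>(lborel :: (real \<times> real) measure)) \<partial>lborel)"
    by (subst lborel.nn_integral_fst[symmetric]) (use m in \<open>simp_all add: lborel_prod\<close>)
  also have "\<dots> = (\<integral>\<^sup>+b. (\<integral>\<^sup>+r. ennreal (2 * pi * r) * indicator {\<bar>b\<bar>..} r * F (r, b) \<partial>lborel) \<partial>lborel)"
  proof (rule nn_integral_cong)
    fix b :: real
    have [measurable]: "(\<lambda>y :: real \<times> real. sqrt (b\<^sup>2 + (norm y)\<^sup>2)) \<in> borel_measurable borel"
      by (intro borel_measurable_continuous_onI continuous_intros)
    have "(\<integral>\<^sup>+y. F (norm (b, y), b) \<partial>(lborel :: (real \<times> real) measure)) =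
        (\<integral>\<^sup>+r. F (r, b) \<partial>distr (lborel :: (real \<times> real) measure) borel (\<lambda>y. sqrt (b\<^sup>2 + (norm y)\<^sup>2)))"
      by (subst nn_integral_distr) (auto simp: norm_Pair)
    also have "\<dots> = (\<integral>\<^sup>+r. ennreal (2 * pi * r) * indicator {\<bar>b\<bar>..} r * F (r, b) \<partial>lborel)"
      unfolding distr_shell_radius by (subst nn_integral_density) auto
    finally show "(\<integral>\<^sup>+y. F (norm (b, y), b) \<partial>(lborel :: (real \<times> real) measure)) =
        (\<integral>\<^sup>+r. ennreal (2 * pi * r) * indicator {\<bar>b\<bar>..} r * F (r, b) \<partial>lborel)" .
  qed
  finally show ?thesis .
qed

text \<open>The rotation-invariant density on space whose image under \<open>x \<mapsto> (|x|, x\<^sub>1)\<close> is \<open>fan f\<close>.\<close>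

definition radial_density :: "(real \<Rightarrow> ennreal) \<Rightarrow> space3 \<Rightarrow> ennreal" where
  "radial_density f x = f (norm x) / ennreal (2 * pi * norm x)"

lemma radial_density_measurable [measurable]:
  assumes [measurable]: "f \<in> borel_measurable borel"
  shows "radial_density f \<in> borel_measurable borel"
  unfolding radial_density_def[abs_def] by measurable

text \<open>The factor \<open>2 \<pi> r\<close> from \<open>distr_shell_radius\<close> cancels the denominator of \<open>radial_density\<close>.\<close>

lemma nn_integral_radial:
  assumes [measurable]: "f \<in> borel_measurable borel" and F [measurable]: "F \<in> borel_measurable (borel \<Otimes>\<^sub>M borel)"
  shows "(\<integral>\<^sup>+x. radial_density f x * F (norm x, fst x) \<partial>lborel) = (\<integral>\<^sup>+p. F p \<partial>fan f)"
proof -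
  have "(\<integral>\<^sup>+x. radial_density f x * F (norm x, fst x) \<partial>lborel) =
      (\<integral>\<^sup>+b. (\<integral>\<^sup>+r. ennreal (2 * pi * r) * indicator {\<bar>b\<bar>..} r * (f r / ennreal (2 * pi * r) * F (r, b)) \<partial>lborel) \<partial>lborel)"
    unfolding radial_density_def
    using nn_integral_shells[of "\<lambda>(r, b). f r / ennreal (2 * pi * r) * F (r, b)"] by simp
  also have "\<dots> = (\<integral>\<^sup>+b. (\<integral>\<^sup>+r. f r * indicator {- r..r} b * F (r, b) \<partial>lborel) \<partial>lborel)"
  proof (rule nn_integral_cong, rule nn_integral_cong_AE)
    fix b :: real
    show "AE r in lborel. ennreal (2 * pi * r) * indicator {\<bar>b\<bar>..} r * (f r / ennreal (2 * pi * r) * F (r, b)) =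
        f r * indicator {- r..r} b * F (r, b)"
      using AE_lborel_singleton[of 0]
    proof eventually_elim
      case (elim r)
      have "ennreal (2 * pi * r) * (f r / ennreal (2 * pi * r)) = f r" if "0 < r"
        using that by (simp add: ennreal_times_divide mult.commute mult_divide_eq_ennreal)
      then have "ennreal (2 * pi * r) * i * (f r / ennreal (2 * pi * r) * F (r, b)) = f r * i * F (r, b)" if "0 < r" for i
        using that by (metis mult.assoc mult.commute)
      moreover have "indicator {\<bar>b\<bar>..} r = (indicator {- r..r} b :: ennreal)"
        by (auto simp: indicator_def)
      moreover have "indicator {- r..r} b = (0 :: ennreal)" if "r < 0"
        using that by (auto simp: indicator_def)
      ultimately show ?case
        using elim by (cases "0 < r") simp_all
    qed
  qed
  also have "\<dots> = (\<integral>\<^sup>+p. F p \<partial>fan f)"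
    by (rule nn_integral_fan(2)[OF assms, symmetric])
  finally show ?thesis .
qed

definition gauss3 :: "real \<Rightarrow> space3 \<Rightarrow> real" where
  "gauss3 h x = normal_density 0 (sqrt h) (fst x) *
    (normal_density 0 (sqrt h) (fst (snd x)) * normal_density 0 (sqrt h) (snd (snd x)))"

lemma gauss3_eq:
  assumes h: "0 < h"
  shows "gauss3 h x = normal_density 0 (sqrt h) (norm x) / (2 * pi * h)"
proof -
  obtain a b c where x: "x = (a, b, c)" by (cases x)
  let ?k = "1 / sqrt (2 * pi * h)"
  have p: "normal_density 0 (sqrt h) u = ?k * exp (- u\<^sup>2 / (2 * h))" for u
    using h by (simp add: normal_density_def)
  have "gauss3 h x = ?k ^ 3 * (exp (- a\<^sup>2 / (2 * h)) * (exp (- b\<^sup>2 / (2 * h)) * exp (- c\<^sup>2 / (2 * h))))"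
    by (simp only: gauss3_def p x fst_conv snd_conv power3_eq_cube mult_ac)
  also have "exp (- a\<^sup>2 / (2 * h)) * (exp (- b\<^sup>2 / (2 * h)) * exp (- c\<^sup>2 / (2 * h))) =
      exp (- a\<^sup>2 / (2 * h) + (- b\<^sup>2 / (2 * h) + - c\<^sup>2 / (2 * h)))"
    by (simp only: exp_add)
  also have "- a\<^sup>2 / (2 * h) + (- b\<^sup>2 / (2 * h) + - c\<^sup>2 / (2 * h)) = - (norm x)\<^sup>2 / (2 * h)"
    unfolding x norm_space3 by (simp add: add_divide_distrib diff_divide_distrib)
  also have "(1 / sqrt (2 * pi * h)) ^ 3 = 1 / sqrt (2 * pi * h) / (2 * pi * h)"
    using h by (simp add: power3_eq_cube)
  finally show ?thesis
    using h by (simp add: p)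
qed

lemma gauss3_measurable [measurable]: "gauss3 h \<in> borel_measurable borel"
  unfolding gauss3_def[abs_def]
  by (intro borel_measurable_times measurable_compose[OF _ borel_measurable_normal_density]
    borel_measurable_continuous_onI continuous_intros)

lemma gauss3_nonneg [simp]: "0 \<le> gauss3 h x"
  by (simp add: gauss3_def)

lemma gauss3_radial:
  assumes h: "0 < h" and x: "x \<noteq> 0"
  shows "ennreal (gauss3 h x) = radial_density (entrance_density h) x"
  using assms by (simp add: gauss3_eq radial_density_def entrance_density_def divide_ennreal)

text \<open>Here \<open>r\<^sup>2 + z\<^sup>2 - 2 z b\<close> is the squared distance between a point at height \<open>z\<close> on an axis through the
  origin and a point of norm \<open>r\<close> at height \<open>b\<close>. It is affine in \<open>b\<close>, so the Gaussian integrates over the zone \<open>|b| \<le> r\<close> to a difference of its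
  values at \<open>r - z\<close> and \<open>r + z\<close>.\<close>

lemma gauss3_shell_integral:
  assumes h: "0 < h" and z: "0 < z" and r: "0 \<le> r"
  defines "q \<equiv> \<lambda>b. normal_density 0 (sqrt h) (sqrt (r\<^sup>2 + z\<^sup>2 - 2 * (z * b))) / (2 * pi * h)"
  shows "(\<integral>\<^sup>+b. ennreal (q b) * indicator {- r..r} b \<partial>lborel) = ennreal (killed_density h r z) / ennreal (2 * pi * z)"
proof -
  define C where "C = 1 / sqrt (2 * pi * h)"
  define g where "g b = C / (2 * pi * h) * exp (- ((r\<^sup>2 + z\<^sup>2 - 2 * (z * b)) / (2 * h)))" for b
  have q: "q b = g b" if "b \<in> {- r..r}" for b
  proof -
    have "0 \<le> (r - z)\<^sup>2 + 2 * (z * (r - b))"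
      using that z by auto
    also have "\<dots> = r\<^sup>2 + z\<^sup>2 - 2 * (z * b)"
      by (simp add: power2_eq_square algebra_simps)
    finally show ?thesis
      using h by (simp add: q_def g_def C_def normal_density_def)
  qed
  have "(\<integral>\<^sup>+b. ennreal (q b) * indicator {- r..r} b \<partial>lborel) = (\<integral>\<^sup>+b. ennreal (g b) * indicator {- r..r} b \<partial>lborel)"
    using q by (intro nn_integral_cong) (auto simp: indicator_def)
  also have "\<dots> = ennreal (h / z * g r - h / z * g (- r))"
  proof (rule nn_integral_FTC_Icc[where F = "\<lambda>b. h / z * g b"])
    show "g \<in> borel_measurable borel"
      unfolding g_def[abs_def] by measurable
    fix b assume "b \<in> {- r..r}"
    show "((\<lambda>b. h / z * g b) has_real_derivative g b) (at b)"
      unfolding g_def using h z by (auto intro!: derivative_eq_intros simp: field_simps)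
    show "0 \<le> g b"
      using h by (simp add: g_def C_def)
  qed (use r in simp)
  also have "h / z * g r - h / z * g (- r) = killed_density h r z / (2 * pi * z)"
  proof -
    have "r\<^sup>2 + z\<^sup>2 - 2 * (z * r) = (r - z)\<^sup>2" "r\<^sup>2 + z\<^sup>2 - 2 * (z * - r) = (r + z)\<^sup>2"
      by (simp_all add: power2_eq_square algebra_simps)
    then have "g r = normal_density 0 (sqrt h) (r - z) / (2 * pi * h)" "g (- r) = normal_density 0 (sqrt h) (r + z) / (2 * pi * h)"
      using h by (simp_all add: g_def C_def normal_density_def)
    then show ?thesis
      using h z by (simp add: killed_density_def diff_divide_distrib mult.commute)
  qed
  also have "ennreal (killed_density h r z / (2 * pi * z)) = ennreal (killed_density h r z) / ennreal (2 * pi * z)"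
    using z r by (intro divide_ennreal[symmetric] killed_density_nonneg) auto
  finally show ?thesis .
qed

text \<open>Rotate \<open>z\<close> into the first axis, pass to the coordinates \<open>(|x|, x\<^sub>1)\<close> and integrate over \<open>x\<^sub>1\<close> first. The
  result is the three-dimensional Bessel semigroup written with the killed density.\<close>

lemma radial_gauss3_convolution:
  assumes [measurable]: "f \<in> borel_measurable borel" and h: "0 < h" and z: "z \<noteq> 0"
  shows "(\<integral>\<^sup>+x. radial_density f x * ennreal (gauss3 h (z - x)) \<partial>lborel) = radial_density (killed_step h f) z"
proof -
  let ?g = "\<lambda>q l. ennreal (normal_density 0 (sqrt h) (sqrt (q + (norm z)\<^sup>2 - 2 * l)) / (2 * pi * h))"
  let ?G = "\<lambda>(q, l). f (sqrt q) / ennreal (2 * pi * sqrt q) * ?g q l"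
  have G: "?G \<in> borel_measurable (borel \<Otimes>\<^sub>M borel)"
    by measurable
  have "norm (z - x) = sqrt ((norm x)\<^sup>2 + (norm z)\<^sup>2 - 2 * (x \<bullet> z))" for x
    by (simp add: norm_eq_sqrt_inner power2_norm_eq_inner inner_diff_left inner_diff_right inner_commute)
  then have "(\<integral>\<^sup>+x. radial_density f x * ennreal (gauss3 h (z - x)) \<partial>lborel) = (\<integral>\<^sup>+x. ?G ((norm x)\<^sup>2, x \<bullet> z) \<partial>lborel)"
    using h by (simp add: gauss3_eq radial_density_def)
  also have "\<dots> = (\<integral>\<^sup>+x. ?G ((norm x)\<^sup>2, norm z * fst x) \<partial>(lborel :: space3 measure))"
    by (rule nn_integral_rotate_inner[OF G])
  also have "\<dots> = (\<integral>\<^sup>+x. radial_density f x * (\<lambda>(r, b). ?g (r\<^sup>2) (norm z * b)) (norm x, fst x) \<partial>lborel)"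
    by (simp add: radial_density_def)
  also have "\<dots> = (\<integral>\<^sup>+p. (\<lambda>(r, b). ?g (r\<^sup>2) (norm z * b)) p \<partial>fan f)"
    by (rule nn_integral_radial) measurable
  also have "\<dots> = (\<integral>\<^sup>+r. (\<integral>\<^sup>+b. f r * indicator {- r..r} b * ?g (r\<^sup>2) (norm z * b) \<partial>lborel) \<partial>lborel)"
    by (subst nn_integral_fan(1)) simp_all
  also have "\<dots> = (\<integral>\<^sup>+r. f r * indicator {0..} r * ennreal (killed_density h r (norm z)) / ennreal (2 * pi * norm z) \<partial>lborel)"
  proof (rule nn_integral_cong)
    fix r :: real
    show "(\<integral>\<^sup>+b. f r * indicator {- r..r} b * ?g (r\<^sup>2) (norm z * b) \<partial>lborel) =
        f r * indicator {0..} r * ennreal (killed_density h r (norm z)) / ennreal (2 * pi * norm z)"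
    proof (cases "0 \<le> r")
      case False
      then have "{- r..r} = {}" by auto
      with False show ?thesis by simp
    next
      case True
      have "(\<integral>\<^sup>+b. f r * indicator {- r..r} b * ?g (r\<^sup>2) (norm z * b) \<partial>lborel) =
          (\<integral>\<^sup>+b. f r * (?g (r\<^sup>2) (norm z * b) * indicator {- r..r} b) \<partial>lborel)"
        by (simp add: mult_ac)
      also have "\<dots> = f r * (\<integral>\<^sup>+b. ?g (r\<^sup>2) (norm z * b) * indicator {- r..r} b \<partial>lborel)"
        by (rule nn_integral_cmult) measurable
      also have "\<dots> = f r * (ennreal (killed_density h r (norm z)) / ennreal (2 * pi * norm z))"
        using z by (subst gauss3_shell_integral[OF h _ True]) auto
      finally show ?thesis
        using True by (simp add: ennreal_times_divide)
    qed
  qed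
  also have "\<dots> = (\<integral>\<^sup>+r. f r * indicator {0..} r * ennreal (killed_density h r (norm z)) \<partial>lborel) / ennreal (2 * pi * norm z)"
    by (rule nn_integral_divide) measurable
  finally show ?thesis
    by (simp add: radial_density_def killed_step_def)
qed

section \<open>Finite-dimensional laws of the radial part\<close>

context standard_brownian_motion_3d begin

lemma coordinate_measurable: "0 \<le> s \<Longrightarrow> (\<lambda>\<omega>. W s \<omega> $ i) \<in> borel_measurable M"
  using standard_brownian_motion.random_variable_at[OF coordinates] .

text \<open>Independence over all coordinates and all time steps jointly: factor first over the coordinate processes,
  which are independent as processes, and then over the increments of each of them.\<close>

lemma increments_independent:
  assumes \<sigma>: "0 \<le> \<sigma> 0" "mono \<sigma>" and n: "0 < n"
  shows "indep_vars (\<lambda>_. borel) (\<lambda>p \<omega>. W (\<sigma> (Suc (snd p))) \<omega> $ fst p - W (\<sigma> (snd p)) \<omega> $ fst p) (UNIV \<times> {..<n})"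
proof -
  have pos: "0 \<le> \<sigma> j" for j
    using \<sigma> monoD[OF \<sigma>(2), of 0 j] by simp
  let ?D = "\<lambda>p \<omega>. W (\<sigma> (Suc (snd p))) \<omega> $ fst p - W (\<sigma> (snd p)) \<omega> $ fst p"
  let ?I = "(UNIV :: 3 set) \<times> {..<n}"
  have D [measurable]: "?D p \<in> borel_measurable M" for p
    using pos by (intro borel_measurable_diff coordinate_measurable)
  show ?thesis
  proof (subst indep_vars_finite[where E = "\<lambda>_. sets borel"])
    show "?I \<noteq> {}" "finite ?I" using n by auto
    show "\<forall>A\<in>?I \<rightarrow> sets borel. prob (\<Inter>p\<in>?I. ?D p -` A p \<inter> space M) = (\<Prod>p\<in>?I. prob (?D p -` A p \<inter> space M))"
    proof
      fix A :: "3 \<times> nat \<Rightarrow> real set" assume "A \<in> ?I \<rightarrow> sets borel"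
      then have A: "A (i, j) \<in> sets borel" if "j < n" for i j
        using that by auto
      let ?P = "\<lambda>i \<omega>. \<lambda>s\<in>{0..}. W s \<omega> $ i"
      define C where "C i = {x \<in> space (PiM {0..} (\<lambda>_. borel)). \<forall>j\<in>{..<n}. x (\<sigma> (Suc j)) - x (\<sigma> j) \<in> A (i, j)}" for i
      have C: "C i \<in> sets (PiM {0..} (\<lambda>_. borel))" for i
        unfolding C_def
      proof (intro sets.sets_Collect_countable_All')
        fix j assume "j \<in> {..<n}"
        then have "A (i, j) \<in> sets borel" using A by simp
        moreover have "(\<lambda>x. x (\<sigma> (Suc j)) - x (\<sigma> j)) \<in> borel_measurable (PiM {0..} (\<lambda>_. borel :: real measure))"
          using pos by (intro borel_measurable_diff measurable_component_singleton) auto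
        ultimately have "(\<lambda>x. x (\<sigma> (Suc j)) - x (\<sigma> j)) -` A (i, j) \<inter> space (PiM {0..} (\<lambda>_. borel)) \<in> sets (PiM {0..} (\<lambda>_. borel))"
          by (intro measurable_sets)
        then show "{x \<in> space (PiM {0..} (\<lambda>_. borel)). x (\<sigma> (Suc j)) - x (\<sigma> j) \<in> A (i, j)} \<in> sets (PiM {0..} (\<lambda>_. borel))"
          by (simp add: vimage_def Int_def conj_commute)
      qed simp
      have PC: "?P i -` C i \<inter> space M = (\<Inter>j\<in>{..<n}. ?D (i, j) -` A (i, j) \<inter> space M)" for i
        using pos n by (auto simp: C_def space_PiM)
      have "(\<Inter>p\<in>?I. ?D p -` A p \<inter> space M) = (\<Inter>i\<in>UNIV. ?P i -` C i \<inter> space M)"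
        unfolding PC using n by auto
      then have "prob (\<Inter>p\<in>?I. ?D p -` A p \<inter> space M) = prob (\<Inter>i\<in>UNIV. ?P i -` C i \<inter> space M)"
        by simp
      also have "\<dots> = (\<Prod>i\<in>UNIV. prob (?P i -` C i \<inter> space M))"
        by (rule indep_varsD_finite[OF independent_coordinates]) (use C in auto)
      also have "\<dots> = (\<Prod>i\<in>UNIV. \<Prod>j\<in>{..<n}. prob (?D (i, j) -` A (i, j) \<inter> space M))"
      proof (rule prod.cong[OF refl])
        fix i :: 3
        have "indep_vars (\<lambda>_. borel) (\<lambda>j. ?D (i, j)) {..<n}"
          using standard_brownian_motion.independent_increments[OF coordinates[of i], of \<sigma> n] \<sigma>
          by (simp add: mono_imp_mono_on)
        then show "prob (?P i -` C i \<inter> space M) = (\<Prod>j\<in>{..<n}. prob (?D (i, j) -` A (i, j) \<inter> space M))"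
          unfolding PC by (rule indep_varsD_finite) (use n A in auto)
      qed
      also have "\<dots> = (\<Prod>p\<in>?I. prob (?D p -` A p \<inter> space M))"
        by (simp add: prod.cartesian_product case_prod_unfold)
      finally show "prob (\<Inter>p\<in>?I. ?D p -` A p \<inter> space M) = (\<Prod>p\<in>?I. prob (?D p -` A p \<inter> space M))" .
    qed
  qed (auto simp: Int_stable_def sets.sigma_sets_eq[of borel, simplified])
qed

definition increment :: "real \<Rightarrow> real \<Rightarrow> 'a \<Rightarrow> space3" where
  "increment r s \<omega> = (W s \<omega> $ 1 - W r \<omega> $ 1, W s \<omega> $ 2 - W r \<omega> $ 2, W s \<omega> $ 3 - W r \<omega> $ 3)"

lemma increment_measurable: "0 \<le> r \<Longrightarrow> 0 \<le> s \<Longrightarrow> increment r s \<in> borel_measurable M"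
  unfolding increment_def[abs_def] borel_prod[symmetric]
  by (intro measurable_Pair borel_measurable_diff coordinate_measurable)

text \<open>Nesting the pairs as in the type of \<open>space3\<close> makes the joint law an iterated product.\<close>

lemma increment_law:
  assumes rs: "0 \<le> r" "r < s"
  shows "distr M borel (increment r s) = density lborel (\<lambda>x. ennreal (gauss3 (s - r) x))"
proof -
  let ?D = "\<lambda>i \<omega>. W s \<omega> $ i - W r \<omega> $ i"
  let ?p = "\<lambda>x. ennreal (normal_density 0 (sqrt (s - r)) x)"
  define \<sigma> :: "nat \<Rightarrow> real" where "\<sigma> j = (if j = 0 then r else s)" for j
  have "mono \<sigma>" "0 \<le> \<sigma> 0"
    using rs by (auto simp: \<sigma>_def mono_def)
  from increments_independent[OF this(2,1), of 1]
  have ind: "indep_vars (\<lambda>_. borel) (\<lambda>p. ?D (fst p)) ((UNIV :: 3 set) \<times> {0::nat})"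
    by (rule indep_vars_cong[THEN iffD1, rotated 3]) (auto simp: \<sigma>_def)
  have [measurable]: "?D i \<in> borel_measurable M" for i
    using rs by (intro borel_measurable_diff coordinate_measurable) auto
  have law: "distr M borel (?D i) = density lborel ?p" for i
  proof -
    have "distributed M lborel (?D i) (normal_density 0 (sqrt (s - r)))"
      using standard_brownian_motion.gaussian_increments[OF coordinates rs] .
    then have "distr M lborel (?D i) = density lborel ?p"
      by (rule distributed_distr_eq_density)
    moreover have "distr M borel (?D i) = distr M lborel (?D i)"
      by (rule distr_cong) simp_all
    ultimately show ?thesis by simp
  qed
  have "indep_var (PiM {(2, 0)} (\<lambda>_. borel)) (\<lambda>\<omega>. \<lambda>p\<in>{(2::3, 0::nat)}. ?D (fst p) \<omega>)
      (PiM {(3, 0)} (\<lambda>_. borel)) (\<lambda>\<omega>. \<lambda>p\<in>{(3::3, 0::nat)}. ?D (fst p) \<omega>)"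
    by (rule indep_var_restrict[OF ind]) auto
  from independent_pair_compose[OF independent_pair_of_indep_var[OF this], of "\<lambda>x. x (2, 0)" borel "\<lambda>x. x (3, 0)" borel]
  have 23: "independent_pair borel (?D 2) borel (?D 3)"
    by (simp add: measurable_component_singleton)
  have "indep_var (PiM {(1, 0)} (\<lambda>_. borel)) (\<lambda>\<omega>. \<lambda>p\<in>{(1::3, 0::nat)}. ?D (fst p) \<omega>)
      (PiM {(2, 0), (3, 0)} (\<lambda>_. borel)) (\<lambda>\<omega>. \<lambda>p\<in>{(2::3, 0::nat), (3, 0)}. ?D (fst p) \<omega>)"
    by (rule indep_var_restrict[OF ind]) auto
  from independent_pair_compose[OF independent_pair_of_indep_var[OF this], of "\<lambda>x. x (1, 0)" borel
      "\<lambda>x. (x (2, 0), x (3, 0))" "borel \<Otimes>\<^sub>M borel"]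
  have 123: "independent_pair borel (?D 1) (borel \<Otimes>\<^sub>M borel) (\<lambda>\<omega>. (?D 2 \<omega>, ?D 3 \<omega>))"
    by (simp add: measurable_component_singleton)
  interpret p: prob_space "density lborel ?p"
    using rs by (intro prob_space_normal_density) simp
  have "distr M borel (increment r s) = distr M (borel \<Otimes>\<^sub>M borel \<Otimes>\<^sub>M borel) (\<lambda>\<omega>. (?D 1 \<omega>, ?D 2 \<omega>, ?D 3 \<omega>))"
    by (simp add: increment_def[abs_def] borel_prod)
  also have "\<dots> = density lborel ?p \<Otimes>\<^sub>M (density lborel ?p \<Otimes>\<^sub>M density lborel ?p)"
    using 23 123 by (simp add: independent_pair_def law)
  also have "density lborel ?p \<Otimes>\<^sub>M density lborel ?p = density (lborel \<Otimes>\<^sub>M lborel) (\<lambda>(y, z). ?p y * ?p z)"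
    by (rule pair_measure_density) (auto intro: sigma_finite_lborel p.sigma_finite_measure_axioms)
  also have "density lborel ?p \<Otimes>\<^sub>M density (lborel \<Otimes>\<^sub>M lborel) (\<lambda>(y, z). ?p y * ?p z) =
      density (lborel \<Otimes>\<^sub>M (lborel \<Otimes>\<^sub>M lborel)) (\<lambda>(x, q). ?p x * (\<lambda>(y, z). ?p y * ?p z) q)"
  proof (rule pair_measure_density)
    show "sigma_finite_measure (lborel \<Otimes>\<^sub>M (lborel :: real measure) :: (real \<times> real) measure)"
      unfolding lborel_prod by (rule sigma_finite_lborel)
    show "sigma_finite_measure (density (lborel \<Otimes>\<^sub>M lborel) (\<lambda>(y, z). ?p y * ?p z))"
      by (subst pair_measure_density[symmetric])
        (auto intro!: sigma_finite_lborel p.sigma_finite_measure_axioms sigma_finite_pair_measure)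
  qed measurable
  also have "\<dots> = density lborel (\<lambda>x. ennreal (gauss3 (s - r) x))"
    unfolding lborel_prod by (rule arg_cong[where f = "density lborel"]) (auto simp: fun_eq_iff gauss3_def ennreal_mult)
  finally show ?thesis .
qed

text \<open>The values at the times \<open>\<tau> 0, ..., \<tau> n\<close>, measured from time \<open>0\<close>, are partial sums of the increments over the
  times \<open>0, \<tau> 0, \<tau> 1, ...\<close>; hence the shifted enumeration \<open>\<sigma>\<close>.\<close>

lemma past_increments_independent:
  assumes \<tau>: "0 \<le> \<tau> 0" "mono \<tau>"
  shows "independent_pair (PiM {..n} (\<lambda>_. borel)) (\<lambda>\<omega>. \<lambda>i\<in>{..n}. increment 0 (\<tau> i) \<omega>)
    borel (increment (\<tau> n) (\<tau> (Suc n)))"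
proof -
  define \<sigma> where "\<sigma> j = (case j of 0 \<Rightarrow> 0 | Suc i \<Rightarrow> \<tau> i)" for j
  have \<sigma>: "0 \<le> \<sigma> 0" "mono \<sigma>"
  proof -
    show "mono \<sigma>"
      unfolding mono_iff_le_Suc using \<tau> by (auto simp: \<sigma>_def mono_iff_le_Suc split: nat.split)
  qed (simp add: \<sigma>_def)
  let ?D = "\<lambda>p \<omega>. W (\<sigma> (Suc (snd p))) \<omega> $ fst p - W (\<sigma> (snd p)) \<omega> $ fst p"
  let ?A = "(UNIV :: 3 set) \<times> {..n}" and ?B = "(UNIV :: 3 set) \<times> {Suc n}"
  have "indep_var (PiM ?A (\<lambda>_. borel)) (\<lambda>\<omega>. \<lambda>p\<in>?A. ?D p \<omega>) (PiM ?B (\<lambda>_. borel)) (\<lambda>\<omega>. \<lambda>p\<in>?B. ?D p \<omega>)"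
    by (rule indep_var_restrict[OF increments_independent[OF \<sigma>, of "Suc (Suc n)"]]) auto
  then have "independent_pair (PiM ?A (\<lambda>_. borel)) (\<lambda>\<omega>. \<lambda>p\<in>?A. ?D p \<omega>) (PiM ?B (\<lambda>_. borel)) (\<lambda>\<omega>. \<lambda>p\<in>?B. ?D p \<omega>)"
    by (rule independent_pair_of_indep_var)
  then have *: "independent_pair (PiM {..n} (\<lambda>_. borel))
      (\<lambda>\<omega>. (\<lambda>x. \<lambda>i\<in>{..n}. (\<Sum>j\<le>i. x (1, j), \<Sum>j\<le>i. x (2, j), \<Sum>j\<le>i. x (3, j))) (\<lambda>p\<in>?A. ?D p \<omega>))
      borel (\<lambda>\<omega>. (\<lambda>y. (y (1, Suc n), y (2, Suc n), y (3, Suc n))) (\<lambda>p\<in>?B. ?D p \<omega>))"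
  proof (rule independent_pair_compose)
    show "(\<lambda>x. \<lambda>i\<in>{..n}. (\<Sum>j\<le>i. x (1, j), \<Sum>j\<le>i. x (2, j), \<Sum>j\<le>i. x (3, j)))
        \<in> PiM ?A (\<lambda>_. borel :: real measure) \<rightarrow>\<^sub>M PiM {..n} (\<lambda>_. borel :: space3 measure)"
      unfolding borel_prod[symmetric]
      by (intro measurable_restrict measurable_Pair borel_measurable_sum measurable_component_singleton) auto
    show "(\<lambda>y. (y (1, Suc n), y (2, Suc n), y (3, Suc n))) \<in> PiM ?B (\<lambda>_. borel :: real measure) \<rightarrow>\<^sub>M (borel :: space3 measure)"
      unfolding borel_prod[symmetric]
      by (intro measurable_Pair measurable_component_singleton) auto
  qed
  have tel: "(\<Sum>j\<le>i. W (\<sigma> (Suc j)) \<omega> $ k - W (\<sigma> j) \<omega> $ k) = W (\<tau> i) \<omega> $ k - W 0 \<omega> $ k" for i k \<omega>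
    using sum_lessThan_telescope[of "\<lambda>j. W (\<sigma> j) \<omega> $ k" "Suc i"]
    by (simp only: lessThan_Suc_atMost) (simp add: \<sigma>_def)
  have "(\<lambda>\<omega>. (\<lambda>x. \<lambda>i\<in>{..n}. (\<Sum>j\<le>i. x (1, j), \<Sum>j\<le>i. x (2, j), \<Sum>j\<le>i. x (3, j))) (\<lambda>p\<in>?A. ?D p \<omega>)) =
      (\<lambda>\<omega>. \<lambda>i\<in>{..n}. increment 0 (\<tau> i) \<omega>)"
  proof (rule ext, rule restrict_ext)
    fix \<omega> i assume "i \<in> {..n}"
    then have "(\<Sum>j\<le>i. (\<lambda>p\<in>?A. ?D p \<omega>) (k, j)) = W (\<tau> i) \<omega> $ k - W 0 \<omega> $ k" for k
      unfolding tel[symmetric] by (intro sum.cong) auto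
    then show "(\<Sum>j\<le>i. (\<lambda>p\<in>?A. ?D p \<omega>) (1, j), \<Sum>j\<le>i. (\<lambda>p\<in>?A. ?D p \<omega>) (2, j), \<Sum>j\<le>i. (\<lambda>p\<in>?A. ?D p \<omega>) (3, j)) =
        increment 0 (\<tau> i) \<omega>"
      unfolding increment_def by (simp only:)
  qed
  moreover have "(\<lambda>\<omega>. (\<lambda>y. (y (1, Suc n), y (2, Suc n), y (3, Suc n))) (\<lambda>p\<in>?B. ?D p \<omega>)) = increment (\<tau> n) (\<tau> (Suc n))"
    by (auto simp: increment_def \<sigma>_def)
  ultimately show ?thesis
    using * by simp
qed

end

definition radial :: "(real \<Rightarrow> ennreal) \<Rightarrow> space3 measure" where
  "radial f = density lborel (radial_density f)"

lemma sets_radial [simp, measurable_cong]: "sets (radial f) = sets borel"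
  by (simp add: radial_def)

lemma (in prob_space) radial_restrict:
  assumes E: "E \<in> events" and Z: "Z \<in> borel_measurable M" and f: "f \<in> borel_measurable borel"
    and C: "C \<in> sets borel" and eq: "law_on M E Z = radial f"
  shows "law_on M {\<omega> \<in> E. norm (Z \<omega>) \<in> C} Z = radial (\<lambda>r. f r * indicator C r)"
proof -
  have "radial_density (\<lambda>r. f r * indicator C r) = (\<lambda>x. radial_density f x * indicator C (norm x))"
    by (auto simp: radial_density_def fun_eq_iff indicator_def)
  then show ?thesis
    using law_on_restrict[OF E Z radial_density_measurable[OF f] borel_measurable_norm C eq[unfolded radial_def]]
    by (simp add: radial_def)
qed

text \<open>The law of a sum of independent variables is a convolution, here of a rotation-invariant density with
  a Gaussian one. The formula for the convolution holds outside the origin, that is, almost everywhere.\<close>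

lemma (in prob_space) radial_step:
  assumes ind: "independent_pair S X borel Y" and A: "A \<in> sets S" and q: "q \<in> borel_measurable S"
    and E: "E = {\<omega> \<in> space M. X \<omega> \<in> A}"
    and f [measurable]: "f \<in> borel_measurable borel" and h: "0 < h"
    and eq: "law_on M E (\<lambda>\<omega>. q (X \<omega>)) = radial f"
    and Y: "distr M borel Y = density lborel (\<lambda>x. ennreal (gauss3 h x))"
  shows "law_on M E (\<lambda>\<omega>. q (X \<omega>) + Y \<omega>) = radial (killed_step h f)"
proof (rule measure_eqI)
  have Xm [measurable]: "X \<in> measurable M S" and Ym [measurable]: "Y \<in> borel_measurable M"
    using ind by (auto simp: independent_pair_def)
  note [measurable] = A q
  have "E = X -` A \<inter> space M" by (auto simp: E)
  then have ev [measurable]: "E \<in> events" by simp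
  have Zs [measurable]: "(\<lambda>\<omega>. q (X \<omega>)) \<in> borel_measurable M"
    by measurable
  have Z [measurable]: "(\<lambda>\<omega>. q (X \<omega>) + Y \<omega>) \<in> borel_measurable M"
    by measurable
  show "sets (law_on M E (\<lambda>\<omega>. q (X \<omega>) + Y \<omega>)) = sets (radial (killed_step h f))"
    by (simp add: law_on_facts)
  fix D assume "D \<in> sets (law_on M E (\<lambda>\<omega>. q (X \<omega>) + Y \<omega>))"
  then have D [measurable]: "D \<in> sets borel"
    by (simp add: law_on_facts)
  define H where "H v = (\<integral>\<^sup>+z. ennreal (gauss3 h (z - v)) * indicator D z \<partial>lborel)" for v
  have H [measurable]: "H \<in> borel_measurable borel"
    unfolding H_def[abs_def] by measurable
  have shift: "(\<integral>\<^sup>+\<eta>. indicator D (v + Y \<eta>) \<partial>M) = H v" for v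
  proof -
    have "(\<integral>\<^sup>+\<eta>. indicator D (v + Y \<eta>) \<partial>M) = (\<integral>\<^sup>+y. indicator D (v + y) \<partial>distr M borel Y)"
      by (subst nn_integral_distr) simp_all
    also have "\<dots> = (\<integral>\<^sup>+y. ennreal (gauss3 h (v + y - v)) * indicator D (v + y) \<partial>lborel)"
      unfolding Y by (subst nn_integral_density) simp_all
    also have "\<dots> = (\<integral>\<^sup>+z. ennreal (gauss3 h (z - v)) * indicator D z \<partial>distr lborel borel ((+) v))"
      by (subst nn_integral_distr) simp_all
    finally show ?thesis
      unfolding lborel_distr_plus H_def .
  qed
  have "emeasure (law_on M E (\<lambda>\<omega>. q (X \<omega>) + Y \<omega>)) D = (\<integral>\<^sup>+z. indicator D z \<partial>law_on M E (\<lambda>\<omega>. q (X \<omega>) + Y \<omega>))"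
    using D by (simp add: law_on_facts)
  also have "\<dots> = (\<integral>\<^sup>+\<omega>. indicator E \<omega> * indicator D (q (X \<omega>) + Y \<omega>) \<partial>M)"
    by (rule law_on_facts(4)[OF ev Z]) measurable
  also have "\<dots> = (\<integral>\<^sup>+\<omega>. (\<lambda>(x, y). indicator A x * indicator D (q x + y)) (X \<omega>, Y \<omega>) \<partial>M)"
    by (intro nn_integral_cong) (auto simp: E indicator_def)
  also have "\<dots> = (\<integral>\<^sup>+\<omega>. (\<integral>\<^sup>+\<eta>. (\<lambda>(x, y). indicator A x * indicator D (q x + y)) (X \<omega>, Y \<eta>) \<partial>M) \<partial>M)"
    by (rule nn_integral_independent_pair[OF ind]) measurable
  also have "\<dots> = (\<integral>\<^sup>+\<omega>. indicator E \<omega> * H (q (X \<omega>)) \<partial>M)"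
  proof (rule nn_integral_cong)
    fix \<omega> assume "\<omega> \<in> space M"
    then show "(\<integral>\<^sup>+\<eta>. (\<lambda>(x, y). indicator A x * indicator D (q x + y)) (X \<omega>, Y \<eta>) \<partial>M) = indicator E \<omega> * H (q (X \<omega>))"
    proof -
      have "indicator E \<omega> = (indicator A (X \<omega>) :: ennreal)"
        using \<open>\<omega> \<in> space M\<close> by (simp add: E indicator_def)
      then show ?thesis
        by (simp add: nn_integral_cmult shift)
    qed
  qed
  also have "\<dots> = (\<integral>\<^sup>+v. H v \<partial>law_on M E (\<lambda>\<omega>. q (X \<omega>)))"
    by (rule law_on_facts(4)[OF ev Zs H, symmetric])
  also have "\<dots> = (\<integral>\<^sup>+v. radial_density f v * H v \<partial>lborel)"
    unfolding eq radial_def by (rule nn_integral_density) measurable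
  also have "\<dots> = (\<integral>\<^sup>+v. (\<integral>\<^sup>+z. radial_density f v * (ennreal (gauss3 h (z - v)) * indicator D z) \<partial>lborel) \<partial>lborel)"
    unfolding H_def by (intro nn_integral_cong nn_integral_cmult[symmetric]) measurable
  also have "\<dots> = (\<integral>\<^sup>+z. (\<integral>\<^sup>+v. radial_density f v * (ennreal (gauss3 h (z - v)) * indicator D z) \<partial>lborel) \<partial>lborel)"
    by (rule lborel_pair.Fubini') measurable
  also have "\<dots> = (\<integral>\<^sup>+z. radial_density (killed_step h f) z * indicator D z \<partial>lborel)"
  proof (rule nn_integral_cong_AE)
    show "AE z in lborel. (\<integral>\<^sup>+v. radial_density f v * (ennreal (gauss3 h (z - v)) * indicator D z) \<partial>lborel) =
        radial_density (killed_step h f) z * indicator D z"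
      using AE_lborel_singleton[of 0]
    proof eventually_elim
      case (elim z)
      have "(\<integral>\<^sup>+v. radial_density f v * (ennreal (gauss3 h (z - v)) * indicator D z) \<partial>lborel) =
          (\<integral>\<^sup>+v. radial_density f v * ennreal (gauss3 h (z - v)) \<partial>lborel) * indicator D z"
        unfolding mult.assoc[symmetric] by (rule nn_integral_multc) measurable
      then show ?case
        using radial_gauss3_convolution[OF f h, of z] elim by simp
    qed
  qed
  also have "\<dots> = emeasure (radial (killed_step h f)) D"
    unfolding radial_def by (rule emeasure_density[symmetric]) measurable
  finally show "emeasure (law_on M E (\<lambda>\<omega>. q (X \<omega>) + Y \<omega>)) D = emeasure (radial (killed_step h f)) D" .
qed

lemma (in prob_space) radial_imp_fan:
  assumes E [measurable]: "E \<in> events" and Z [measurable]: "Z \<in> borel_measurable M"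
    and f [measurable]: "f \<in> borel_measurable borel" and eq: "law_on M E Z = radial f"
  shows "law_on M E (\<lambda>\<omega>. (norm (Z \<omega>), fst (Z \<omega>))) = fan f"
proof (rule measure_eqI)
  have Z' [measurable]: "(\<lambda>\<omega>. (norm (Z \<omega>), fst (Z \<omega>))) \<in> borel_measurable M"
    by (rule measurable_compose[OF Z measurable_norm_fst])
  show "sets (law_on M E (\<lambda>\<omega>. (norm (Z \<omega>), fst (Z \<omega>)))) = sets (fan f)"
    by (simp add: law_on_facts)
  fix D assume "D \<in> sets (law_on M E (\<lambda>\<omega>. (norm (Z \<omega>), fst (Z \<omega>))))"
  then have D: "D \<in> sets borel"
    by (simp add: law_on_facts)
  have D'm: "(\<lambda>x :: space3. indicator D (norm x, fst x) :: ennreal) \<in> borel_measurable borel"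
    by (rule measurable_compose[OF measurable_norm_fst]) (use D in simp)
  have "emeasure (law_on M E (\<lambda>\<omega>. (norm (Z \<omega>), fst (Z \<omega>)))) D =
      (\<integral>\<^sup>+p. indicator D p \<partial>law_on M E (\<lambda>\<omega>. (norm (Z \<omega>), fst (Z \<omega>))))"
    using D by (simp add: law_on_facts)
  also have "\<dots> = (\<integral>\<^sup>+\<omega>. indicator E \<omega> * indicator D (norm (Z \<omega>), fst (Z \<omega>)) \<partial>M)"
    by (rule law_on_facts(4)[OF E Z']) (use D in simp)
  also have "\<dots> = (\<integral>\<^sup>+x. indicator D (norm x, fst x) \<partial>law_on M E Z)"
    by (rule law_on_facts(4)[OF E Z D'm, symmetric])
  also have "\<dots> = (\<integral>\<^sup>+x. radial_density f x * indicator D (norm x, fst x) \<partial>lborel)"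
    unfolding eq radial_def by (rule nn_integral_density) (use D'm in simp_all)
  also have "\<dots> = (\<integral>\<^sup>+p. indicator D p \<partial>fan f)"
    by (rule nn_integral_radial) (use D in \<open>simp_all add: borel_prod\<close>)
  also have "\<dots> = emeasure (fan f) D"
    using D by simp
  finally show "emeasure (law_on M E (\<lambda>\<omega>. (norm (Z \<omega>), fst (Z \<omega>)))) D = emeasure (fan f) D" .
qed

lemma (in standard_brownian_motion_3d) norm_finite_dimensional_law:
  assumes \<tau>: "0 < \<tau> 0" "strict_mono \<tau>" and A [measurable]: "\<And>i. A i \<in> sets borel"
  shows "law_on M {\<omega> \<in> space M. \<forall>i\<le>n. norm (increment 0 (\<tau> i) \<omega>) \<in> A i}
      (\<lambda>\<omega>. (norm (increment 0 (\<tau> n) \<omega>), fst (increment 0 (\<tau> n) \<omega>))) = fan (path_weight \<tau> A n)"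
proof -
  have pos: "0 < \<tau> i" for i
    using \<tau> strict_mono_less_eq[of \<tau> 0 i] by simp
  have m [measurable]: "increment 0 (\<tau> i) \<in> borel_measurable M" for i
    using pos[of i] by (intro increment_measurable) auto
  define E where "E n = {\<omega> \<in> space M. \<forall>i\<le>n. norm (increment 0 (\<tau> i) \<omega>) \<in> A i}" for n
  have ev: "E n \<in> events" for n
    unfolding E_def by measurable
  have "law_on M (E n) (increment 0 (\<tau> n)) = radial (path_weight \<tau> A n)"
  proof (induction n)
    case 0
    have "law_on M (space M) (increment 0 (\<tau> 0)) = distr M borel (increment 0 (\<tau> 0))"
    proof (rule measure_eqI)
      fix D assume "D \<in> sets (law_on M (space M) (increment 0 (\<tau> 0)))"
      then have D: "D \<in> sets borel" by (simp add: law_on_facts)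
      show "emeasure (law_on M (space M) (increment 0 (\<tau> 0))) D = emeasure (distr M borel (increment 0 (\<tau> 0))) D"
        unfolding law_on_facts(3)[OF sets.top m D] emeasure_distr[OF m D]
        by (auto intro!: arg_cong[where f = "emeasure M"])
    qed (simp add: law_on_facts)
    also have "\<dots> = density lborel (\<lambda>x. ennreal (gauss3 (\<tau> 0) x))"
      using increment_law[of 0 "\<tau> 0"] \<tau>(1) by simp
    also have "\<dots> = radial (entrance_density (\<tau> 0))"
      unfolding radial_def
    proof (rule density_cong)
      show "AE x in lborel. ennreal (gauss3 (\<tau> 0) x) = radial_density (entrance_density (\<tau> 0)) x"
        using AE_lborel_singleton[of 0] by eventually_elim (rule gauss3_radial[OF \<tau>(1)])
    qed measurable
    finally have "law_on M (space M) (increment 0 (\<tau> 0)) = radial (entrance_density (\<tau> 0))" .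
    moreover have "{\<omega> \<in> space M. norm (increment 0 (\<tau> 0) \<omega>) \<in> A 0} = E 0"
      by (auto simp: E_def)
    ultimately show ?case
      using radial_restrict[OF sets.top m entrance_density_measurable A, of 0 "\<tau> 0" 0] by simp
  next
    case (Suc n)
    let ?S = "PiM {..n} (\<lambda>_. borel :: space3 measure)"
    let ?X = "\<lambda>\<omega>. \<lambda>i\<in>{..n}. increment 0 (\<tau> i) \<omega>"
    define A' where "A' = {x \<in> space ?S. \<forall>i\<in>{..n}. norm (x i) \<in> A i}"
    have A': "A' \<in> sets ?S"
      unfolding A'_def
    proof (intro sets.sets_Collect_countable_All')
      fix i assume "i \<in> {..n}"
      then have "(\<lambda>x. norm (x i)) \<in> borel_measurable ?S"
        by (rule measurable_compose[OF measurable_component_singleton[where M = "\<lambda>_. borel"] borel_measurable_norm])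
      from measurable_sets[OF this A[of i]] show "{x \<in> space ?S. norm (x i) \<in> A i} \<in> sets ?S"
        by (simp add: vimage_def Int_def conj_commute)
    qed simp
    have E: "E n = {\<omega> \<in> space M. ?X \<omega> \<in> A'}"
      by (auto simp: E_def A'_def space_PiM)
    have less: "0 < \<tau> (Suc n) - \<tau> n" "\<tau> n < \<tau> (Suc n)"
      using \<tau>(2) by (simp_all add: strict_mono_less)
    have q: "(\<lambda>x. x n) \<in> borel_measurable ?S"
      by (intro measurable_component_singleton) simp
    have "law_on M (E n) (\<lambda>\<omega>. ?X \<omega> n + increment (\<tau> n) (\<tau> (Suc n)) \<omega>) =
        radial (killed_step (\<tau> (Suc n) - \<tau> n) (path_weight \<tau> A n))"
    proof (rule radial_step[OF past_increments_independent A' q E path_weight_measurable[OF A] less(1)])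
      show "0 \<le> \<tau> 0" "mono \<tau>" using \<tau> by (auto intro: strict_mono_mono)
      show "law_on M (E n) (\<lambda>\<omega>. ?X \<omega> n) = radial (path_weight \<tau> A n)"
        using Suc.IH by simp
      show "distr M borel (increment (\<tau> n) (\<tau> (Suc n))) = density lborel (\<lambda>x. ennreal (gauss3 (\<tau> (Suc n) - \<tau> n) x))"
        using pos[of n] less(2) by (intro increment_law) auto
    qed
    moreover have "(\<lambda>\<omega>. ?X \<omega> n + increment (\<tau> n) (\<tau> (Suc n)) \<omega>) = increment 0 (\<tau> (Suc n))"
      by (auto simp: increment_def)
    ultimately have step: "law_on M (E n) (increment 0 (\<tau> (Suc n))) = radial (killed_step (\<tau> (Suc n) - \<tau> n) (path_weight \<tau> A n))"
      by simp
    have "{\<omega> \<in> E n. norm (increment 0 (\<tau> (Suc n)) \<omega>) \<in> A (Suc n)} = E (Suc n)"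
      by (auto simp: E_def le_Suc_eq)
    then show ?case
      using radial_restrict[OF ev m killed_step_measurable[OF path_weight_measurable[OF A]] A step, of "Suc n"] by simp
  qed
  then show ?thesis
    using radial_imp_fan[OF ev[of n] m[of n] path_weight_measurable[of A, OF A, of \<tau> n]] unfolding E_def by simp
qed

section \<open>From finite-dimensional laws to laws of paths\<close>

text \<open>Beyond the last time \<open>t\<close> the enumeration continues arbitrarily, by steps of \<open>1\<close>, in order to be strictly
  monotone on all natural numbers.\<close>

lemma strict_mono_enumeration:
  assumes K: "finite K" "K \<subseteq> {0<..t}" "t \<in> K"
  shows "\<exists>(\<tau> :: nat \<Rightarrow> real) n. strict_mono \<tau> \<and> 0 < \<tau> 0 \<and> \<tau> ` {..n} = K \<and> \<tau> n = t"
proof -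
  define xs where "xs = sorted_list_of_set K"
  define n where "n = length xs - 1"
  have xs: "set xs = K" "sorted_wrt (<) xs"
    using K(1) by (auto simp: xs_def)
  then have len: "length xs = Suc n"
    using K(3) by (cases xs) (auto simp: n_def)
  define \<tau> where "\<tau> i = (if i \<le> n then xs ! i else t + real (i - n))" for i
  have im: "\<tau> ` {..n} = K"
  proof -
    have "\<tau> ` {..n} = (!) xs ` {..<length xs}"
      unfolding len lessThan_Suc_atMost by (intro image_cong) (auto simp: \<tau>_def)
    also have "\<dots> = set xs"
      by (auto simp: set_conv_nth)
    finally show ?thesis using xs(1) by simp
  qed
  have le: "\<tau> i \<le> t" "0 < \<tau> i" if "i \<le> n" for i
    using im K(2) that by force+
  have less: "\<tau> i < \<tau> j" if "i < j" "j \<le> n" for i j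
    using sorted_wrt_nth_less[OF xs(2), of i j] that len by (simp add: \<tau>_def)
  obtain i where i: "i \<le> n" "\<tau> i = t"
    using im K(3) by (metis (no_types, lifting) atMost_iff imageE)
  have n: "\<tau> n = t"
    using less[of i n] le[of n] i by (cases "i = n") auto
  have "strict_mono \<tau>"
    unfolding strict_mono_Suc_iff
  proof
    fix i
    consider "Suc i \<le> n" | "i = n" | "n < i" by linarith
    then show "\<tau> i < \<tau> (Suc i)"
      using n by cases (auto simp: less, auto simp: \<tau>_def Suc_diff_le)
  qed
  then show ?thesis
    using im n le(2)[of 0] by blast
qed

lemma restrict_mem_cylinder_iff:
  fixes v :: "'i \<Rightarrow> 'd::topological_space"
  assumes "J \<subseteq> I"
  shows "restrict v I \<in> prod_emb I (\<lambda>_. borel) J (Pi\<^sub>E J A) \<longleftrightarrow> (\<forall>j\<in>J. v j \<in> A j)"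
proof -
  have "restrict (restrict v I) J = restrict v J"
    using assms by (simp add: Int_absorb1)
  then show ?thesis
    by (simp add: prod_emb_def PiE_iff)
qed

text \<open>The path \<open>R\<close> on \<open>[0,t]\<close> and the endpoint \<open>b\<close> are stored in one family, with \<open>b\<close> at the index \<open>-1\<close>
  outside the time interval, so that the uniqueness theorem for measures on product spaces covers both. A cylinder over a finite set
  \<open>J\<close> of indices is rewritten with the increasing times of \<open>J\<close> in \<open>]0,t]\<close> and \<open>t\<close>; at times not in
  \<open>J\<close> the condition is void, and at time \<open>0\<close> the value is \<open>0\<close> on both sides.\<close>

lemma endpoint_marked_path_law_eqI:
  fixes R :: "real \<Rightarrow> 'a \<Rightarrow> real" and R' :: "real \<Rightarrow> 'b \<Rightarrow> real"
  assumes M: "prob_space M" and N: "prob_space N" and t: "0 < t"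
    and R: "\<And>u. u \<in> {0..t} \<Longrightarrow> R u \<in> borel_measurable M" "b \<in> borel_measurable M"
      "\<And>\<omega>. \<omega> \<in> space M \<Longrightarrow> R 0 \<omega> = 0"
    and R': "\<And>u. u \<in> {0..t} \<Longrightarrow> R' u \<in> borel_measurable N" "b' \<in> borel_measurable N"
      "\<And>\<omega>. \<omega> \<in> space N \<Longrightarrow> R' 0 \<omega> = 0"
    and eq: "\<And>\<tau> A n. strict_mono \<tau> \<Longrightarrow> 0 < \<tau> 0 \<Longrightarrow> \<tau> n = t \<Longrightarrow> (\<And>i::nat. A i \<in> sets borel) \<Longrightarrow>
      law_on M {\<omega> \<in> space M. \<forall>i\<le>n. R (\<tau> i) \<omega> \<in> A i} (\<lambda>\<omega>. (R t \<omega>, b \<omega>)) =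
      law_on N {\<omega> \<in> space N. \<forall>i\<le>n. R' (\<tau> i) \<omega> \<in> A i} (\<lambda>\<omega>. (R' t \<omega>, b' \<omega>))"
  shows "distr M (PiM (insert (- 1) {0..t}) (\<lambda>_. borel)) (\<lambda>\<omega>. \<lambda>u\<in>insert (- 1) {0..t}. if u = - 1 then b \<omega> else R u \<omega>) =
    distr N (PiM (insert (- 1) {0..t}) (\<lambda>_. borel)) (\<lambda>\<omega>. \<lambda>u\<in>insert (- 1) {0..t}. if u = - 1 then b' \<omega> else R' u \<omega>)"
proof (rule measure_eqI_PiM_infinite[where I = "insert (- 1) {0..t}" and M = "\<lambda>_. borel"])
  let ?I = "insert (- 1) {0..t}"
  let ?X = "\<lambda>\<omega>. \<lambda>u\<in>?I. if u = - 1 then b \<omega> else R u \<omega>"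
  let ?X' = "\<lambda>\<omega>. \<lambda>u\<in>?I. if u = - 1 then b' \<omega> else R' u \<omega>"
  interpret M: prob_space M by fact
  interpret N: prob_space N by fact
  have X: "?X \<in> measurable M (PiM ?I (\<lambda>_. borel))" "?X' \<in> measurable N (PiM ?I (\<lambda>_. borel))"
    using R R' by (auto intro!: measurable_restrict)
  interpret D: prob_space "distr M (PiM ?I (\<lambda>_. borel)) ?X"
    by (rule M.prob_space_distr[OF X(1)])
  show "finite_measure (distr M (PiM ?I (\<lambda>_. borel)) ?X)"
    by (rule D.finite_measure_axioms)
  fix A and J :: "real set" assume J: "finite J" "J \<subseteq> ?I" and A: "\<And>j. j \<in> J \<Longrightarrow> A j \<in> sets (borel :: real measure)"
  have "finite (insert t (J \<inter> {0<..t}))" "insert t (J \<inter> {0<..t}) \<subseteq> {0<..t}" "t \<in> insert t (J \<inter> {0<..t})"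
    using J t by auto
  from strict_mono_enumeration[OF this]
  obtain \<tau> :: "nat \<Rightarrow> real" and n where \<tau>: "strict_mono \<tau>" "0 < \<tau> 0" "\<tau> ` {..n} = insert t (J \<inter> {0<..t})" "\<tau> n = t"
    by blast
  define A' where "A' i = (if \<tau> i \<in> J then A (\<tau> i) else UNIV)" for i
  define C where "C = (if - 1 \<in> J then A (- 1) else UNIV)"
  have A': "A' i \<in> sets borel" for i
    using A by (simp add: A'_def)
  have "(UNIV :: real set) \<times> C \<in> sets (borel \<Otimes>\<^sub>M (borel :: real measure))"
    using A by (intro pair_measureI) (auto simp: C_def)
  then have C: "(UNIV :: real set) \<times> C \<in> sets borel"
    by (simp only: borel_prod)
  have \<tau>_range: "\<tau> i \<in> {0<..t}" if "i \<le> n" for i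
    using \<tau>(3) t that by (metis (no_types, lifting) IntD2 atMost_iff greaterThanAtMost_iff image_eqI insert_iff order.refl)
  have cyl: "{\<omega> \<in> space Q. \<forall>j\<in>J. (if j = - 1 then c \<omega> else S j \<omega>) \<in> A j} =
      (if 0 \<in> J \<and> 0 \<notin> A 0 then {} else {\<omega> \<in> {\<omega> \<in> space Q. \<forall>i\<le>n. S (\<tau> i) \<omega> \<in> A' i}. (S t \<omega>, c \<omega>) \<in> UNIV \<times> C})"
    if S0: "\<And>\<omega>. \<omega> \<in> space Q \<Longrightarrow> S 0 \<omega> = 0" for Q :: "'d measure" and S :: "real \<Rightarrow> 'd \<Rightarrow> real" and c
  proof -
    have "(\<forall>j\<in>J. (if j = - 1 then c \<omega> else S j \<omega>) \<in> A j) \<longleftrightarrow>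
        (0 \<in> J \<longrightarrow> 0 \<in> A 0) \<and> (\<forall>i\<le>n. S (\<tau> i) \<omega> \<in> A' i) \<and> c \<omega> \<in> C" (is "?l \<longleftrightarrow> ?r") if \<omega>: "\<omega> \<in> space Q" for \<omega>
    proof
      assume l: ?l
      have "S (\<tau> i) \<omega> \<in> A' i" if "i \<le> n" for i
        using l \<tau>_range[OF that] by (force simp: A'_def)
      moreover have "c \<omega> \<in> C" "0 \<in> J \<longrightarrow> 0 \<in> A 0"
        using l S0[OF \<omega>] by (force simp: C_def)+
      ultimately show ?r by blast
    next
      assume r: ?r
      show ?l
      proof
        fix j assume j: "j \<in> J"
        consider "j = - 1" | "j = 0" | "j \<in> {0<..t}"
          using j J(2) by force
        then show "(if j = - 1 then c \<omega> else S j \<omega>) \<in> A j"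
        proof cases
          case 3
          then obtain i where "i \<le> n" "j = \<tau> i"
            using \<tau>(3) j by (metis (no_types, lifting) IntI atMost_iff image_iff insert_iff)
          then show ?thesis
            using r 3 j by (auto simp: A'_def)
        qed (use r j S0[OF \<omega>] in \<open>auto simp: C_def\<close>)
      qed
    qed
    then have "{\<omega> \<in> space Q. \<forall>j\<in>J. (if j = - 1 then c \<omega> else S j \<omega>) \<in> A j} =
        {\<omega> \<in> space Q. (0 \<in> J \<longrightarrow> 0 \<in> A 0) \<and> (\<forall>i\<le>n. S (\<tau> i) \<omega> \<in> A' i) \<and> c \<omega> \<in> C}"
      by (intro Collect_cong conj_cong refl)
    then show ?thesis by simp
  qed
  have prob_emb: "emeasure (distr Q (PiM ?I (\<lambda>_. borel)) (\<lambda>\<omega>. \<lambda>u\<in>?I. if u = - 1 then c \<omega> else S u \<omega>))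
      (prod_emb ?I (\<lambda>_. borel) J (Pi\<^sub>E J A)) = emeasure Q {\<omega> \<in> space Q. \<forall>j\<in>J. (if j = - 1 then c \<omega> else S j \<omega>) \<in> A j}"
    if "(\<lambda>\<omega>. \<lambda>u\<in>?I. if u = - 1 then c \<omega> else S u \<omega>) \<in> measurable Q (PiM ?I (\<lambda>_. borel))"
    for Q :: "'d measure" and S :: "real \<Rightarrow> 'd \<Rightarrow> real" and c
  proof (subst emeasure_distr[OF that])
    show "prod_emb ?I (\<lambda>_. borel) J (Pi\<^sub>E J A) \<in> sets (PiM ?I (\<lambda>_. borel))"
      using J A by (intro sets_PiM_I) auto
    show "emeasure Q ((\<lambda>\<omega>. \<lambda>u\<in>?I. if u = - 1 then c \<omega> else S u \<omega>) -` prod_emb ?I (\<lambda>_. borel) J (Pi\<^sub>E J A) \<inter> space Q) =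
        emeasure Q {\<omega> \<in> space Q. \<forall>j\<in>J. (if j = - 1 then c \<omega> else S j \<omega>) \<in> A j}"
      by (intro arg_cong[where f = "emeasure Q"]) (simp only: vimage_def Int_def mem_Collect_eq restrict_mem_cylinder_iff[OF J(2)] conj_commute)
  qed
  let ?E = "{\<omega> \<in> space M. \<forall>i\<le>n. R (\<tau> i) \<omega> \<in> A' i}" and ?E' = "{\<omega> \<in> space N. \<forall>i\<le>n. R' (\<tau> i) \<omega> \<in> A' i}"
  have ev: "{\<omega> \<in> space Q. \<forall>i\<le>n. S (\<tau> i) \<omega> \<in> A' i} \<in> sets Q"
    if S: "\<And>u. u \<in> {0..t} \<Longrightarrow> S u \<in> borel_measurable Q" for Q :: "'d measure" and S :: "real \<Rightarrow> 'd \<Rightarrow> real"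
  proof -
    have "{\<omega> \<in> space Q. \<forall>i\<in>{..n}. S (\<tau> i) \<omega> \<in> A' i} \<in> sets Q"
    proof (rule sets.sets_Collect_countable_All')
      fix i assume "i \<in> {..n}"
      then have "\<tau> i \<in> {0..t}"
        using \<tau>_range[of i] by simp
      from measurable_sets[OF S[OF this] A'[of i]]
      show "{\<omega> \<in> space Q. S (\<tau> i) \<omega> \<in> A' i} \<in> sets Q"
        by (simp add: vimage_def Int_def conj_commute)
    qed simp
    then show ?thesis unfolding Ball_def atMost_iff .
  qed
  have E: "?E \<in> sets M" "?E' \<in> sets N"
    by (rule ev, rule R(1), assumption, rule ev, rule R'(1), assumption)
  have t': "t \<in> {0..t}" using t by simp
  have Z: "(\<lambda>\<omega>. (R t \<omega>, b \<omega>)) \<in> borel_measurable M" "(\<lambda>\<omega>. (R' t \<omega>, b' \<omega>)) \<in> borel_measurable N"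
    by (rule borel_measurable_Pair[OF R(1)[OF t'] R(2)], rule borel_measurable_Pair[OF R'(1)[OF t'] R'(2)])
  have "emeasure M {\<omega> \<in> ?E. (R t \<omega>, b \<omega>) \<in> UNIV \<times> C} = emeasure N {\<omega> \<in> ?E'. (R' t \<omega>, b' \<omega>) \<in> UNIV \<times> C}"
    unfolding M.law_on_facts(3)[OF E(1) Z(1) C, symmetric] N.law_on_facts(3)[OF E(2) Z(2) C, symmetric]
    using eq[OF \<tau>(1,2,4) A'] by simp
  then have "emeasure M (if 0 \<in> J \<and> 0 \<notin> A 0 then {} else {\<omega> \<in> ?E. (R t \<omega>, b \<omega>) \<in> UNIV \<times> C}) =
      emeasure N (if 0 \<in> J \<and> 0 \<notin> A 0 then {} else {\<omega> \<in> ?E'. (R' t \<omega>, b' \<omega>) \<in> UNIV \<times> C})"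
    by (simp only: if_distrib[of "emeasure M"] if_distrib[of "emeasure N"] emeasure_empty)
  then have "emeasure M {\<omega> \<in> space M. \<forall>j\<in>J. (if j = - 1 then b \<omega> else R j \<omega>) \<in> A j} =
      emeasure N {\<omega> \<in> space N. \<forall>j\<in>J. (if j = - 1 then b' \<omega> else R' j \<omega>) \<in> A j}"
    using cyl[of M R b, OF R(3)] cyl[of N R' b', OF R'(3)] by (simp only:)
  then show "emeasure (distr M (PiM ?I (\<lambda>_. borel)) ?X) (prod_emb ?I (\<lambda>_. borel) J (Pi\<^sub>E J A)) =
      emeasure (distr N (PiM ?I (\<lambda>_. borel)) ?X') (prod_emb ?I (\<lambda>_. borel) J (Pi\<^sub>E J A))"
    by (simp only: prob_emb[OF X(1)] prob_emb[OF X(2)])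
qed (simp_all)

lemma continuous_on_restrict_iff: "continuous_on S (restrict f S) \<longleftrightarrow> continuous_on S f"
  by (rule continuous_on_cong) auto

lemma distr_restrict_space_eqI:
  assumes X: "X \<in> measurable M P" "X \<in> space M \<rightarrow> \<Omega>" and Y: "Y \<in> measurable N P" "Y \<in> space N \<rightarrow> \<Omega>"
    and eq: "distr M P X = distr N P Y"
  shows "distr M (restrict_space P \<Omega>) X = distr N (restrict_space P \<Omega>) Y"
proof (rule measure_eqI)
  have m: "X \<in> measurable M (restrict_space P \<Omega>)" "Y \<in> measurable N (restrict_space P \<Omega>)"
    using X Y by (auto intro: measurable_restrict_space2)
  fix A assume "A \<in> sets (distr M (restrict_space P \<Omega>) X)"
  then have A: "A \<in> sets (restrict_space P \<Omega>)" by simp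
  then obtain A' where A': "A' \<in> sets P" "A = \<Omega> \<inter> A'"
    by (auto simp: sets_restrict_space)
  have "emeasure (distr M (restrict_space P \<Omega>) X) A = emeasure (distr M P X) A'"
    unfolding emeasure_distr[OF m(1) A] emeasure_distr[OF X(1) A'(1)]
    using X(2) A' by (auto intro!: arg_cong[where f = "emeasure M"])
  also have "\<dots> = emeasure (distr N (restrict_space P \<Omega>) Y) A"
    unfolding eq emeasure_distr[OF m(2) A] emeasure_distr[OF Y(1) A'(1)]
    using Y(2) A' by (auto intro!: arg_cong[where f = "emeasure N"])
  finally show "emeasure (distr M (restrict_space P \<Omega>) X) A = emeasure (distr N (restrict_space P \<Omega>) Y) A" .
qed simp

text \<open>The map of \<open>reflected_path_inversion\<close>: from the radius on \<open>[0,t]\<close>, with the final position stored at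
  index \<open>-1\<close>, to radius and position at each time. Either process of the theorem is almost surely its image.\<close>

definition recover_pair :: "real \<Rightarrow> (real \<Rightarrow> real) \<Rightarrow> real \<Rightarrow> real \<times> real" where
  "recover_pair t x = (\<lambda>s\<in>{0..t}. (x s, - x s + min (2 * inf_path s t x) (x t + x (- 1))))"

lemma recover_pair_measurable:
  assumes "0 < t"
  shows "recover_pair t \<in> measurable (PiM (insert (- 1) {0..t}) (\<lambda>_. borel)) (PiM {0..t} (\<lambda>_. borel))"
  unfolding recover_pair_def[abs_def] borel_prod[symmetric]
  using assms by (intro measurable_restrict measurable_Pair borel_measurable_add borel_measurable_uminus borel_measurable_min
    borel_measurable_times borel_measurable_const measurable_component_singleton inf_path_measurable) auto

lemma (in standard_brownian_motion) path_pair_measurable: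
  assumes "0 < t"
  shows "path_on t (\<lambda>s \<omega>. (2 * (SUP u\<in>{0..s}. B u \<omega>) - B s \<omega>, B s \<omega>)) \<in> measurable M (PiM {0..t} (\<lambda>_. borel))"
    "path_on t (\<lambda>s \<omega>. (2 * (SUP u\<in>{0..s}. B u \<omega>) - B s \<omega>, B s \<omega>)) \<in> space M \<rightarrow> {f. continuous_on {0..t} f}"
proof -
  show "path_on t (\<lambda>s \<omega>. (2 * (SUP u\<in>{0..s}. B u \<omega>) - B s \<omega>, B s \<omega>)) \<in> measurable M (PiM {0..t} (\<lambda>_. borel))"
    unfolding path_on_def[abs_def] borel_prod[symmetric]
    by (intro measurable_restrict measurable_Pair borel_measurable_diff borel_measurable_times borel_measurable_const
      random_variable_SUP random_variable_at) auto
  show "path_on t (\<lambda>s \<omega>. (2 * (SUP u\<in>{0..s}. B u \<omega>) - B s \<omega>, B s \<omega>)) \<in> space M \<rightarrow> {f. continuous_on {0..t} f}"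
  proof
    fix \<omega> assume \<omega>: "\<omega> \<in> space M"
    have c: "continuous_on {0..t} (\<lambda>u. B u \<omega>)"
      using continuous_path[OF \<omega>] by simp
    have "continuous_on {0..t} (\<lambda>s. (2 * (SUP u\<in>{0..s}. B u \<omega>) - B s \<omega>, B s \<omega>))"
      by (intro continuous_intros continuous_on_running_SUP c)
    then show "path_on t (\<lambda>s \<omega>. (2 * (SUP u\<in>{0..s}. B u \<omega>) - B s \<omega>, B s \<omega>)) \<omega> \<in> {f. continuous_on {0..t} f}"
      unfolding path_on_def mem_Collect_eq continuous_on_restrict_iff .
  qed
qed

lemma (in standard_brownian_motion_3d) continuous_path: 
  assumes "\<omega> \<in> space M"
  shows "continuous_on {0..} (\<lambda>s. W s \<omega>)"
proof -
  have "continuous_on {0..} (\<lambda>s. \<chi> i. W s \<omega> $ i)"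
    using standard_brownian_motion.continuous_paths[OF coordinates assms] by (intro continuous_on_vec_lambda)
  then show ?thesis by simp
qed

lemma norm_vec3: "norm (v :: real ^ 3) = norm (v $ 1, v $ 2, v $ 3)"
  by (simp add: norm_vec_def L2_set_def sum_3 norm_Pair)

text \<open>Unlike for \<open>(2 S - B, B)\<close>, here the pair is by construction \<open>recover_pair\<close> of the norm and the
  endpoint, which also gives measurability.\<close>

lemma (in standard_brownian_motion_3d) path_pair_measurable:
  assumes "0 < t"
  defines "Y \<equiv> \<lambda>s \<omega>. (norm (W s \<omega>), - norm (W s \<omega>) + min (2 * (INF u\<in>{s..t}. norm (W u \<omega>))) (norm (W t \<omega>) + W t \<omega> $ 1))"
  shows "path_on t Y \<in> measurable M (PiM {0..t} (\<lambda>_. borel))"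
    "path_on t Y \<in> space M \<rightarrow> {f. continuous_on {0..t} f}"
    "\<And>\<omega>. \<omega> \<in> space M \<Longrightarrow> path_on t Y \<omega> =
      recover_pair t (\<lambda>u\<in>insert (- 1) {0..t}. if u = - 1 then W t \<omega> $ 1 else norm (W u \<omega>))"
proof -
  have n: "continuous_on {0..t} (\<lambda>u. norm (W u \<omega>))" if "\<omega> \<in> space M" for \<omega>
    by (intro continuous_on_norm continuous_on_subset[OF continuous_path[OF that]]) auto
  have nm: "(\<lambda>\<omega>. norm (W u \<omega>)) \<in> borel_measurable M" if "0 \<le> u" for u
  proof -
    have "(\<lambda>\<omega>. (W u \<omega> $ 1, W u \<omega> $ 2, W u \<omega> $ 3)) \<in> borel_measurable M"
      unfolding borel_prod[symmetric] by (intro measurable_Pair coordinate_measurable that)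
    then show ?thesis
      unfolding norm_vec3 by (rule measurable_compose) measurable
  qed
  show rb: "path_on t Y \<omega> = recover_pair t (\<lambda>u\<in>insert (- 1) {0..t}. if u = - 1 then W t \<omega> $ 1 else norm (W u \<omega>))"
    if \<omega>: "\<omega> \<in> space M" for \<omega>
    unfolding path_on_def recover_pair_def
  proof (rule restrict_ext)
    let ?x = "\<lambda>u\<in>insert (- 1) {0..t}. if u = - 1 then W t \<omega> $ 1 else norm (W u \<omega>)"
    fix s assume s: "s \<in> {0..t}"
    have "inf_path s t ?x = inf_path s t (\<lambda>u. norm (W u \<omega>))"
      using s by (intro inf_path_cong) auto
    also have "\<dots> = (INF u\<in>{s..t}. norm (W u \<omega>))"
      using s by (intro inf_path_eq[symmetric] continuous_on_subset[OF n[OF \<omega>]]) auto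
    finally show "Y s \<omega> = (?x s, - ?x s + min (2 * inf_path s t ?x) (?x t + ?x (- 1)))"
      using s by (auto simp: Y_def)
  qed
  have c1: "(\<lambda>\<omega>. W t \<omega> $ 1) \<in> borel_measurable M"
    using assms(1) by (intro coordinate_measurable) simp
  have "(\<lambda>\<omega>. recover_pair t (\<lambda>u\<in>insert (- 1) {0..t}. if u = - 1 then W t \<omega> $ 1 else norm (W u \<omega>))) \<in> measurable M (PiM {0..t} (\<lambda>_. borel))"
    using assms(1) by (intro measurable_compose[OF _ recover_pair_measurable] measurable_restrict) (auto intro: nm c1)
  then show "path_on t Y \<in> measurable M (PiM {0..t} (\<lambda>_. borel))"
    using rb by (simp cong: measurable_cong)
  show "path_on t Y \<in> space M \<rightarrow> {f. continuous_on {0..t} f}"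
  proof
    fix \<omega> assume \<omega>: "\<omega> \<in> space M"
    have "continuous_on {0..t} (\<lambda>s. Y s \<omega>)"
      unfolding Y_def by (intro continuous_intros continuous_on_future_INF n[OF \<omega>] continuous_on_subset[OF continuous_path[OF \<omega>]]) auto
    then show "path_on t Y \<omega> \<in> {f. continuous_on {0..t} f}"
      unfolding path_on_def mem_Collect_eq continuous_on_restrict_iff .
  qed
qed

theorem theorem1p1:
  fixes t :: real
    and M :: "'a measure" and B :: "real \<Rightarrow> 'a \<Rightarrow> real"
    and N :: "'b measure" and W :: "real \<Rightarrow> 'b \<Rightarrow> real ^ 3"
  assumes "0 < t"
    and "standard_brownian_motion M B"
    and "standard_brownian_motion_3d N W"
  shows "identical_in_law_on t
    M (\<lambda>s \<omega>. (2 * (SUP u\<in>{0..s}. B u \<omega>) - B s \<omega>, B s \<omega>))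
    N (\<lambda>s \<omega>. (norm (W s \<omega>),
          - norm (W s \<omega>) +
            min (2 * (INF u\<in>{s..t}. norm (W u \<omega>))) (norm (W t \<omega>) + W t \<omega> $ 1)))"
proof -
  let ?X = "\<lambda>s \<omega>. (2 * (SUP u\<in>{0..s}. B u \<omega>) - B s \<omega>, B s \<omega>)"
  let ?Y = "\<lambda>s \<omega>. (norm (W s \<omega>), - norm (W s \<omega>) + min (2 * (INF u\<in>{s..t}. norm (W u \<omega>))) (norm (W t \<omega>) + W t \<omega> $ 1))"
  let ?I = "insert (- 1) {0..t}" and ?P = "PiM {0..t} (\<lambda>_. borel :: (real \<times> real) measure)"
  note t = \<open>0 < t\<close>
  interpret B: standard_brownian_motion M B by fact
  interpret W: standard_brownian_motion_3d N W by fact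
  interpret B0: pinned_brownian_motion M "\<lambda>u \<omega>. B u \<omega> - B 0 \<omega>"
    using B.shifted_increments_pinned[of 0] by simp
  let ?S = "\<lambda>\<omega>. \<lambda>u\<in>?I. if u = - 1 then B t \<omega> - B 0 \<omega> else B0.pitman u \<omega>"
  let ?T = "\<lambda>\<omega>. \<lambda>u\<in>?I. if u = - 1 then fst (W.increment 0 t \<omega>) else norm (W.increment 0 u \<omega>)"
  have end_m: "(\<lambda>\<omega>. B t \<omega> - B 0 \<omega>) \<in> borel_measurable M"
    using t by (intro borel_measurable_diff B.random_variable_at) auto
  have S: "?S \<in> measurable M (PiM ?I (\<lambda>_. borel))"
    using t by (intro measurable_restrict) (auto intro: B0.pitman_measurable end_m)
  have fst_m: "(\<lambda>\<omega>. fst (W.increment 0 t \<omega>)) \<in> borel_measurable N"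
    unfolding W.increment_def fst_conv using t by (intro borel_measurable_diff W.coordinate_measurable) auto
  have norm_m: "(\<lambda>\<omega>. norm (W.increment 0 u \<omega>)) \<in> borel_measurable N" if "0 \<le> u" for u
    using W.increment_measurable[OF order.refl that] by measurable
  have T: "?T \<in> measurable N (PiM ?I (\<lambda>_. borel))"
    using t by (intro measurable_restrict) (auto intro: fst_m norm_m)
  have laws: "distr M (PiM ?I (\<lambda>_. borel)) ?S = distr N (PiM ?I (\<lambda>_. borel)) ?T"
  proof (rule endpoint_marked_path_law_eqI[where R = B0.pitman and R' = "\<lambda>u \<omega>. norm (W.increment 0 u \<omega>)"])
    fix \<tau> :: "nat \<Rightarrow> real" and A :: "nat \<Rightarrow> real set" and n
    assume \<tau>: "strict_mono \<tau>" "0 < \<tau> 0" "\<tau> n = t" and A: "\<And>i. A i \<in> sets borel"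
    show "law_on M {\<omega> \<in> space M. \<forall>i\<le>n. B0.pitman (\<tau> i) \<omega> \<in> A i} (\<lambda>\<omega>. (B0.pitman t \<omega>, B t \<omega> - B 0 \<omega>)) =
        law_on N {\<omega> \<in> space N. \<forall>i\<le>n. norm (W.increment 0 (\<tau> i) \<omega>) \<in> A i}
          (\<lambda>\<omega>. (norm (W.increment 0 t \<omega>), fst (W.increment 0 t \<omega>)))"
      using B0.pitman_finite_dimensional_law[OF \<tau>(2,1) A, of n] W.norm_finite_dimensional_law[OF \<tau>(2,1) A, of n] \<tau>(3)
      by simp
  next
    show "B0.pitman 0 \<omega> = 0" for \<omega>
      by (simp add: B0.pitman_def)
    show "norm (W.increment 0 0 \<omega>) = 0" for \<omega>
      by (simp add: W.increment_def zero_prod_def)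
  qed (use t in \<open>auto intro: B.prob_space_axioms W.prob_space_axioms B0.pitman_measurable fst_m norm_m end_m\<close>)
  \<comment> \<open>On the event \<open>B 0 = 0\<close> the pinned motion is \<open>B\<close> itself, and the pathwise inversion applies.\<close>
  have X_eq: "AE \<omega> in M. path_on t ?X \<omega> = recover_pair t (?S \<omega>)"
    using B.starts_at_0 AE_space
  proof eventually_elim
    case (elim \<omega>)
    have c: "continuous_on {0..t} (\<lambda>u. B u \<omega>)"
      using B.continuous_path[OF elim(2)] by simp
    let ?m = "\<lambda>u. SUP v\<in>{0..u}. B v \<omega>"
    have pit: "B0.pitman u \<omega> = 2 * ?m u - B u \<omega>" for u
      using elim(1) by (simp add: B0.pitman_def)
    have cR: "continuous_on {0..t} (\<lambda>u. 2 * ?m u - B u \<omega>)"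
      by (intro continuous_intros continuous_on_running_SUP c)
    show ?case
      unfolding path_on_def recover_pair_def
    proof (rule restrict_ext)
      fix s assume s: "s \<in> {0..t}"
      have cR': "continuous_on {s..t} (\<lambda>u. 2 * ?m u - B u \<omega>)"
        using s by (intro continuous_on_subset[OF cR]) auto
      have "inf_path s t (?S \<omega>) = inf_path s t (\<lambda>u. 2 * ?m u - B u \<omega>)"
        using s pit by (intro inf_path_cong) auto
      also have "\<dots> = (INF u\<in>{s..t}. 2 * ?m u - B u \<omega>)"
        using s by (intro inf_path_eq[symmetric] cR') auto
      finally have "min (2 * inf_path s t (?S \<omega>)) (2 * ?m t) = 2 * ?m s"
        using reflected_path_inversion[OF c _ _ cR'] s by simp
      then show "?X s \<omega> = (?S \<omega> s, - ?S \<omega> s + min (2 * inf_path s t (?S \<omega>)) (?S \<omega> t + ?S \<omega> (- 1)))"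
        using s t pit elim(1) by simp
    qed
  qed
  have W0: "AE \<omega> in N. W 0 \<omega> $ 1 = 0 \<and> W 0 \<omega> $ 2 = 0 \<and> W 0 \<omega> $ 3 = 0"
    using standard_brownian_motion.starts_at_0[OF W.coordinates] by (intro AE_conjI)
  have Y_eq: "AE \<omega> in N. path_on t ?Y \<omega> = recover_pair t (?T \<omega>)"
    using W0 AE_space
  proof eventually_elim
    case (elim \<omega>)
    have "?T \<omega> = (\<lambda>u\<in>?I. if u = - 1 then W t \<omega> $ 1 else norm (W u \<omega>))"
      using elim(1) by (intro restrict_ext) (simp add: W.increment_def norm_vec3)
    then show ?case
      using W.path_pair_measurable(3)[OF t elim(2)] by simp
  qed
  have "distr M ?P (path_on t ?X) = distr M ?P (\<lambda>\<omega>. recover_pair t (?S \<omega>))"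
    by (rule distr_cong_AE[OF refl refl X_eq B.path_pair_measurable(1)[OF t] measurable_compose[OF S recover_pair_measurable[OF t]]])
  also have "\<dots> = distr (distr M (PiM ?I (\<lambda>_. borel)) ?S) ?P (recover_pair t)"
    by (simp add: distr_distr[OF recover_pair_measurable[OF t] S] comp_def)
  also have "\<dots> = distr N ?P (\<lambda>\<omega>. recover_pair t (?T \<omega>))"
    unfolding laws by (simp add: distr_distr[OF recover_pair_measurable[OF t] T] comp_def)
  also have "\<dots> = distr N ?P (path_on t ?Y)"
    by (rule distr_cong_AE[OF refl refl Y_eq W.path_pair_measurable(1)[OF t] measurable_compose[OF T recover_pair_measurable[OF t]], symmetric])
  finally have "distr M (path_space t) (path_on t ?X) = distr N (path_space t) (path_on t ?Y)"
    unfolding path_space_def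
    by (rule distr_restrict_space_eqI[OF B.path_pair_measurable[OF t] W.path_pair_measurable(1,2)[OF t]])
  then show ?thesis
    unfolding identical_in_law_on_def path_space_def
    using B.path_pair_measurable[OF t] W.path_pair_measurable(1,2)[OF t]
    by (auto intro!: measurable_restrict_space2)
qed

end
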